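(* Let $K$ be an algebraically closed field of characteristic not $2$ or $3$, let $N$ and $k$ be positive integers, and let $F$ be a form of degree $4$ in the polynomial ring $R=K[x_1,\ldots,x_N]$. If $F$ is $\bigl(6k(k+1)4^{k(k+1)}+(k+1)^2\bigr)$-strong, then there is a Zariski dense open subset of $\mathcal{D}F$ all of whose elements are $k$-strong. That is, $\mathfrak{K}_4(k)=6k(k+1)4^{k(k+1)}+(k+1)^2$ is a key function for degree $4$ and characteristics different from $2$ and $3$.
   Context: $\mathcal{D}F$ is the $K$-vector space spanned by the partial derivatives $\partial F/\partial x_1,\ldots,\partial F/\partial x_N$. A form $F$ has a $k$-collapse if $F=\sum_{i=1}^{k}G_iH_i$, where each $G_i$ is a form of positive degree strictly less than $\deg F$ (or is $0$) and each $H_i$ is a form of degree $\deg F-\deg G_i$ (or is $0$). $F$ is $k$-strong if it has no $k$-collapse (so $0$ is not $k$-strong). A function $\mathfrak{K}_i$ is a key function for degree $i$ and a set $\mathcal{S}$ of characteristics if, independently of the algebraically closed field $K$ with characteristic in $\mathcal{S}$ and of the number of variables $N$, for any form $F$ of degree $i$ in $K[x_1,\ldots,x_N]$, if $F$ is $\mathfrak{K}_i(k)$-strong then the elements in a Zariski dense open subset of $\mathcal{D}F$ are $k$-strong. *)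

theory Defs
  imports
    "HOL-Analysis.Abstract_Topology"
    "HOL-Library.Poly_Mapping"
    "HOL-Computational_Algebra.Polynomial"
begin

section \<open>Polynomials\<close>

text \<open>
  A monomial is its finitely supported exponent vector, so multiplication of polynomials
  is the convolution product of \<^theory>\<open>HOL-Library.Poly_Mapping\<close>. The variables are
  indexed by all natural numbers; the ring in the variables $x_1, \dots, x_N$ is the
  carrier \<open>mpolys N\<close>.
\<close>

type_synonym 'a mpoly = "(nat \<Rightarrow>\<^sub>0 nat) \<Rightarrow>\<^sub>0 'a"

definition mpolys :: "nat \<Rightarrow> 'a::zero mpoly set" where
  "mpolys N = {p. \<forall>m \<in> Poly_Mapping.keys p. Poly_Mapping.keys m \<subseteq> {1..N}}"

definition monom_degree :: "(nat \<Rightarrow>\<^sub>0 nat) \<Rightarrow> nat" where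
  "monom_degree m = (\<Sum>i\<in>Poly_Mapping.keys m. Poly_Mapping.lookup m i)"

text \<open>The zero polynomial gets degree \<open>0\<close>.\<close>

definition total_degree :: "'a::zero mpoly \<Rightarrow> nat" where
  "total_degree p = Max (insert 0 (monom_degree ` Poly_Mapping.keys p))"

text \<open>Forms are nonzero; where zero is admitted, it is mentioned separately.\<close>

definition is_form :: "nat \<Rightarrow> nat \<Rightarrow> 'a::zero mpoly \<Rightarrow> bool" where
  "is_form N d p \<longleftrightarrow> p \<in> mpolys N \<and> p \<noteq> 0 \<and> (\<forall>m \<in> Poly_Mapping.keys p. monom_degree m = d)"

lemma total_degree_form:
  assumes "is_form N d p"
  shows "total_degree p = d"
proof -
  have "Poly_Mapping.keys p \<noteq> {}" "\<forall>m \<in> Poly_Mapping.keys p. monom_degree m = d"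
    using assms by (simp_all add: is_form_def)
  then have "monom_degree ` Poly_Mapping.keys p = {d}"
    by (metis image_cong image_constant_conv)
  then show ?thesis
    by (simp add: total_degree_def)
qed

definition scale_mpoly :: "'a::comm_semiring_1 \<Rightarrow> 'a mpoly \<Rightarrow> 'a mpoly" where
  "scale_mpoly c p = Poly_Mapping.single 0 c * p"

global_interpretation mpoly: vector_space "scale_mpoly :: 'a::field \<Rightarrow> 'a mpoly \<Rightarrow> 'a mpoly"
proof
  fix a b :: 'a and x y :: "'a mpoly"
  show "scale_mpoly a (x + y) = scale_mpoly a x + scale_mpoly a y"
    by (simp add: scale_mpoly_def distrib_left)
  show "scale_mpoly (a + b) x = scale_mpoly a x + scale_mpoly b x"
    by (simp add: scale_mpoly_def single_add distrib_right)
  show "scale_mpoly a (scale_mpoly b x) = scale_mpoly (a * b) x"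
    by (simp add: scale_mpoly_def mult_single flip: mult.assoc)
  show "scale_mpoly 1 x = x"
    by (simp add: scale_mpoly_def)
qed

text \<open>
  If \<open>x\<^sub>i\<close> does not divide the monomial \<open>m\<close>, then \<open>m - single i 1\<close> is \<open>m\<close> by truncated
  subtraction, but the coefficient \<open>lookup m i\<close> is \<open>0\<close>.
\<close>

definition partial_deriv :: "nat \<Rightarrow> 'a::comm_semiring_1 mpoly \<Rightarrow> 'a mpoly" where
  "partial_deriv i p =
     (\<Sum>m\<in>Poly_Mapping.keys p. Poly_Mapping.single (m - Poly_Mapping.single i 1)
                    (of_nat (Poly_Mapping.lookup m i) * Poly_Mapping.lookup p m))"

definition deriv_span :: "nat \<Rightarrow> 'a::field mpoly \<Rightarrow> 'a mpoly set" where
  "deriv_span N F = mpoly.span ((\<lambda>i. partial_deriv i F) ` {1..N})"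


section \<open>Strength\<close>

definition has_collapse :: "nat \<Rightarrow> nat \<Rightarrow> 'a::comm_semiring_1 mpoly \<Rightarrow> bool" where
  "has_collapse N k F \<longleftrightarrow>
     (\<exists>G H. F = (\<Sum>i=1..k. G i * H i) \<and>
        (\<forall>i\<in>{1..k}.
           (G i = 0 \<or> (\<exists>d. 0 < d \<and> d < total_degree F \<and> is_form N d (G i))) \<and>
           (H i = 0 \<or> is_form N (total_degree F - total_degree (G i)) (H i))))"

definition strong :: "nat \<Rightarrow> nat \<Rightarrow> 'a::comm_semiring_1 mpoly \<Rightarrow> bool" where
  "strong N k F \<longleftrightarrow> \<not> has_collapse N k F"

lemma not_strong_zero: "\<not> strong N k 0"
  unfolding strong_def has_collapse_def by (auto intro!: exI[of _ "\<lambda>_. 0"])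


section \<open>The Zariski topology on a vector space\<close>

text \<open>
  The regular functions are the \<open>K\<close>-algebra of functions generated by the linear
  functionals, i.e. the polynomials in the coordinates with respect to any basis. On a
  subspace they restrict to the regular functions of the subspace, since every linear
  functional on a subspace extends to the whole space.
\<close>

inductive_set regular_functions :: "('a::field \<Rightarrow> 'v::ab_group_add \<Rightarrow> 'v) \<Rightarrow> ('v \<Rightarrow> 'a) set"
  for scale :: "'a \<Rightarrow> 'v \<Rightarrow> 'v" where
  const: "(\<lambda>_. c) \<in> regular_functions scale"
| linear: "Vector_Spaces.linear scale (*) l \<Longrightarrow> l \<in> regular_functions scale"
| add: "f \<in> regular_functions scale \<Longrightarrow> g \<in> regular_functions scale \<Longrightarrow>
    (\<lambda>v. f v + g v) \<in> regular_functions scale"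
| mult: "f \<in> regular_functions scale \<Longrightarrow> g \<in> regular_functions scale \<Longrightarrow>
    (\<lambda>v. f v * g v) \<in> regular_functions scale"

definition zariski_open :: "('a::field \<Rightarrow> 'v::ab_group_add \<Rightarrow> 'v) \<Rightarrow> 'v set \<Rightarrow> 'v set \<Rightarrow> bool" where
  "zariski_open scale V U \<longleftrightarrow>
     (\<exists>S \<subseteq> regular_functions scale. U = V - {v \<in> V. \<forall>f\<in>S. f v = 0})"

definition zariski_topology :: "('a::field \<Rightarrow> 'v::ab_group_add \<Rightarrow> 'v) \<Rightarrow> 'v set \<Rightarrow> 'v topology" where
  "zariski_topology scale V = topology (zariski_open scale V)"

lemma istopology_zariski_open: "istopology (zariski_open scale V)"
  unfolding istopology_def
proof (intro conjI allI impI)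
  fix U W assume "zariski_open scale V U" "zariski_open scale V W"
  then obtain S T where S: "S \<subseteq> regular_functions scale" "U = V - {v \<in> V. \<forall>f\<in>S. f v = 0}"
    and T: "T \<subseteq> regular_functions scale" "W = V - {v \<in> V. \<forall>f\<in>T. f v = 0}"
    unfolding zariski_open_def by auto
  let ?P = "(\<lambda>(f, g) v. f v * g v) ` (S \<times> T)"
  have "?P \<subseteq> regular_functions scale"
    using S(1) T(1) by (auto intro: regular_functions.mult)
  moreover have "U \<inter> W = V - {v \<in> V. \<forall>f\<in>?P. f v = 0}"
    unfolding S(2) T(2) by auto
  ultimately show "zariski_open scale V (U \<inter> W)"
    unfolding zariski_open_def by blast
next
  fix \<U> assume "\<forall>U\<in>\<U>. zariski_open scale V U"
  then have "\<forall>U\<in>\<U>. \<exists>S. S \<subseteq> regular_functions scale \<and> U = V - {v \<in> V. \<forall>f\<in>S. f v = 0}"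
    by (simp only: zariski_open_def)
  from bchoice[OF this] obtain S where *: "\<forall>U\<in>\<U>. S U \<subseteq> regular_functions scale \<and>
      U = V - {v \<in> V. \<forall>f\<in>S U. f v = 0}" ..
  have S: "\<And>U. U \<in> \<U> \<Longrightarrow> S U \<subseteq> regular_functions scale"
      "\<And>U. U \<in> \<U> \<Longrightarrow> U = V - {v \<in> V. \<forall>f\<in>S U. f v = 0}"
    by (rule conjunct1[OF bspec[OF *]], assumption) (rule conjunct2[OF bspec[OF *]])
  have "(\<Union>U\<in>\<U>. U) = (\<Union>U\<in>\<U>. V - {v \<in> V. \<forall>f\<in>S U. f v = 0})"
    by (rule SUP_cong[OF refl S(2)])
  then have "\<Union>\<U> = (\<Union>U\<in>\<U>. V - {v \<in> V. \<forall>f\<in>S U. f v = 0})"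
    by simp
  also have "\<dots> = V - {v \<in> V. \<forall>f\<in>\<Union>(S ` \<U>). f v = 0}"
    by auto
  finally have "\<Union>\<U> = V - {v \<in> V. \<forall>f\<in>\<Union>(S ` \<U>). f v = 0}" .
  moreover have "\<Union>(S ` \<U>) \<subseteq> regular_functions scale"
    by (rule UN_least[OF S(1)])
  ultimately show "zariski_open scale V (\<Union>\<U>)"
    unfolding zariski_open_def by blast
qed

lemma openin_zariski_topology: "openin (zariski_topology scale V) = zariski_open scale V"
  unfolding zariski_topology_def by (rule topology_inverse'[OF istopology_zariski_open])

lemma topspace_zariski_topology: "topspace (zariski_topology scale V) = V"
proof
  show "topspace (zariski_topology scale V) \<subseteq> V"
    unfolding topspace_def openin_zariski_topology zariski_open_def by auto
  have "zariski_open scale V V"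
    unfolding zariski_open_def
    by (rule exI[of _ "{\<lambda>_. 1}"]) (auto intro: regular_functions.const)
  then show "V \<subseteq> topspace (zariski_topology scale V)"
    unfolding topspace_def openin_zariski_topology by auto
qed

definition zariski_dense_open :: "('a::field \<Rightarrow> 'v::ab_group_add \<Rightarrow> 'v) \<Rightarrow> 'v set \<Rightarrow> 'v set \<Rightarrow> bool" where
  "zariski_dense_open scale V U \<longleftrightarrow>
     openin (zariski_topology scale V) U \<and> zariski_topology scale V closure_of U = V"


section \<open>Key functions\<close>

text \<open>
  The field is a type, so being a key function is stated for one algebraically closed
  field \<open>'a\<close> at a time; independence of the field is expressed by leaving \<open>'a\<close> arbitrary
  while \<open>\<kappa>\<close> does not depend on it.
\<close>

definition key_function ::
    "'a::alg_closed_field itself \<Rightarrow> nat \<Rightarrow> nat set \<Rightarrow> (nat \<Rightarrow> nat) \<Rightarrow> bool" where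
  "key_function _ d S \<kappa> \<longleftrightarrow>
     (CHAR('a) \<in> S \<longrightarrow>
      (\<forall>N>0. \<forall>k>0. \<forall>F :: 'a mpoly.
         is_form N d F \<longrightarrow> strong N (\<kappa> k) F \<longrightarrow>
         (\<exists>U. zariski_dense_open scale_mpoly (deriv_span N F) U \<and> (\<forall>G\<in>U. strong N k G))))"

end

theory Submission
  imports Defs
begin

text \<open>
  A cubic form with a \<open>k\<close>-collapse is a sum of \<open>k\<close> products of a linear and a quadratic form, and so it
  vanishes on a subspace of codimension at most \<open>k\<close>. Suppose that this happens for a Zariski dense set
  of derivatives of a quartic form \<open>F\<close>. Then \<open>F\<close> has a \<open>6k\<close>-collapse
  (\<open>quartic_collapse_if_derivatives_collapse\<close>), and \<open>6k\<close> is below the given bound. Otherwise the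
  derivatives outside the closure of that set are \<open>k\<close>-strong and contain a nonempty principal open set,
  which is dense because the space of derivatives is irreducible.

  For the collapse, let \<open>T\<close> be the symmetric tensor of \<open>F\<close>, which determines \<open>F\<close> as the characteristic
  is not \<open>2\<close> or \<open>3\<close>. For a direction \<open>v\<close> as above let \<open>U\<close> be the subspace on which the derivative along
  \<open>v\<close> vanishes. By polarization \<open>T v x\<close> vanishes on \<open>U \<times> U\<close> for all \<open>x\<close> in \<open>U\<close>, so as a matrix it has
  rank at most \<open>2k\<close>. Let \<open>X\<close> be an irreducible variety in the closure of the set of such pairs
  \<open>(v, x)\<close> that dominates the space of all \<open>v\<close> together with all but \<open>k\<close> coordinates of \<open>x\<close>. It has
  codimension at most \<open>k\<close>, and its conormal space at the generic point has at most this dimension (\<open>locally_generated_mpoly\<close>,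
  \<open>ex_local_equations\<close>). Now follow the matrix \<open>T v x\<close> to second order along an arc in \<open>X\<close> with initial
  direction \<open>(w, w)\<close> (\<open>second_order_lift\<close>). Its rank stays bounded, so on the kernel of \<open>T v x\<close> the
  second-order term is a Schur complement, a quadratic form of rank at most \<open>2k\<close> in a vector whose
  entries are quadratic in \<open>w\<close>. This second-order term is \<open>T w w\<close> plus a contribution of the second-order
  part of the arc, which may be taken to lie in at most \<open>k\<close> fixed directions with coefficients that are
  quadratic in \<open>w\<close>. For \<open>w\<close> subject to \<open>k\<close> tangency conditions and \<open>2k\<close> kernel conditions, \<open>T w w w w\<close>
  is thus a sum of \<open>k + 2k\<close> products of quadratic forms (\<open>quartic_decomposition\<close>). Hence \<open>F\<close> is a sum of
  \<open>3k\<close> such products modulo \<open>3k\<close> linear forms.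

  In positive characteristic \<open>X\<close> may be inseparable over the space of directions \<open>v\<close>, so that the
  subspaces \<open>U\<close> cannot be differentiated as functions of \<open>v\<close>. This is why \<open>v\<close> and \<open>x\<close> move together:
  the tangent space of \<open>X\<close> has codimension at most \<open>k\<close> in the space of pairs, however it lies over the
  space of directions.
\<close>

section \<open>Evaluation of polynomials\<close>

abbreviation cst :: "'a::comm_ring_1 \<Rightarrow> 'a mpoly" where
  "cst c \<equiv> Poly_Mapping.single 0 c"

definition var :: "nat \<Rightarrow> 'a::comm_ring_1 mpoly" where
  "var i = Poly_Mapping.single (Poly_Mapping.single i 1) 1"

definition monom_val :: "(nat \<Rightarrow> 'a::comm_ring_1) \<Rightarrow> (nat \<Rightarrow>\<^sub>0 nat) \<Rightarrow> 'a" where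
  "monom_val x m = (\<Prod>i\<in>Poly_Mapping.keys m. x i ^ Poly_Mapping.lookup m i)"

definition ev :: "(nat \<Rightarrow> 'a::comm_ring_1) \<Rightarrow> 'a mpoly \<Rightarrow> 'a" where
  "ev x p = (\<Sum>m\<in>Poly_Mapping.keys p. Poly_Mapping.lookup p m * monom_val x m)"

lemma sum_singles:
  "(p :: 'b \<Rightarrow>\<^sub>0 'c::comm_monoid_add) =
    (\<Sum>m\<in>Poly_Mapping.keys p. Poly_Mapping.single m (Poly_Mapping.lookup p m))"
proof (rule poly_mapping_eqI)
  fix k
  have "Poly_Mapping.lookup
      (\<Sum>m\<in>Poly_Mapping.keys p. Poly_Mapping.single m (Poly_Mapping.lookup p m)) k
      = (\<Sum>m\<in>Poly_Mapping.keys p. if m = k then Poly_Mapping.lookup p k else 0)"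
    by (auto simp: lookup_sum lookup_single when_def intro!: sum.cong)
  also have "\<dots> = Poly_Mapping.lookup p k"
    by (simp add: not_in_keys_iff_lookup_eq_zero)
  finally show "Poly_Mapping.lookup p k = Poly_Mapping.lookup
      (\<Sum>m\<in>Poly_Mapping.keys p. Poly_Mapping.single m (Poly_Mapping.lookup p m)) k" by simp
qed

lemma singles_induct [case_names zero single add]:
  fixes p :: "'b \<Rightarrow>\<^sub>0 'c::comm_monoid_add"
  assumes "Q 0" "\<And>m c. m \<in> Poly_Mapping.keys p \<Longrightarrow> Q (Poly_Mapping.single m c)"
    and "\<And>p q. Q p \<Longrightarrow> Q q \<Longrightarrow> Q (p + q)"
  shows "Q p"
proof -
  have "Q (\<Sum>m\<in>A. Poly_Mapping.single m (Poly_Mapping.lookup p m))"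
    if "finite A" "A \<subseteq> Poly_Mapping.keys p" for A
    using that by (induction A rule: finite_induct) (auto intro: assms)
  from this[of "Poly_Mapping.keys p"] show ?thesis
    by (simp flip: sum_singles)
qed

lemma monom_val_superset:
  assumes "finite A" "Poly_Mapping.keys m \<subseteq> A"
  shows "monom_val x m = (\<Prod>i\<in>A. x i ^ Poly_Mapping.lookup m i)"
  unfolding monom_val_def
  by (rule prod.mono_neutral_left) (use assms in \<open>auto simp: in_keys_iff\<close>)

lemma monom_val_add: "monom_val x (m + n) = monom_val x m * monom_val x n"
proof -
  let ?A = "Poly_Mapping.keys m \<union> Poly_Mapping.keys n"
  have "monom_val x (m + n) = (\<Prod>i\<in>?A. x i ^ Poly_Mapping.lookup (m + n) i)"
    by (rule monom_val_superset) (use keys_add[of m n] in auto)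
  then show ?thesis
    by (simp add: lookup_add power_add prod.distrib
        monom_val_superset[of ?A m] monom_val_superset[of ?A n])
qed

lemma monom_val_zero [simp]: "monom_val x 0 = 1"
  by (simp add: monom_val_def)

lemma ev_superset:
  assumes "finite A" "Poly_Mapping.keys p \<subseteq> A"
  shows "ev x p = (\<Sum>m\<in>A. Poly_Mapping.lookup p m * monom_val x m)"
  unfolding ev_def
  by (rule sum.mono_neutral_left) (use assms in \<open>auto simp: in_keys_iff\<close>)

lemma ev_add [simp]: "ev x (p + q) = ev x p + ev x q"
proof -
  let ?A = "Poly_Mapping.keys p \<union> Poly_Mapping.keys q"
  have "ev x (p + q) = (\<Sum>m\<in>?A. Poly_Mapping.lookup (p + q) m * monom_val x m)"
    by (rule ev_superset) (use keys_add[of p q] in auto)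
  then show ?thesis
    by (simp add: lookup_add distrib_right sum.distrib
        ev_superset[of ?A p] ev_superset[of ?A q])
qed

lemma ev_zero [simp]: "ev x 0 = 0"
  by (simp add: ev_def)

lemma ev_single: "ev x (Poly_Mapping.single m c) = c * monom_val x m"
  by (simp add: ev_superset[of "{m}"])

lemma ev_cst [simp]: "ev x (cst c) = c"
  by (simp add: ev_single)

lemma ev_one [simp]: "ev x 1 = 1"
  using ev_cst[of x 1] by simp

lemma ev_var [simp]: "ev x (var i) = x i"
  by (simp add: var_def ev_single monom_val_def)

lemma ev_mult [simp]: "ev x (p * q) = ev x p * ev x q"
proof (induction p rule: singles_induct)
  case (single m c)
  show ?case
    by (induction q rule: singles_induct)
      (auto simp: mult_single ev_single monom_val_add algebra_simps)
qed (auto simp: algebra_simps)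

lemma ev_uminus [simp]: "ev x (- p) = - ev x p"
  by (metis add.right_inverse add_eq_0_iff ev_add ev_zero)

lemma ev_diff [simp]: "ev x (p - q) = ev x p - ev x q"
  using ev_add[of x p "- q"] by simp

lemma ev_sum [simp]: "ev x (sum f A) = (\<Sum>a\<in>A. ev x (f a))"
  by (induction A rule: infinite_finite_induct) auto

lemma ev_prod [simp]: "ev x (prod f A) = (\<Prod>a\<in>A. ev x (f a))"
  by (induction A rule: infinite_finite_induct) auto

lemma ev_power [simp]: "ev x (p ^ n) = ev x p ^ n"
  by (induction n) auto


section \<open>Polynomials in a given set of variables\<close>

definition mpvars :: "nat set \<Rightarrow> 'a::zero mpoly set" where
  "mpvars V = {p. \<forall>m\<in>Poly_Mapping.keys p. Poly_Mapping.keys m \<subseteq> V}"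

lemma mpolys_eq_mpvars: "mpolys N = mpvars {1..N}"
  by (simp add: mpolys_def mpvars_def)

lemma mpvars_UNIV [simp]: "mpvars UNIV = UNIV"
  by (simp add: mpvars_def)

lemma mpvars_zero [simp]: "0 \<in> mpvars V"
  by (simp add: mpvars_def)

lemma mpvars_cst [simp]: "cst c \<in> mpvars V"
  by (simp add: mpvars_def)

lemma mpvars_one [simp]: "1 \<in> (mpvars V :: 'a::comm_ring_1 mpoly set)"
  by (simp add: mpvars_def)

lemma mpvars_var [simp]: "i \<in> V \<Longrightarrow> var i \<in> mpvars V"
  by (simp add: mpvars_def var_def)

lemma mpvars_add: "p \<in> mpvars V \<Longrightarrow> q \<in> mpvars V \<Longrightarrow> p + q \<in> mpvars V"
  unfolding mpvars_def using keys_add[of p q] by blast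

lemma mpvars_uminus: "(p :: 'a::comm_ring_1 mpoly) \<in> mpvars V \<Longrightarrow> - p \<in> mpvars V"
  by (auto simp: mpvars_def in_keys_iff)

lemma mpvars_diff: "(p :: 'a::comm_ring_1 mpoly) \<in> mpvars V \<Longrightarrow> q \<in> mpvars V \<Longrightarrow> p - q \<in> mpvars V"
  using mpvars_add[of p V "- q"] mpvars_uminus[of q V] by simp

lemma mpvars_mult: "(p :: 'a::comm_ring_1 mpoly) \<in> mpvars V \<Longrightarrow> q \<in> mpvars V \<Longrightarrow> p * q \<in> mpvars V"
  unfolding mpvars_def
proof (intro CollectI ballI)
  fix m assume p: "p \<in> {p. \<forall>m\<in>Poly_Mapping.keys p. Poly_Mapping.keys m \<subseteq> V}"
    and q: "q \<in> {p. \<forall>m\<in>Poly_Mapping.keys p. Poly_Mapping.keys m \<subseteq> V}"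
    and "m \<in> Poly_Mapping.keys (p * q)"
  then obtain a b where "m = a + b" "a \<in> Poly_Mapping.keys p" "b \<in> Poly_Mapping.keys q"
    using keys_mult[of p q] by blast
  then show "Poly_Mapping.keys m \<subseteq> V"
    using p q keys_add[of a b] by blast
qed

lemma mpvars_power: "(p :: 'a::comm_ring_1 mpoly) \<in> mpvars V \<Longrightarrow> p ^ n \<in> mpvars V"
  by (induction n) (auto intro: mpvars_mult)

lemma mpvars_prod: "(\<And>a. a \<in> A \<Longrightarrow> f a \<in> mpvars V) \<Longrightarrow> (prod f A :: 'a::comm_ring_1 mpoly) \<in> mpvars V"
  by (induction A rule: infinite_finite_induct) (auto intro: mpvars_mult)

lemma single_eq_cst_prod:
  "Poly_Mapping.single m c =
    cst (c::'a::comm_ring_1) * (\<Prod>i\<in>Poly_Mapping.keys m. var i ^ Poly_Mapping.lookup m i)"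
proof -
  have pow: "var i ^ n = Poly_Mapping.single (Poly_Mapping.single i n) (1::'a)" for i n
    by (induction n) (simp_all add: var_def mult_single flip: single_add)
  have "(\<Prod>i\<in>A. var i ^ Poly_Mapping.lookup m i)
      = Poly_Mapping.single (\<Sum>i\<in>A. Poly_Mapping.single i (Poly_Mapping.lookup m i)) (1::'a)" for A
    by (induction A rule: infinite_finite_induct) (auto simp: mult_single pow)
  from this[of "Poly_Mapping.keys m"] show ?thesis
    by (simp add: mult_single flip: sum_singles)
qed

lemma mpvars_induct [consumes 1, case_names cst var add mult]:
  assumes "p \<in> mpvars V"
    and cst: "\<And>c::'a::comm_ring_1. Q (cst c)" and var: "\<And>i. i \<in> V \<Longrightarrow> Q (var i)"
    and add: "\<And>p q. Q p \<Longrightarrow> Q q \<Longrightarrow> Q (p + q)" and mult: "\<And>p q. Q p \<Longrightarrow> Q q \<Longrightarrow> Q (p * q)"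
  shows "Q p"
proof (induction p rule: singles_induct)
  case zero
  show ?case using cst[of 0] by simp
next
  case (single m c)
  have one: "Q 1" using cst[of 1] by simp
  have pow: "Q (var i ^ n)" if "i \<in> V" for i n
    by (induction n) (auto intro: one mult var that)
  have "Q (\<Prod>i\<in>A. var i ^ Poly_Mapping.lookup m i)" if "A \<subseteq> Poly_Mapping.keys m" for A
    using that single assms(1)
    by (induction A rule: infinite_finite_induct) (auto simp: mpvars_def intro!: one mult pow)
  then show ?case
    by (subst single_eq_cst_prod) (auto intro: mult cst)
qed (rule add)

lemmas mpoly_induct = mpvars_induct[where V = UNIV, simplified, case_names cst var add mult]

lemma ev_cong:
  assumes "p \<in> mpvars V" "\<And>i. i \<in> V \<Longrightarrow> x i = y i"
  shows "ev x p = ev y p"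
  using assms(1) by (induction rule: mpvars_induct) (auto simp: assms(2))

lemma mpvars_insert_expand:
  assumes "p \<in> mpvars (insert z V)"
  shows "\<exists>n c. (\<forall>j. c j \<in> mpvars V) \<and> p = (\<Sum>j<n. c j * (var z :: 'a::comm_ring_1 mpoly) ^ j)"
proof -
  let ?E = "\<lambda>p. \<exists>n c. (\<forall>j. c j \<in> mpvars V) \<and> p = (\<Sum>j<n. c j * (var z :: 'a mpoly) ^ j)"
  have add: "?E (p + q)" if "?E p" "?E q" for p q
  proof -
    obtain n c where c: "\<forall>j. c j \<in> mpvars V" "p = (\<Sum>j<n. c j * var z ^ j)" using \<open>?E p\<close> by blast
    obtain n' c' where c': "\<forall>j. c' j \<in> mpvars V" "q = (\<Sum>j<n'. c' j * var z ^ j)" using \<open>?E q\<close> by blast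
    let ?d = "\<lambda>j. (if j < n then c j else 0) + (if j < n' then c' j else 0)"
    have "p = (\<Sum>j<max n n'. (if j < n then c j else 0) * var z ^ j)"
      unfolding c(2) by (rule sum.mono_neutral_cong_left) auto
    moreover have "q = (\<Sum>j<max n n'. (if j < n' then c' j else 0) * var z ^ j)"
      unfolding c'(2) by (rule sum.mono_neutral_cong_left) auto
    ultimately have "p + q = (\<Sum>j<max n n'. ?d j * var z ^ j)"
      by (simp only: distrib_right sum.distrib)
    moreover have "\<forall>j. ?d j \<in> mpvars V" using c(1) c'(1) by (auto intro: mpvars_add)
    ultimately show ?thesis
      by (intro exI[of _ "max n n'"] exI[of _ ?d] conjI)
  qed
  show ?thesis
  proof (induction p rule: singles_induct)
    case zero
    show ?case by (rule exI[of _ 0]) (auto intro: exI[of _ "\<lambda>_. 0"])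
  next
    case (single m a)
    let ?e = "Poly_Mapping.lookup m z"
    let ?K = "Poly_Mapping.keys m"
    let ?d = "cst a * (\<Prod>i\<in>?K - {z}. var i ^ Poly_Mapping.lookup m i)"
    have "?K \<subseteq> insert z V" using single assms by (auto simp: mpvars_def)
    then have d: "?d \<in> mpvars V"
      by (intro mpvars_mult mpvars_prod mpvars_power mpvars_var mpvars_cst) auto
    have "(\<Prod>i\<in>?K. var i ^ Poly_Mapping.lookup m i)
        = (\<Prod>i\<in>?K - {z}. var i ^ Poly_Mapping.lookup m i) * (var z :: 'a mpoly) ^ ?e"
    proof (cases "z \<in> ?K")
      case True
      then show ?thesis by (subst prod.remove[of _ z]) (simp_all add: mult.commute)
    next
      case False
      then show ?thesis by (simp add: in_keys_iff)
    qed
    then have eq: "Poly_Mapping.single m a = ?d * var z ^ ?e"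
      by (subst single_eq_cst_prod) (simp add: mult.assoc)
    show ?case
    proof (intro exI conjI)
      show "\<forall>j. (if j = ?e then ?d else 0) \<in> mpvars V" using d by simp
      have "(\<Sum>j<Suc ?e. (if j = ?e then ?d else 0) * var z ^ j) = ?d * var z ^ ?e"
        by (subst sum.remove[of _ ?e]) (auto intro!: sum.neutral)
      then show "Poly_Mapping.single m a = (\<Sum>j<Suc ?e. (if j = ?e then ?d else 0) * var z ^ j)"
        using eq by simp
    qed
  qed (rule add)
qed

text \<open>
  Expand in one variable, choose values of the others at which some coefficient is nonzero, by
  induction, and then avoid the finitely many roots of the resulting univariate polynomial.
\<close>

lemma ex_ev_nonzero:
  assumes inf: "infinite (UNIV :: 'a::field set)" and "p \<noteq> (0 :: 'a mpoly)"
  shows "\<exists>x. ev x p \<noteq> 0"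
proof -
  have "\<exists>x. ev x q \<noteq> 0" if "finite V" "q \<in> mpvars V" "q \<noteq> 0" for V and q :: "'a mpoly"
    using that
  proof (induction V arbitrary: q rule: finite_induct)
    case empty
    then have "Poly_Mapping.keys q \<subseteq> {0}" by (auto simp: mpvars_def)
    then have "q = cst (Poly_Mapping.lookup q 0)"
      by (intro poly_mapping_eqI) (auto simp: lookup_single when_def in_keys_iff)
    then show ?case using \<open>q \<noteq> 0\<close> by (metis ev_cst single_zero)
  next
    case (insert z V)
    obtain n c where c: "\<And>j. c j \<in> mpvars V" and q: "q = (\<Sum>j<n. c j * var z ^ j)"
      using mpvars_insert_expand[OF insert.prems(1)] by blast
    obtain j where j: "j < n" "c j \<noteq> 0"
    proof -
      have "\<not> (\<forall>j<n. c j = 0)" using \<open>q \<noteq> 0\<close> unfolding q by (auto intro!: sum.neutral)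
      then show thesis using that by blast
    qed
    obtain x where x: "ev x (c j) \<noteq> 0"
      using insert.IH[OF c j(2)] by blast
    let ?u = "\<Sum>j<n. monom (ev x (c j)) j"
    have "coeff ?u j \<noteq> 0" using x j by (simp add: coeff_sum)
    then have "?u \<noteq> 0" by (metis coeff_0)
    then have "finite {t. poly ?u t = 0}" by (rule poly_roots_finite)
    obtain t where t: "poly ?u t \<noteq> 0"
    proof -
      have "{t. poly ?u t = 0} \<noteq> UNIV" using \<open>finite {t. poly ?u t = 0}\<close> inf by metis
      then show thesis using that by blast
    qed
    have "ev (x(z := t)) (c i) = ev x (c i)" for i
      by (rule ev_cong[OF c]) (use insert.hyps in auto)
    then have "ev (x(z := t)) q = poly ?u t"
      unfolding q by (simp add: poly_sum poly_monom)
    then show ?case using t by metis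
  qed
  moreover have "p \<in> mpvars (\<Union>(Poly_Mapping.keys ` Poly_Mapping.keys p))"
    by (auto simp: mpvars_def)
  ultimately show ?thesis using assms(2) by (metis finite_UN finite_keys)
qed

section \<open>Partial derivatives and homogeneous polynomials\<close>

lemma partial_deriv_superset:
  assumes "finite A" "Poly_Mapping.keys p \<subseteq> A"
  shows "partial_deriv i p = (\<Sum>m\<in>A. Poly_Mapping.single (m - Poly_Mapping.single i 1)
    (of_nat (Poly_Mapping.lookup m i) * Poly_Mapping.lookup p m))"
  unfolding partial_deriv_def
  by (rule sum.mono_neutral_left) (use assms in \<open>auto simp: in_keys_iff\<close>)

lemma partial_deriv_add [simp]: "partial_deriv i (p + q) = partial_deriv i p + partial_deriv i q"
proof -
  let ?A = "Poly_Mapping.keys p \<union> Poly_Mapping.keys q"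
  have "Poly_Mapping.keys (p + q) \<subseteq> ?A" by (rule keys_add)
  then show ?thesis
    by (simp add: partial_deriv_superset[of ?A] lookup_add distrib_left single_add sum.distrib)
qed

lemma partial_deriv_zero [simp]: "partial_deriv i 0 = 0"
  by (simp add: partial_deriv_def)

lemma partial_deriv_single:
  "partial_deriv i (Poly_Mapping.single m c) =
    Poly_Mapping.single (m - Poly_Mapping.single i 1) (of_nat (Poly_Mapping.lookup m i) * c)"
  by (simp add: partial_deriv_superset[of "{m}"])

lemma partial_deriv_cst [simp]: "partial_deriv i (cst c) = 0"
  by (simp add: partial_deriv_single)

lemma partial_deriv_one [simp]: "partial_deriv i (1 :: 'a::comm_ring_1 mpoly) = 0"
  by (metis partial_deriv_cst single_one)

lemma partial_deriv_var: "partial_deriv i (var j) = (if i = j then 1 else 0)"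
  by (auto simp: var_def partial_deriv_single lookup_single)

lemma diff_single_add:
  fixes m n :: "nat \<Rightarrow>\<^sub>0 nat"
  assumes "0 < Poly_Mapping.lookup m i"
  shows "m - Poly_Mapping.single i 1 + n = m + n - Poly_Mapping.single i 1"
  using assms by (intro poly_mapping_eqI) (auto simp: lookup_add lookup_minus lookup_single when_def)

lemma partial_deriv_mult:
  "partial_deriv i (p * q) = partial_deriv i p * q + p * partial_deriv i q"
proof (induction p rule: singles_induct)
  case (single m c)
  show ?case
  proof (induction q rule: singles_induct)
    case (single n d)
    let ?s = "Poly_Mapping.single :: (nat \<Rightarrow>\<^sub>0 nat) \<Rightarrow> 'a \<Rightarrow> 'a mpoly"
    let ?e = "Poly_Mapping.single i 1 :: nat \<Rightarrow>\<^sub>0 nat"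
    have 1: "?s (m - ?e + n) (of_nat (Poly_Mapping.lookup m i) * a)
        = ?s (m + n - ?e) (of_nat (Poly_Mapping.lookup m i) * a)" for a
      by (cases "Poly_Mapping.lookup m i = 0") (auto simp: diff_single_add simp del: One_nat_def)
    have 2: "?s (m + (n - ?e)) (of_nat (Poly_Mapping.lookup n i) * a)
        = ?s (m + n - ?e) (of_nat (Poly_Mapping.lookup n i) * a)" for a
      by (cases "Poly_Mapping.lookup n i = 0")
        (use diff_single_add[of n i m] in \<open>auto simp: add.commute simp del: One_nat_def\<close>)
    show ?case
      using 1[of "c * d"] 2[of "c * d"]
      by (simp add: mult_single partial_deriv_single lookup_add distrib_right single_add mult.assoc
          mult.left_commute[of c])
  qed (auto simp: algebra_simps)
qed (auto simp: algebra_simps)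

lemma partial_deriv_uminus [simp]:
  "partial_deriv i (- p :: 'a::comm_ring_1 mpoly) = - partial_deriv i p"
  by (metis add.right_inverse add_eq_0_iff partial_deriv_add partial_deriv_zero)

lemma partial_deriv_diff [simp]:
  "partial_deriv i (p - q :: 'a::comm_ring_1 mpoly) = partial_deriv i p - partial_deriv i q"
  using partial_deriv_add[of i p "- q"] by simp

lemma partial_deriv_sum [simp]: "partial_deriv i (sum f A) = (\<Sum>a\<in>A. partial_deriv i (f a))"
  by (induction A rule: infinite_finite_induct) auto

lemma partial_deriv_commute:
  "partial_deriv i (partial_deriv j p) = partial_deriv j (partial_deriv i (p :: 'a::comm_ring_1 mpoly))"
proof (induction p rule: mpoly_induct)
  case (var k)
  show ?case by (simp add: partial_deriv_var)
next
  case (mult p q)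
  then show ?case by (simp add: partial_deriv_mult algebra_simps)
qed auto

lemma monom_degree_superset:
  assumes "finite A" "Poly_Mapping.keys m \<subseteq> A"
  shows "monom_degree m = (\<Sum>i\<in>A. Poly_Mapping.lookup m i)"
  unfolding monom_degree_def
  by (rule sum.mono_neutral_left) (use assms in \<open>auto simp: in_keys_iff\<close>)

lemma monom_degree_add: "monom_degree (m + n) = monom_degree m + monom_degree n"
proof -
  let ?A = "Poly_Mapping.keys m \<union> Poly_Mapping.keys n"
  have "Poly_Mapping.keys (m + n) \<subseteq> ?A" by (rule keys_add)
  then show ?thesis
    by (simp add: monom_degree_superset[of ?A] lookup_add sum.distrib)
qed

lemma monom_degree_single [simp]: "monom_degree (Poly_Mapping.single i n) = n"
  by (simp add: monom_degree_superset[of "{i}"])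

lemma monom_degree_zero [simp]: "monom_degree 0 = 0"
  by (simp add: monom_degree_def)

text \<open>A homogeneous polynomial is a form or \<open>0\<close>; unlike forms, these are closed under sums.\<close>

definition homog :: "nat \<Rightarrow> nat \<Rightarrow> 'a::zero mpoly \<Rightarrow> bool" where
  "homog N d p \<longleftrightarrow> p \<in> mpolys N \<and> (\<forall>m\<in>Poly_Mapping.keys p. monom_degree m = d)"

lemma is_form_iff: "is_form N d p \<longleftrightarrow> homog N d p \<and> p \<noteq> 0"
  by (auto simp: is_form_def homog_def)

lemma homog_zero [simp]: "homog N d 0"
  by (simp add: homog_def mpolys_def)

lemma homog_add: "homog N d p \<Longrightarrow> homog N d q \<Longrightarrow> homog N d (p + q)"
  unfolding homog_def mpolys_eq_mpvars using keys_add[of p q] mpvars_add by blast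

lemma homog_sum: "(\<And>a. a \<in> A \<Longrightarrow> homog N d (f a)) \<Longrightarrow> homog N d (sum f A)"
  by (induction A rule: infinite_finite_induct) (auto intro: homog_add)

lemma homog_mult:
  assumes "homog N d (p :: 'a::comm_ring_1 mpoly)" "homog N e q"
  shows "homog N (d + e) (p * q)"
  unfolding homog_def
proof (intro conjI ballI)
  show "p * q \<in> mpolys N"
    using assms by (auto simp: homog_def mpolys_eq_mpvars intro: mpvars_mult)
  fix m assume "m \<in> Poly_Mapping.keys (p * q)"
  then obtain a b where "m = a + b" "a \<in> Poly_Mapping.keys p" "b \<in> Poly_Mapping.keys q"
    using keys_mult[of p q] by blast
  then show "monom_degree m = d + e"
    using assms by (auto simp: homog_def monom_degree_add)
qed

lemma homog_cst [simp]: "homog N 0 (cst c)"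
  by (auto simp: homog_def mpolys_eq_mpvars)

lemma homog_var: "i \<in> {1..N} \<Longrightarrow> homog N 1 (var i :: 'a::comm_ring_1 mpoly)"
  unfolding homog_def mpolys_eq_mpvars by (intro conjI mpvars_var) (auto simp: var_def)

lemma homog_cst_mult: "homog N d (p :: 'a::comm_ring_1 mpoly) \<Longrightarrow> homog N d (cst c * p)"
  using homog_mult[OF homog_cst] by fastforce

lemma homog_0_eq_cst:
  assumes "homog N 0 p"
  shows "p = cst (Poly_Mapping.lookup p 0)"
proof -
  have "m = 0" if "m \<in> Poly_Mapping.keys p" for m
  proof -
    have "monom_degree m = 0" using that assms by (simp add: homog_def)
    then have "Poly_Mapping.lookup m i = 0" for i
      unfolding monom_degree_def by (cases "i \<in> Poly_Mapping.keys m") (auto simp: in_keys_iff)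
    then show ?thesis by (intro poly_mapping_eqI) simp
  qed
  then show ?thesis
    by (intro poly_mapping_eqI) (auto simp: lookup_single when_def in_keys_iff)
qed

lemma homog_partial_deriv:
  assumes "homog N (Suc d) p"
  shows "homog N d (partial_deriv i (p :: 'a::comm_ring_1 mpoly))"
proof (induction p rule: singles_induct)
  case (single m c)
  show ?case
  proof (cases "Poly_Mapping.lookup m i = 0")
    case False
    let ?n = "m - Poly_Mapping.single i 1"
    have m: "?n + Poly_Mapping.single i 1 = m"
      using False by (intro poly_mapping_eqI) (auto simp: lookup_add lookup_minus lookup_single when_def)
    have "Suc d = monom_degree (?n + Poly_Mapping.single i 1)"
      unfolding m using single assms by (simp add: homog_def)
    then have "monom_degree ?n = d" by (simp add: monom_degree_add)
    moreover have "Poly_Mapping.keys m \<subseteq> {1..N}"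
      using single assms by (simp add: homog_def mpolys_def)
    moreover have "Poly_Mapping.keys ?n \<subseteq> Poly_Mapping.keys m"
      by (auto simp: in_keys_iff lookup_minus)
    ultimately show ?thesis
      unfolding partial_deriv_single homog_def mpolys_def by (auto split: if_splits)
  qed (simp add: partial_deriv_single)
qed (auto intro: homog_add)

lemma euler:
  assumes "homog N d (p :: 'a::comm_ring_1 mpoly)"
  shows "(\<Sum>i=1..N. var i * partial_deriv i p) = of_nat d * p"
proof (induction p rule: singles_induct)
  case (single m c)
  have *: "var i * partial_deriv i (Poly_Mapping.single m c)
      = Poly_Mapping.single m (of_nat (Poly_Mapping.lookup m i) * c)" for i
  proof (cases "Poly_Mapping.lookup m i = 0")
    case False
    then have "Poly_Mapping.single i 1 + (m - Poly_Mapping.single i 1) = m"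
      by (intro poly_mapping_eqI) (auto simp: lookup_add lookup_minus lookup_single when_def)
    then show ?thesis by (simp add: var_def partial_deriv_single mult_single)
  qed (simp add: partial_deriv_single)
  have "Poly_Mapping.keys m \<subseteq> {1..N}" "monom_degree m = d"
    using single assms by (auto simp: homog_def mpolys_def)
  then have "(\<Sum>i=1..N. Poly_Mapping.lookup m i) = d"
    using monom_degree_superset[of "{1..N}" m] by simp
  then have d: "(\<Sum>i=1..N. of_nat (Poly_Mapping.lookup m i)) = (of_nat d :: 'a)"
    by (metis of_nat_sum)
  have "(\<Sum>i\<in>A. Poly_Mapping.single m (f i)) = Poly_Mapping.single m (\<Sum>i\<in>A. f i)"
    for A and f :: "nat \<Rightarrow> 'a"
    by (induction A rule: infinite_finite_induct) (auto simp: single_add)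
  then have "(\<Sum>i=1..N. var i * partial_deriv i (Poly_Mapping.single m c))
      = Poly_Mapping.single m (of_nat d * c)"
    unfolding * by (simp flip: d add: sum_distrib_right)
  also have "\<dots> = of_nat d * Poly_Mapping.single m c"
  proof -
    have "of_nat d = (cst (of_nat d) :: 'a mpoly)" by simp
    then show ?thesis by (metis mult_single add_0)
  qed
  finally show ?case .
qed (auto simp: algebra_simps sum.distrib)

section \<open>Linear algebra and local generators modulo a prime ideal\<close>

locale prime_ideal =
  fixes P :: "'r::comm_ring_1 set"
  assumes zero_in [simp]: "0 \<in> P"
    and add_in: "a \<in> P \<Longrightarrow> b \<in> P \<Longrightarrow> a + b \<in> P"
    and mult_in: "a \<in> P \<Longrightarrow> r * a \<in> P"
    and one_notin [simp]: "1 \<notin> P"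
    and prime: "a * b \<in> P \<Longrightarrow> a \<in> P \<or> b \<in> P"
begin

lemma mult_in_left: "a \<in> P \<Longrightarrow> a * r \<in> P"
  using mult_in[of a r] by (simp add: mult.commute)

lemma uminus_in: "a \<in> P \<Longrightarrow> - a \<in> P"
  using mult_in[of a "- 1"] by simp

lemma diff_in: "a \<in> P \<Longrightarrow> b \<in> P \<Longrightarrow> a - b \<in> P"
  using add_in[of a "- b"] uminus_in[of b] by simp

lemma sum_in: "(\<And>x. x \<in> A \<Longrightarrow> f x \<in> P) \<Longrightarrow> sum f A \<in> P"
  by (induction A rule: infinite_finite_induct) (auto intro: add_in)

lemma mult_notin: "a \<notin> P \<Longrightarrow> b \<notin> P \<Longrightarrow> a * b \<notin> P"
  using prime by blast

text \<open>
  Gauss-Jordan elimination over the domain of residues modulo \<open>P\<close>, without denominators: the common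
  value \<open>\<delta>\<close> of the pivots stands in for \<open>1\<close>. The rows \<open>f\<close> of the reduced matrix remain honest
  combinations of the given rows \<open>h\<close>; only the pivot pattern and the statement that the new rows
  span the old ones hold modulo \<open>P\<close>.
\<close>

lemma gauss_jordan_ex:
  assumes "finite I"
  shows "\<exists>B \<delta> f m. B \<subseteq> J \<and> finite B \<and> card B \<le> card I \<and> \<delta> \<notin> P \<and>
    (\<forall>b\<in>B. \<forall>j. f b j = (\<Sum>i\<in>I. m b i * h i j)) \<and>
    (\<forall>b\<in>B. \<forall>c\<in>B. f b c - (if b = c then \<delta> else 0) \<in> P) \<and>
    (\<forall>i\<in>I. \<forall>j\<in>J. \<delta> * h i j - (\<Sum>b\<in>B. h i b * f b j) \<in> P)"
  using assms
proof (induction I rule: finite_induct)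
  case empty
  show ?case by (rule exI[of _ "{}"], rule exI[of _ 1]) simp
next
  case (insert k I)
  from insert.IH obtain B \<delta> f m where
    IH: "B \<subseteq> J \<and> finite B \<and> card B \<le> card I \<and> \<delta> \<notin> P \<and>
      (\<forall>b\<in>B. \<forall>j. f b j = (\<Sum>i\<in>I. m b i * h i j)) \<and>
      (\<forall>b\<in>B. \<forall>c\<in>B. f b c - (if b = c then \<delta> else 0) \<in> P) \<and>
      (\<forall>i\<in>I. \<forall>j\<in>J. \<delta> * h i j - (\<Sum>b\<in>B. h i b * f b j) \<in> P)"
    by (elim exE)
  have B: "B \<subseteq> J" "finite B" "card B \<le> card I" and \<delta>: "\<delta> \<notin> P"
    using IH by simp_all
  have f: "f b j = (\<Sum>i\<in>I. m b i * h i j)" if "b \<in> B" for b j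
    using IH that by (elim conjE) blast
  have piv: "f b c - (if b = c then \<delta> else 0) \<in> P" if "b \<in> B" "c \<in> B" for b c
    using IH that by (elim conjE) blast
  have span: "\<delta> * h i j - (\<Sum>b\<in>B. h i b * f b j) \<in> P" if "i \<in> I" "j \<in> J" for i j
    using IH that by (elim conjE) blast
  (* the new row, reduced by the old pivots *)
  define h' where "h' j = \<delta> * h k j - (\<Sum>b\<in>B. h k b * f b j)" for j
  show ?case
  proof (cases "\<forall>j\<in>J. h' j \<in> P")
    case True
    let ?m = "\<lambda>b i. if i = k then 0 else m b i"
    show ?thesis
    proof (intro exI conjI ballI allI)
      show "B \<subseteq> J" "finite B" "card B \<le> card (insert k I)" "\<delta> \<notin> P"
        using B \<delta> insert.hyps by auto
      show "f b c - (if b = c then \<delta> else 0) \<in> P" if "b \<in> B" "c \<in> B" for b c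
        using piv that by blast
      show "f b j = (\<Sum>i\<in>insert k I. ?m b i * h i j)" if "b \<in> B" for b j
      proof -
        have "(\<Sum>i\<in>I. ?m b i * h i j) = (\<Sum>i\<in>I. m b i * h i j)"
          by (rule sum.cong) (use insert.hyps in auto)
        then show ?thesis using f[OF that] insert.hyps by simp
      qed
      show "\<delta> * h i j - (\<Sum>b\<in>B. h i b * f b j) \<in> P" if "i \<in> insert k I" "j \<in> J" for i j
        using that span True by (auto simp: h'_def)
    qed
  next
    case False
    then obtain j0 where j0: "j0 \<in> J" "h' j0 \<notin> P" by blast
    define \<epsilon> where "\<epsilon> = h' j0"
    have h'B: "h' c \<in> P" if c: "c \<in> B" for c
    proof -
      have "(\<Sum>b\<in>B. h k b * (if b = c then \<delta> else 0)) = (\<Sum>b\<in>B. if b = c then h k b * \<delta> else 0)"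
        by (rule sum.cong) auto
      also have "\<dots> = h k c * \<delta>"
        using B(2) c by simp
      finally have "(\<Sum>b\<in>B. h k b * (if b = c then \<delta> else 0)) = h k c * \<delta>" .
      then have "h' c = - (\<Sum>b\<in>B. h k b * (f b c - (if b = c then \<delta> else 0)))"
        by (simp add: h'_def right_diff_distrib sum_subtractf mult.commute)
      also have "\<dots> \<in> P"
        using c by (intro uminus_in sum_in mult_in piv)
      finally show ?thesis .
    qed
    have j0B: "j0 \<notin> B" using h'B j0(2) by blast
    (* j0 becomes a pivot, and column j0 is cleared in the old rows *)
    define f' where "f' b j = (if b = j0 then \<delta> * h' j else \<epsilon> * f b j - f b j0 * h' j)" for b j
    define m' where "m' i = (if i = k then \<delta> else - (\<Sum>b\<in>B. h k b * m b i))" for i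
    define m'' where "m'' b i = (if b = j0 then \<delta> * m' i
      else (if i = k then 0 else \<epsilon> * m b i) - f b j0 * m' i)" for b i
    have h'm: "h' j = (\<Sum>i\<in>insert k I. m' i * h i j)" for j
    proof -
      have "(\<Sum>i\<in>I. m' i * h i j) = (\<Sum>i\<in>I. - (\<Sum>b\<in>B. h k b * m b i * h i j))"
        by (rule sum.cong) (use insert.hyps in \<open>auto simp: m'_def sum_distrib_right\<close>)
      also have "\<dots> = - (\<Sum>i\<in>I. \<Sum>b\<in>B. h k b * m b i * h i j)"
        by (simp add: sum_negf)
      also have "\<dots> = - (\<Sum>b\<in>B. \<Sum>i\<in>I. h k b * m b i * h i j)"
        by (subst sum.swap) simp
      also have "\<dots> = - (\<Sum>b\<in>B. h k b * f b j)"
        by (intro arg_cong[of _ _ uminus] sum.cong) (auto simp: f sum_distrib_left mult.assoc)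
      finally show ?thesis using insert.hyps by (simp add: h'_def m'_def)
    qed
    show ?thesis
    proof (intro exI conjI ballI allI)
      show "insert j0 B \<subseteq> J" "finite (insert j0 B)" "card (insert j0 B) \<le> card (insert k I)"
        using B j0 j0B insert.hyps by auto
      show "\<delta> * \<epsilon> \<notin> P"
        using \<delta> j0(2) mult_notin by (simp add: \<epsilon>_def)
      show "f' b j = (\<Sum>i\<in>insert k I. m'' b i * h i j)" if "b \<in> insert j0 B" for b j
      proof (cases "b = j0")
        case True
        then show ?thesis by (simp add: f'_def m''_def h'm sum_distrib_left mult.assoc)
      next
        case False
        then have b: "b \<in> B" using that by simp
        have "(\<Sum>i\<in>insert k I. (if i = k then 0 else \<epsilon> * m b i) * h i j) = \<epsilon> * f b j"
          using insert.hyps by (auto simp: f[OF b] sum_distrib_left mult.assoc intro!: sum.cong)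
        moreover have "(\<Sum>i\<in>insert k I. (f b j0 * m' i) * h i j) = f b j0 * h' j"
          by (simp only: h'm sum_distrib_left mult.assoc)
        ultimately show ?thesis
          using False by (simp only: f'_def m''_def if_False left_diff_distrib sum_subtractf)
      qed
      show "f' b c - (if b = c then \<delta> * \<epsilon> else 0) \<in> P"
        if b: "b \<in> insert j0 B" and c: "c \<in> insert j0 B" for b c
      proof (cases "b = j0")
        case True
        show ?thesis
        proof (cases "c = j0")
          case True
          then show ?thesis using \<open>b = j0\<close> by (simp add: f'_def \<epsilon>_def)
        next
          case False
          then show ?thesis using \<open>b = j0\<close> c h'B[of c] by (auto simp: f'_def intro: mult_in)
        qed
      next
        case False
        then have b: "b \<in> B" using b by simp
        show ?thesis
        proof (cases "c = j0")
          case True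
          then show ?thesis using False by (simp add: f'_def \<epsilon>_def mult.commute)
        next
          case False
          then have c: "c \<in> B" using c by simp
          have "f' b c - (if b = c then \<delta> * \<epsilon> else 0)
              = \<epsilon> * (f b c - (if b = c then \<delta> else 0)) - f b j0 * h' c"
            using \<open>b \<noteq> j0\<close> by (auto simp: f'_def algebra_simps)
          also have "\<dots> \<in> P"
            by (intro diff_in mult_in piv h'B b c)
          finally show ?thesis .
        qed
      qed
      show "\<delta> * \<epsilon> * h i j - (\<Sum>b\<in>insert j0 B. h i b * f' b j) \<in> P"
        if i: "i \<in> insert k I" and j: "j \<in> J" for i j
      proof -
        have "(\<Sum>b\<in>B. h i b * f' b j) = (\<Sum>b\<in>B. \<epsilon> * (h i b * f b j) - h' j * (h i b * f b j0))"
          by (rule sum.cong) (use j0B in \<open>auto simp: f'_def algebra_simps\<close>)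
        also have "\<dots> = \<epsilon> * (\<Sum>b\<in>B. h i b * f b j) - h' j * (\<Sum>b\<in>B. h i b * f b j0)"
          by (simp add: sum_subtractf sum_distrib_left)
        finally have eq: "\<delta> * \<epsilon> * h i j - (\<Sum>b\<in>insert j0 B. h i b * f' b j)
            = \<epsilon> * (\<delta> * h i j - (\<Sum>b\<in>B. h i b * f b j))
              - h' j * (\<delta> * h i j0 - (\<Sum>b\<in>B. h i b * f b j0))"
          using B(2) j0B by (simp add: f'_def algebra_simps)
        show ?thesis
        proof (cases "i = k")
          case True
          then show ?thesis
            unfolding eq unfolding True \<epsilon>_def h'_def[symmetric] by (simp add: mult.commute[of "h' j"])
        next
          case False
          then show ?thesis
            unfolding eq using i span[OF _ j] span[OF _ j0(1)] by (auto intro: diff_in mult_in)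
        qed
      qed
    qed
  qed
qed

lemma gauss_jordan:
  assumes "finite I"
  obtains B \<delta> f m where "B \<subseteq> J" "finite B" "card B \<le> card I" "\<delta> \<notin> P"
    and "\<And>b j. b \<in> B \<Longrightarrow> f b j = (\<Sum>i\<in>I. m b i * h i j)"
    and "\<And>b c. b \<in> B \<Longrightarrow> c \<in> B \<Longrightarrow> f b c - (if b = c then \<delta> else 0) \<in> P"
    and "\<And>i j. i \<in> I \<Longrightarrow> j \<in> J \<Longrightarrow> \<delta> * h i j - (\<Sum>b\<in>B. h i b * f b j) \<in> P"
proof -
  from gauss_jordan_ex[OF assms, of J h] show thesis
  proof (elim exE conjE)
    fix B \<delta> f m
    assume "B \<subseteq> J" "finite B" "card B \<le> card I" "\<delta> \<notin> P"
      "\<forall>b\<in>B. \<forall>j. f b j = (\<Sum>i\<in>I. m b i * h i j)"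
      "\<forall>b\<in>B. \<forall>c\<in>B. f b c - (if b = c then \<delta> else 0) \<in> P"
      "\<forall>i\<in>I. \<forall>j\<in>J. \<delta> * h i j - (\<Sum>b\<in>B. h i b * f b j) \<in> P"
    then show thesis by (intro that[of B \<delta> f m]) blast+
  qed
qed

text \<open>Membership of \<open>g\<close> in the ideal that \<open>H\<close> generates in the localization at \<open>P\<close>.\<close>

definition locally_generated :: "'r set \<Rightarrow> 'r \<Rightarrow> bool" where
  "locally_generated H g \<longleftrightarrow> (\<exists>s a. s \<notin> P \<and> s * g = (\<Sum>h\<in>H. a h * h))"

lemma locally_generated_zero [simp]: "locally_generated H 0"
  unfolding locally_generated_def by (rule exI[of _ 1], rule exI[of _ "\<lambda>_. 0"]) simp

lemma locally_generated_add:
  assumes "locally_generated H g" "locally_generated H g'"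
  shows "locally_generated H (g + g')"
proof -
  obtain s a s' a' where s: "s \<notin> P" "s' \<notin> P"
    and *: "s * g = (\<Sum>h\<in>H. a h * h)" "s' * g' = (\<Sum>h\<in>H. a' h * h)"
    using assms unfolding locally_generated_def by blast
  have "(s * s') * (g + g') = s' * (s * g) + s * (s' * g')" by (simp add: algebra_simps)
  also have "\<dots> = (\<Sum>h\<in>H. (s' * a h + s * a' h) * h)"
    unfolding * by (simp add: sum_distrib_left algebra_simps sum.distrib)
  finally have "(s * s') * (g + g') = (\<Sum>h\<in>H. (s' * a h + s * a' h) * h)" .
  moreover have "s * s' \<notin> P" using s by (rule mult_notin)
  ultimately show ?thesis
    unfolding locally_generated_def by (intro exI[of _ "s * s'"] exI conjI)
qed

lemma locally_generated_mult:
  assumes "locally_generated H g"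
  shows "locally_generated H (r * g)"
proof -
  obtain s a where s: "s \<notin> P" and *: "s * g = (\<Sum>h\<in>H. a h * h)"
    using assms unfolding locally_generated_def by blast
  have "s * (r * g) = r * (s * g)" by (simp add: algebra_simps)
  also have "\<dots> = (\<Sum>h\<in>H. (r * a h) * h)"
    unfolding * by (simp add: sum_distrib_left mult.assoc)
  finally show ?thesis
    using s unfolding locally_generated_def by (intro exI[of _ s] exI[of _ "\<lambda>h. r * a h"] conjI)
qed

lemma locally_generated_cancel:
  assumes "r \<notin> P" "locally_generated H (r * g)"
  shows "locally_generated H g"
proof -
  obtain s a where s: "s \<notin> P" and *: "s * (r * g) = (\<Sum>h\<in>H. a h * h)"
    using assms unfolding locally_generated_def by blast
  then have "s * r \<notin> P" "(s * r) * g = (\<Sum>h\<in>H. a h * h)"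
    using assms mult_notin by (auto simp: mult.assoc)
  then show ?thesis unfolding locally_generated_def by blast
qed

lemma locally_generated_insert:
  assumes "finite H" "locally_generated H g"
  shows "locally_generated (insert h H) g"
proof (cases "h \<in> H")
  case False
  obtain s a where s: "s \<notin> P" and *: "s * g = (\<Sum>h\<in>H. a h * h)"
    using assms unfolding locally_generated_def by blast
  have "(\<Sum>x\<in>H. (a(h := 0)) x * x) = (\<Sum>x\<in>H. a x * x)"
    by (rule sum.cong) (use False in auto)
  then have "s * g = (\<Sum>x\<in>insert h H. (a(h := 0)) x * x)"
    using False assms(1) * by simp
  then show ?thesis using s unfolding locally_generated_def by blast
qed (use assms in \<open>simp add: insert_absorb\<close>)

lemma locally_generated_base:
  assumes "finite H" "h \<in> H"
  shows "locally_generated H h"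
proof -
  have "(\<Sum>x\<in>H. (if x = h then 1 else 0) * x) = (\<Sum>x\<in>H. if x = h then x else 0)"
    by (rule sum.cong) auto
  also have "\<dots> = h" using assms by simp
  finally have "(\<Sum>x\<in>H. (if x = h then 1 else 0) * x) = h" .
  then show ?thesis
    unfolding locally_generated_def
    by (intro exI[of _ 1] exI[of _ "\<lambda>x. if x = h then 1 else 0"]) simp
qed

text \<open>
  The one new generator is a polynomial expression in \<open>z\<close> over \<open>C\<close> that lies in \<open>P\<close> and has minimal
  degree among those whose leading coefficient is not in \<open>P\<close>. Pseudo-division by it reduces every
  expression in \<open>P\<close> to one whose coefficients all lie in \<open>P\<close>, and these are locally generated
  already. If no such expression exists, the old generators suffice.
\<close>

lemma locally_generated_adjoin:
  assumes C: "0 \<in> C" "\<And>a b. a \<in> C \<Longrightarrow> b \<in> C \<Longrightarrow> a - b \<in> C" "\<And>a b. a \<in> C \<Longrightarrow> b \<in> C \<Longrightarrow> a * b \<in> C"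
    and H: "finite H" "H \<subseteq> P" and gen: "\<And>g. g \<in> P \<Longrightarrow> g \<in> C \<Longrightarrow> locally_generated H g"
  shows "\<exists>H'. finite H' \<and> H' \<subseteq> P \<and> card H' \<le> Suc (card H) \<and>
    (\<forall>n c. (\<forall>j. c j \<in> C) \<longrightarrow> (\<Sum>j<n. c j * z ^ j) \<in> P \<longrightarrow>
      locally_generated H' (\<Sum>j<n. c j * z ^ j))"
proof -
  define lead where "lead n c \<longleftrightarrow> (\<forall>j. c j \<in> C) \<and> (\<Sum>j<Suc n. c j * z ^ j) \<in> P \<and> c n \<notin> P" for n c
  show ?thesis
  proof (cases "\<exists>n c. lead n c")
    case False
    have "locally_generated H (\<Sum>j<n. c j * z ^ j)"
      if "\<forall>j. c j \<in> C" "(\<Sum>j<n. c j * z ^ j) \<in> P" for n c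
      using that
    proof (induction n)
      case (Suc n)
      then have cn: "c n \<in> P" using False unfolding lead_def by blast
      then have top: "c n * z ^ n \<in> P" by (rule mult_in_left)
      have "(\<Sum>j<n. c j * z ^ j) = (\<Sum>j<Suc n. c j * z ^ j) - c n * z ^ n" by simp
      then have "(\<Sum>j<n. c j * z ^ j) \<in> P" using Suc.prems(2) top diff_in by metis
      then have "locally_generated H (\<Sum>j<n. c j * z ^ j)" using Suc by blast
      moreover have "locally_generated H (z ^ n * c n)"
        using gen cn Suc.prems(1) by (blast intro: locally_generated_mult)
      ultimately show ?case by (simp add: locally_generated_add mult.commute)
    qed simp
    then show ?thesis using H by (intro exI[of _ H]) auto
  next
    case True
    define d where "d = (LEAST d. \<exists>c. lead d c)"
    have "\<exists>c. lead d c" unfolding d_def by (rule LeastI_ex) (use True in blast)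
    then obtain c where c: "lead d c" by blast
    define h where "h = (\<Sum>j<Suc d. c j * z ^ j)"
    have h: "h \<in> P" using c by (simp add: lead_def h_def)
    let ?H = "insert h H"
    have fin: "finite ?H" using H by simp
    have "locally_generated ?H (\<Sum>j<n. e j * z ^ j)"
      if "\<forall>j. e j \<in> C" "(\<Sum>j<n. e j * z ^ j) \<in> P" for n e
      using that
    proof (induction n arbitrary: e)
      case (Suc n)
      show ?case
      proof (cases "e n \<in> P")
        case True
        then have top: "e n * z ^ n \<in> P" by (rule mult_in_left)
        have "(\<Sum>j<n. e j * z ^ j) = (\<Sum>j<Suc n. e j * z ^ j) - e n * z ^ n" by simp
        then have "(\<Sum>j<n. e j * z ^ j) \<in> P" using Suc.prems(2) top diff_in by metis
        then have "locally_generated ?H (\<Sum>j<n. e j * z ^ j)" using Suc by blast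
        moreover have "locally_generated ?H (z ^ n * e n)"
          using gen True Suc.prems(1) H
          by (blast intro: locally_generated_mult locally_generated_insert)
        ultimately show ?thesis by (simp add: locally_generated_add mult.commute)
      next
        case False
        then have "lead n e" using Suc.prems by (simp add: lead_def)
        then have dn: "d \<le> n" unfolding d_def by (blast intro: Least_le)
        (* one step of pseudo-division by h; the terms of degree n cancel *)
        define e' where "e' j = c d * e j - (if n - d \<le> j then e n * c (j - (n - d)) else 0)" for j
        have "z ^ (n - d) * h = (\<Sum>j<Suc d. c j * z ^ (j + (n - d)))"
          by (simp add: h_def sum_distrib_left power_add algebra_simps)
        also have "\<dots> = (\<Sum>j\<in>{n - d..<Suc n}. c (j - (n - d)) * z ^ j)"
          by (rule sum.reindex_bij_witness[of _ "\<lambda>j. j - (n - d)" "\<lambda>j. j + (n - d)"]) (use dn in auto)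
        also have "\<dots> = (\<Sum>j<Suc n. if n - d \<le> j then c (j - (n - d)) * z ^ j else 0)"
          by (rule sum.mono_neutral_cong_left) auto
        finally have zh: "z ^ (n - d) * h = \<dots>" .
        have "e n * z ^ (n - d) * h = (\<Sum>j<Suc n. (if n - d \<le> j then e n * c (j - (n - d)) else 0) * z ^ j)"
          unfolding mult.assoc zh sum_distrib_left by (rule sum.cong) (auto simp: mult.assoc)
        then have eq0: "c d * (\<Sum>j<Suc n. e j * z ^ j) - e n * z ^ (n - d) * h = (\<Sum>j<Suc n. e' j * z ^ j)"
          by (simp only: e'_def left_diff_distrib sum_subtractf sum_distrib_left mult.assoc)
        have "e' n = 0" using dn by (simp add: e'_def mult.commute)
        then have eq: "c d * (\<Sum>j<Suc n. e j * z ^ j) - e n * z ^ (n - d) * h = (\<Sum>j<n. e' j * z ^ j)"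
          unfolding eq0 by simp
        have "\<forall>j. c j \<in> C" using c by (simp add: lead_def)
        then have "\<forall>j. e' j \<in> C" using Suc.prems(1) C by (auto simp: e'_def)
        moreover have "(\<Sum>j<n. e' j * z ^ j) \<in> P"
          unfolding eq[symmetric] using Suc.prems(2) h by (intro diff_in mult_in)
        ultimately have "locally_generated ?H (\<Sum>j<n. e' j * z ^ j)" by (rule Suc.IH)
        moreover have "locally_generated ?H (e n * z ^ (n - d) * h)"
          using fin by (intro locally_generated_mult locally_generated_base) auto
        ultimately have "locally_generated ?H (c d * (\<Sum>j<Suc n. e j * z ^ j))"
          unfolding eq[symmetric] using locally_generated_add by fastforce
        moreover have "c d \<notin> P" using c by (simp add: lead_def)
        ultimately show ?thesis using locally_generated_cancel by blast
      qed
    qed simp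
    moreover have "card ?H \<le> Suc (card H)" using H(1) by (simp add: card_insert_if)
    ultimately show ?thesis using H h fin by (intro exI[of _ ?H]) auto
  qed
qed

end

text \<open>
  Geometrically, the variety of \<open>P\<close> dominates the space of the variables outside \<open>Z\<close>, so its
  codimension is at most \<open>card Z\<close>; and the local ring of the affine space at its generic point is
  regular. Concretely, the variables in \<open>Z\<close> are adjoined one by one, starting from the zero ideal.
\<close>

lemma locally_generated_mpoly:
  assumes P: "prime_ideal (P :: 'a::comm_ring_1 mpoly set)" and "finite Z"
    and free: "P \<inter> mpvars (- Z) = {0}"
  shows "\<exists>H. finite H \<and> H \<subseteq> P \<and> card H \<le> card Z \<and> (\<forall>g\<in>P. prime_ideal.locally_generated P H g)"
proof -
  interpret prime_ideal P by (rule P)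
  have "\<exists>H. finite H \<and> H \<subseteq> P \<and> card H \<le> card Y \<and>
      (\<forall>g\<in>P \<inter> mpvars (- Z \<union> Y). locally_generated H g)" if "finite Y" for Y
    using that
  proof (induction Y rule: finite_induct)
    case empty
    show ?case using free by (intro exI[of _ "{}"]) auto
  next
    case (insert z Y)
    then obtain H where H: "finite H" "H \<subseteq> P" "card H \<le> card Y"
      and gen: "\<And>g. g \<in> P \<Longrightarrow> g \<in> mpvars (- Z \<union> Y) \<Longrightarrow> locally_generated H g"
      by blast
    let ?C = "mpvars (- Z \<union> Y)"
    have "\<exists>H'. finite H' \<and> H' \<subseteq> P \<and> card H' \<le> Suc (card H) \<and>
      (\<forall>n c. (\<forall>j. c j \<in> ?C) \<longrightarrow> (\<Sum>j<n. c j * var z ^ j) \<in> P \<longrightarrow>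
        locally_generated H' (\<Sum>j<n. c j * var z ^ j))"
      by (rule locally_generated_adjoin[where C = ?C and H = H])
        (simp_all add: mpvars_diff mpvars_mult H gen)
    then obtain H' where H': "finite H'" "H' \<subseteq> P" "card H' \<le> Suc (card H)"
      and gen': "\<forall>n c. (\<forall>j. c j \<in> ?C) \<longrightarrow> (\<Sum>j<n. c j * var z ^ j) \<in> P \<longrightarrow>
        locally_generated H' (\<Sum>j<n. c j * var z ^ j)"
      by (elim exE conjE)
    have "locally_generated H' g" if g: "g \<in> P" "g \<in> mpvars (- Z \<union> insert z Y)" for g
    proof -
      have "g \<in> mpvars (insert z (- Z \<union> Y))" using g(2) by simp
      then obtain n c where c: "\<forall>j. c j \<in> ?C" and "g = (\<Sum>j<n. c j * var z ^ j)"
        using mpvars_insert_expand by blast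
      then show ?thesis using gen'[rule_format, of c n] g(1) by simp
    qed
    moreover have "card H' \<le> card (insert z Y)" using H'(3) H(3) insert.hyps by simp
    ultimately show ?case using H' by (intro exI[of _ H']) auto
  qed
  from this[OF \<open>finite Z\<close>] show ?thesis by simp
qed

section \<open>Generic points\<close>

text \<open>By Zorn's lemma there is a minimal proper filter below the one generated by \<open>\<D>\<close>.\<close>

lemma ex_ultrafilter:
  fixes \<D> :: "'p set set"
  assumes ne: "\<D> \<noteq> {}" "{} \<notin> \<D>" and dir: "\<And>A B. A \<in> \<D> \<Longrightarrow> B \<in> \<D> \<Longrightarrow> \<exists>C\<in>\<D>. C \<subseteq> A \<inter> B"
  shows "\<exists>F. F \<noteq> bot \<and> (\<forall>A\<in>\<D>. \<forall>\<^sub>F p in F. p \<in> A) \<and>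
    (\<forall>Q. (\<forall>\<^sub>F p in F. Q p) \<or> (\<forall>\<^sub>F p in F. \<not> Q p))"
proof -
  define F0 where "F0 = (INF A\<in>\<D>. principal A)"
  have F0: "eventually Q F0 \<longleftrightarrow> (\<exists>A\<in>\<D>. eventually Q (principal A))" for Q
    unfolding F0_def
  proof (rule eventually_INF_base[OF ne(1)])
    fix A B assume "A \<in> \<D>" "B \<in> \<D>"
    then show "\<exists>C\<in>\<D>. principal C \<le> inf (principal A) (principal B)"
      using dir[of A B] by (simp add: inf_principal)
  qed
  have "\<not> eventually (\<lambda>_. False) F0"
    using ne(2) by (auto simp: F0 eventually_principal)
  then have "F0 \<noteq> bot" by (simp add: trivial_limit_def)
  let ?A = "{F. F \<noteq> bot \<and> F \<le> F0}"
  have "\<exists>m\<in>?A. \<forall>a\<in>?A. m \<ge> a \<longrightarrow> a = m"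
  proof (rule predicate_Zorn)
    show "partial_order_on ?A (relation_of (\<ge>) ?A)"
      by (rule partial_order_on_relation_ofI) auto
    fix C assume C: "C \<in> Chains (relation_of (\<ge>) ?A)"
    show "\<exists>u\<in>?A. \<forall>a\<in>C. a \<ge> u"
    proof (cases "C = {}")
      case True
      then show ?thesis using \<open>F0 \<noteq> bot\<close> by auto
    next
      case False
      have CA: "C \<subseteq> ?A" and tot: "\<And>x y. x \<in> C \<Longrightarrow> y \<in> C \<Longrightarrow> x \<le> y \<or> y \<le> x"
        using C by (auto simp: Chains_def relation_of_def)
      have "eventually (\<lambda>_. False) (Inf C) \<longleftrightarrow> (\<exists>b\<in>C. eventually (\<lambda>_. False) b)"
      proof (rule eventually_Inf_base[OF False])
        fix x y assume "x \<in> C" "y \<in> C"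
        then show "\<exists>z\<in>C. z \<le> inf x y" using tot[of x y] by (auto simp: inf_absorb1 inf_absorb2)
      qed
      then have "Inf C \<noteq> bot"
        using CA by (auto simp: trivial_limit_def)
      moreover have "Inf C \<le> F0"
      proof -
        obtain c where c: "c \<in> C" using False by blast
        then have "c \<le> F0" using CA by blast
        then show ?thesis by (rule Inf_lower2[OF c])
      qed
      ultimately show ?thesis by (auto intro: Inf_lower)
    qed
  qed
  obtain F where F: "F \<noteq> bot" "F \<le> F0" and max: "\<And>G. G \<noteq> bot \<Longrightarrow> G \<le> F \<Longrightarrow> G = F"
  proof -
    from \<open>\<exists>m\<in>?A. \<forall>a\<in>?A. m \<ge> a \<longrightarrow> a = m\<close> obtain m
      where m: "m \<in> ?A" and mx: "\<And>a. a \<in> ?A \<Longrightarrow> a \<le> m \<Longrightarrow> a = m" by blast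
    show thesis
    proof (rule that[of m])
      show "m \<noteq> bot" "m \<le> F0" using m by auto
      show "G = m" if "G \<noteq> bot" "G \<le> m" for G
        by (rule mx) (use that m in \<open>auto intro: order_trans\<close>)
    qed
  qed
  have "(\<forall>\<^sub>F p in F. Q p) \<or> (\<forall>\<^sub>F p in F. \<not> Q p)" for Q
  proof (cases "inf F (principal {p. Q p}) = bot")
    case True
    then have "eventually (\<lambda>_. False) (inf F (principal {p. Q p}))" by simp
    then show ?thesis by (simp add: eventually_inf_principal)
  next
    case False
    then have "inf F (principal {p. Q p}) = F" by (intro max) auto
    then have "F \<le> principal {p. Q p}" by (simp add: le_iff_inf)
    then show ?thesis by (simp add: le_principal)
  qed
  moreover have "\<forall>\<^sub>F p in F. p \<in> A" if "A \<in> \<D>" for A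
  proof -
    have "\<forall>\<^sub>F p in F0. p \<in> A" using that by (auto simp: F0 eventually_principal)
    then show ?thesis by (rule filter_leD[OF F(2)])
  qed
  ultimately show ?thesis using F(1) by blast
qed

text \<open>
  An ultrafilter of points serves as the generic point of a variety. The polynomials that vanish at
  almost all points form a prime ideal, and whatever holds generically holds at actual points over the
  ground field, so that specializing is immediate.
\<close>

definition vanishing :: "(nat \<Rightarrow> 'a::comm_ring_1) filter \<Rightarrow> 'a mpoly set" where
  "vanishing F = {g. \<forall>\<^sub>F p in F. ev p g = 0}"

locale generic_point =
  fixes F :: "(nat \<Rightarrow> 'a::field) filter"
  assumes ultra: "(\<forall>\<^sub>F p in F. Q p) \<or> (\<forall>\<^sub>F p in F. \<not> Q p)" and nontrivial: "F \<noteq> bot"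
begin

lemma notin_vanishingD: "g \<notin> vanishing F \<Longrightarrow> \<forall>\<^sub>F p in F. ev p g \<noteq> 0"
  using ultra[of "\<lambda>p. ev p g = 0"] by (simp add: vanishing_def)

lemma in_vanishingD: "g \<in> vanishing F \<Longrightarrow> \<forall>\<^sub>F p in F. ev p g = 0"
  by (simp add: vanishing_def)

sublocale prime_ideal "vanishing F"
proof
  show "0 \<in> vanishing F" by (simp add: vanishing_def)
  show "1 \<notin> vanishing F" using nontrivial by (simp add: vanishing_def)
  show "a + b \<in> vanishing F" if "a \<in> vanishing F" "b \<in> vanishing F" for a b
    using that unfolding vanishing_def mem_Collect_eq by eventually_elim simp
  show "r * a \<in> vanishing F" if "a \<in> vanishing F" for r a
    using that unfolding vanishing_def mem_Collect_eq by eventually_elim simp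
  show "a \<in> vanishing F \<or> b \<in> vanishing F" if "a * b \<in> vanishing F" for a b
  proof (rule ccontr)
    assume "\<not> (a \<in> vanishing F \<or> b \<in> vanishing F)"
    then have "\<forall>\<^sub>F p in F. ev p a \<noteq> 0" "\<forall>\<^sub>F p in F. ev p b \<noteq> 0" "\<forall>\<^sub>F p in F. ev p (a * b) = 0"
      using that notin_vanishingD in_vanishingD by blast+
    then have "\<forall>\<^sub>F p in F. False" by eventually_elim simp
    then show False using nontrivial by simp
  qed
qed

end


section \<open>Second-order jets\<close>

text \<open>
  \<open>D1\<close> and \<open>D2\<close> are the first and twice the second Taylor coefficient of \<open>g\<close> along the curve
  $p + t \<xi> + t^2 \<zeta> / 2$. The factor two makes them polynomial in \<open>\<xi>\<close> and \<open>\<zeta>\<close> over the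
  integers.
\<close>

definition D1 :: "nat set \<Rightarrow> (nat \<Rightarrow> 'a::comm_ring_1) \<Rightarrow> (nat \<Rightarrow> 'a) \<Rightarrow> 'a mpoly \<Rightarrow> 'a" where
  "D1 J \<xi> p g = (\<Sum>j\<in>J. \<xi> j * ev p (partial_deriv j g))"

definition hess :: "nat set \<Rightarrow> (nat \<Rightarrow> 'a::comm_ring_1) \<Rightarrow> (nat \<Rightarrow> 'a) \<Rightarrow> 'a mpoly \<Rightarrow> 'a" where
  "hess J \<xi> p g = (\<Sum>j\<in>J. \<xi> j * D1 J \<xi> p (partial_deriv j g))"

definition D2 :: "nat set \<Rightarrow> (nat \<Rightarrow> 'a::comm_ring_1) \<Rightarrow> (nat \<Rightarrow> 'a) \<Rightarrow> (nat \<Rightarrow> 'a) \<Rightarrow> 'a mpoly \<Rightarrow> 'a" where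
  "D2 J \<xi> \<zeta> p g = D1 J \<zeta> p g + hess J \<xi> p g"

lemma D1_add [simp]: "D1 J \<xi> p (g + h) = D1 J \<xi> p g + D1 J \<xi> p h"
  by (simp add: D1_def distrib_left sum.distrib)

lemma D1_diff [simp]: "D1 J \<xi> p (g - h) = D1 J \<xi> p g - D1 J \<xi> p h"
  by (simp add: D1_def right_diff_distrib sum_subtractf)

lemma D1_mult: "D1 J \<xi> p (g * h) = D1 J \<xi> p g * ev p h + ev p g * D1 J \<xi> p h"
  by (simp add: D1_def partial_deriv_mult sum_distrib_left sum_distrib_right sum.distrib
      algebra_simps)

lemma D1_zero [simp]: "D1 J \<xi> p 0 = 0"
  by (simp add: D1_def)

lemma D1_sum [simp]: "D1 J \<xi> p (sum f A) = (\<Sum>a\<in>A. D1 J \<xi> p (f a))"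
  by (induction A rule: infinite_finite_induct) auto

lemma D1_cst [simp]: "D1 J \<xi> p (cst c) = 0"
  by (simp add: D1_def)

lemma D1_var: "finite J \<Longrightarrow> j \<in> J \<Longrightarrow> D1 J \<xi> p (var j) = \<xi> j"
proof -
  assume J: "finite J" "j \<in> J"
  have "D1 J \<xi> p (var j) = (\<Sum>i\<in>J. if i = j then \<xi> i else 0)"
    unfolding D1_def by (rule sum.cong) (auto simp: partial_deriv_var)
  then show ?thesis using J by simp
qed

lemma hess_add [simp]: "hess J \<xi> p (g + h) = hess J \<xi> p g + hess J \<xi> p h"
  by (simp add: hess_def distrib_left sum.distrib)

lemma hess_mult:
  "hess J \<xi> p (g * h) = hess J \<xi> p g * ev p h + 2 * D1 J \<xi> p g * D1 J \<xi> p h + ev p g * hess J \<xi> p h"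
proof -
  have "hess J \<xi> p (g * h) = (\<Sum>j\<in>J. (\<xi> j * D1 J \<xi> p (partial_deriv j g)) * ev p h
      + (\<xi> j * ev p (partial_deriv j g)) * D1 J \<xi> p h
      + D1 J \<xi> p g * (\<xi> j * ev p (partial_deriv j h))
      + ev p g * (\<xi> j * D1 J \<xi> p (partial_deriv j h)))"
    unfolding hess_def by (rule sum.cong) (simp_all add: partial_deriv_mult D1_mult algebra_simps)
  also have "\<dots> = hess J \<xi> p g * ev p h + D1 J \<xi> p g * D1 J \<xi> p h
      + D1 J \<xi> p g * D1 J \<xi> p h + ev p g * hess J \<xi> p h"
    by (simp only: sum.distrib sum_distrib_left[symmetric] sum_distrib_right[symmetric]
        hess_def[symmetric] D1_def[symmetric])
  finally show ?thesis by (simp add: algebra_simps)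
qed

lemma hess_zero [simp]: "hess J \<xi> p 0 = 0"
  by (simp add: hess_def)

lemma hess_cst [simp]: "hess J \<xi> p (cst c) = 0"
  by (simp add: hess_def)

lemma hess_var [simp]: "hess J \<xi> p (var j) = 0"
proof -
  have "D1 J \<xi> p (partial_deriv i (var j)) = 0" for i
    using D1_cst[of J \<xi> p 1] by (simp add: partial_deriv_var)
  then show ?thesis by (simp add: hess_def)
qed

lemma D2_add [simp]: "D2 J \<xi> \<zeta> p (g + h) = D2 J \<xi> \<zeta> p g + D2 J \<xi> \<zeta> p h"
  by (simp add: D2_def)

lemma D2_zero [simp]: "D2 J \<xi> \<zeta> p 0 = 0"
  by (simp add: D2_def)

lemma D2_sum [simp]: "D2 J \<xi> \<zeta> p (sum f A) = (\<Sum>a\<in>A. D2 J \<xi> \<zeta> p (f a))"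
  by (induction A rule: infinite_finite_induct) auto

lemma D2_mult: "D2 J \<xi> \<zeta> p (g * h) =
    D2 J \<xi> \<zeta> p g * ev p h + 2 * D1 J \<xi> p g * D1 J \<xi> p h + ev p g * D2 J \<xi> \<zeta> p h"
  by (simp add: D2_def D1_mult hess_mult algebra_simps)

lemma D2_cst [simp]: "D2 J \<xi> \<zeta> p (cst c) = 0"
  by (simp add: D2_def)

lemma D2_var: "finite J \<Longrightarrow> j \<in> J \<Longrightarrow> D2 J \<xi> \<zeta> p (var j) = \<zeta> j"
  by (simp add: D2_def D1_var)

context generic_point
begin

text \<open>
  The gradients of the elements of \<open>vanishing F\<close> span the conormal space of its variety at the generic
  point, and those of the local generators \<open>H\<close> suffice. Row reduction of their Jacobian matrix yields
  local equations \<open>f b\<close>, indexed by pivot coordinates \<open>b\<close>, in terms of which every gradient is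
  determined by its pivot entries.
\<close>

lemma ex_local_equations:
  assumes H: "finite H" "H \<subseteq> vanishing F" "\<forall>g\<in>vanishing F. locally_generated H g"
  shows "\<exists>B \<delta> f. B \<subseteq> J \<and> finite B \<and> card B \<le> card H \<and> \<delta> \<notin> vanishing F \<and>
    (\<forall>b\<in>B. f b \<in> vanishing F) \<and>
    (\<forall>g\<in>vanishing F. \<forall>j\<in>J.
      \<delta> * partial_deriv j g - (\<Sum>b\<in>B. partial_deriv b g * partial_deriv j (f b)) \<in> vanishing F)"
proof -
  let ?P = "vanishing F"
  obtain B \<delta> r m where B: "B \<subseteq> J" "finite B" "card B \<le> card H" "\<delta> \<notin> ?P"
    and r: "\<And>b j. b \<in> B \<Longrightarrow> r b j = (\<Sum>h\<in>H. m b h * partial_deriv j h)"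
    and piv: "\<And>b c. b \<in> B \<Longrightarrow> c \<in> B \<Longrightarrow> r b c - (if b = c then \<delta> else 0) \<in> ?P"
    and span: "\<And>h j. h \<in> H \<Longrightarrow> j \<in> J \<Longrightarrow>
      \<delta> * partial_deriv j h - (\<Sum>b\<in>B. partial_deriv b h * r b j) \<in> ?P"
    by (rule gauss_jordan[OF H(1), of J "\<lambda>h j. partial_deriv j h"]) (rule that; assumption)
  define f where "f b = (\<Sum>h\<in>H. m b h * h)" for b
  have fP: "f b \<in> ?P" for b
    unfolding f_def using H(2) by (intro sum_in mult_in) auto
  have fr: "partial_deriv j (f b) - r b j \<in> ?P" if "b \<in> B" for b j
  proof -
    have "partial_deriv j (f b) - r b j = (\<Sum>h\<in>H. partial_deriv j (m b h) * h)"
      by (simp add: f_def r[OF that] partial_deriv_mult sum.distrib)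
    also have "\<dots> \<in> ?P" using H(2) by (intro sum_in mult_in) auto
    finally show ?thesis .
  qed
  have "\<delta> * partial_deriv j g - (\<Sum>b\<in>B. partial_deriv b g * partial_deriv j (f b)) \<in> ?P"
    if g: "g \<in> ?P" and j: "j \<in> J" for g j
  proof -
    obtain s a where s: "s \<notin> ?P" and sg: "s * g = (\<Sum>h\<in>H. a h * h)"
      using H(3) g unfolding locally_generated_def by blast
    have grad: "s * partial_deriv i g - (\<Sum>h\<in>H. a h * partial_deriv i h) \<in> ?P" for i
    proof -
      have "partial_deriv i (s * g) = partial_deriv i (\<Sum>h\<in>H. a h * h)" by (simp only: sg)
      then have "s * partial_deriv i g - (\<Sum>h\<in>H. a h * partial_deriv i h)
          = (\<Sum>h\<in>H. partial_deriv i (a h) * h) - partial_deriv i s * g"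
        by (simp add: partial_deriv_mult sum.distrib algebra_simps)
      also have "\<dots> \<in> ?P" using H(2) g by (intro diff_in sum_in mult_in) auto
      finally show ?thesis .
    qed
    let ?S = "\<Sum>b\<in>B. partial_deriv b g * partial_deriv j (f b)"
    have "s * (\<delta> * partial_deriv j g - ?S) =
        \<delta> * (s * partial_deriv j g - (\<Sum>h\<in>H. a h * partial_deriv j h))
        + (\<Sum>h\<in>H. a h * (\<delta> * partial_deriv j h - (\<Sum>b\<in>B. partial_deriv b h * r b j)))
        - (\<Sum>b\<in>B. r b j * (s * partial_deriv b g - (\<Sum>h\<in>H. a h * partial_deriv b h)))
        - (\<Sum>b\<in>B. s * partial_deriv b g * (partial_deriv j (f b) - r b j))"
    proof -
      let ?A = "\<Sum>h\<in>H. a h * partial_deriv j h"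
      let ?X = "\<Sum>h\<in>H. a h * (\<Sum>b\<in>B. partial_deriv b h * r b j)"
      let ?Y = "\<Sum>b\<in>B. partial_deriv b g * r b j"
      have "?X = (\<Sum>b\<in>B. r b j * (\<Sum>h\<in>H. a h * partial_deriv b h))"
        unfolding sum_distrib_left by (subst sum.swap) (simp only: mult_ac)
      then have T3: "(\<Sum>b\<in>B. r b j * (s * partial_deriv b g - (\<Sum>h\<in>H. a h * partial_deriv b h))) = s * ?Y - ?X"
        by (simp only: right_diff_distrib sum_subtractf) (simp only: sum_distrib_left mult_ac)
      have T2: "(\<Sum>h\<in>H. a h * (\<delta> * partial_deriv j h - (\<Sum>b\<in>B. partial_deriv b h * r b j)))
          = \<delta> * ?A - ?X"
        by (simp only: right_diff_distrib sum_subtractf) (simp only: sum_distrib_left mult_ac)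
      have T4: "(\<Sum>b\<in>B. s * partial_deriv b g * (partial_deriv j (f b) - r b j)) = s * ?S - s * ?Y"
        by (simp only: right_diff_distrib sum_subtractf) (simp only: sum_distrib_left mult_ac)
      show ?thesis unfolding T2 T3 T4 by (simp add: algebra_simps)
    qed
    also have "\<dots> \<in> ?P"
      using j by (intro diff_in add_in sum_in mult_in grad span fr)
    finally show ?thesis using prime s by blast
  qed
  then show ?thesis using B fP by (intro exI[of _ B] exI[of _ \<delta>] exI[of _ f]) auto
qed

text \<open>
  The correction \<open>\<zeta>\<close> in the pivot coordinates is chosen to cancel the Hessians of the local equations
  \<open>f b\<close>. It serves all other elements \<open>g\<close> of \<open>vanishing F\<close> as well: the relation
  \<open>\<delta> dg = \<Sum> (\<partial>\<^sub>b g) df\<^sub>b\<close> holds on the whole variety, so it may be differentiated along \<open>\<xi>\<close>, and then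
  it expresses the Hessian of \<open>g\<close> by those of the \<open>f b\<close>. Where \<open>2\<close> is invertible, tangent vectors at the
  generic point thus lift to second-order arcs on the variety.
\<close>

lemma second_order_lift:
  assumes J: "finite J" "B \<subseteq> J" and \<delta>: "\<delta> \<notin> vanishing F"
    and span: "\<And>g j. g \<in> vanishing F \<Longrightarrow> j \<in> J \<Longrightarrow>
      \<delta> * partial_deriv j g - (\<Sum>b\<in>B. partial_deriv b g * partial_deriv j (f b)) \<in> vanishing F"
    and g: "g \<in> vanishing F"
  shows "\<forall>\<^sub>F p in F. \<forall>\<xi>. (\<forall>b\<in>B. D1 J \<xi> p (f b) = 0) \<longrightarrow>
    D1 J \<xi> p g = 0 \<and>
    D2 J \<xi> (\<lambda>j. if j \<in> B then - hess J \<xi> p (f j) / ev p \<delta> else 0) p g = 0"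
proof -
  define q where "q j = \<delta> * partial_deriv j g - (\<Sum>b\<in>B. partial_deriv b g * partial_deriv j (f b))" for j
  have q: "q j \<in> vanishing F" if "j \<in> J" for j
    unfolding q_def by (rule span[OF g that])
  have "\<forall>\<^sub>F p in F. ev p \<delta> \<noteq> 0" using \<delta> by (rule notin_vanishingD)
  moreover have "\<forall>\<^sub>F p in F. \<forall>i\<in>J. ev p (q i) = 0"
    using J(1) q by (intro eventually_ball_finite ballI in_vanishingD)
  moreover have "\<forall>\<^sub>F p in F. \<forall>j\<in>J. \<forall>i\<in>J.
      ev p (\<delta> * partial_deriv i (q j) - (\<Sum>b\<in>B. partial_deriv b (q j) * partial_deriv i (f b))) = 0"
    using J(1) q span by (intro eventually_ball_finite ballI in_vanishingD) auto
  ultimately show ?thesis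
  proof eventually_elim
    case (elim p)
    show ?case
    proof (intro allI impI)
      fix \<xi> assume tan: "\<forall>b\<in>B. D1 J \<xi> p (f b) = 0"
      have first: "D1 J \<xi> p g' = 0"
        if "\<And>i. i \<in> J \<Longrightarrow> ev p (\<delta> * partial_deriv i g' - (\<Sum>b\<in>B. partial_deriv b g' * partial_deriv i (f b))) = 0"
        for g'
      proof -
        have "ev p \<delta> * D1 J \<xi> p g' = (\<Sum>i\<in>J. \<xi> i * (ev p \<delta> * ev p (partial_deriv i g')))"
          by (simp add: D1_def sum_distrib_left algebra_simps)
        also have "\<dots> = (\<Sum>i\<in>J. \<xi> i * (\<Sum>b\<in>B. ev p (partial_deriv b g') * ev p (partial_deriv i (f b))))"
          by (rule sum.cong) (use that in auto)
        also have "\<dots> = (\<Sum>b\<in>B. ev p (partial_deriv b g') * D1 J \<xi> p (f b))"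
          unfolding D1_def sum_distrib_left by (subst sum.swap) (simp add: algebra_simps)
        also have "\<dots> = 0" using tan by simp
        finally show ?thesis using elim(1) by simp
      qed
      have D1g: "D1 J \<xi> p g = 0"
        by (rule first) (use elim(2) in \<open>simp add: q_def\<close>)
      have D1q: "D1 J \<xi> p (q j) = 0" if "j \<in> J" for j
        by (rule first) (use elim(3) that in blast)
      have "0 = (\<Sum>j\<in>J. \<xi> j * D1 J \<xi> p (q j))" using D1q by simp
      also have "\<dots> = (\<Sum>j\<in>J. D1 J \<xi> p \<delta> * (\<xi> j * ev p (partial_deriv j g))
          + ev p \<delta> * (\<xi> j * D1 J \<xi> p (partial_deriv j g))
          - (\<Sum>b\<in>B. D1 J \<xi> p (partial_deriv b g) * (\<xi> j * ev p (partial_deriv j (f b))))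
          - (\<Sum>b\<in>B. ev p (partial_deriv b g) * (\<xi> j * D1 J \<xi> p (partial_deriv j (f b)))))"
        by (rule sum.cong) (simp_all add: q_def D1_mult sum.distrib sum_distrib_left algebra_simps)
      also have "\<dots> = D1 J \<xi> p \<delta> * D1 J \<xi> p g + ev p \<delta> * hess J \<xi> p g
          - (\<Sum>b\<in>B. D1 J \<xi> p (partial_deriv b g) * D1 J \<xi> p (f b))
          - (\<Sum>b\<in>B. ev p (partial_deriv b g) * hess J \<xi> p (f b))"
      proof -
        have "(\<Sum>j\<in>J. \<Sum>b\<in>B. D1 J \<xi> p (partial_deriv b g) * (\<xi> j * ev p (partial_deriv j (f b))))
            = (\<Sum>b\<in>B. D1 J \<xi> p (partial_deriv b g) * D1 J \<xi> p (f b))"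
          by (subst sum.swap) (simp only: sum_distrib_left[symmetric] D1_def[symmetric])
        moreover have "(\<Sum>j\<in>J. \<Sum>b\<in>B. ev p (partial_deriv b g) * (\<xi> j * D1 J \<xi> p (partial_deriv j (f b))))
            = (\<Sum>b\<in>B. ev p (partial_deriv b g) * hess J \<xi> p (f b))"
          by (subst sum.swap) (simp only: sum_distrib_left[symmetric] hess_def[symmetric])
        ultimately show ?thesis
          by (simp only: sum.distrib sum_subtractf sum_distrib_left[symmetric] D1_def[symmetric] hess_def[symmetric])
      qed
      also have "\<dots> = ev p \<delta> * hess J \<xi> p g - (\<Sum>b\<in>B. ev p (partial_deriv b g) * hess J \<xi> p (f b))"
        using D1g tan by simp
      finally have hess: "ev p \<delta> * hess J \<xi> p g = (\<Sum>b\<in>B. ev p (partial_deriv b g) * hess J \<xi> p (f b))"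
        by simp
      let ?\<zeta> = "\<lambda>j. if j \<in> B then - hess J \<xi> p (f j) / ev p \<delta> else 0"
      have "D1 J ?\<zeta> p g = (\<Sum>b\<in>B. - hess J \<xi> p (f b) / ev p \<delta> * ev p (partial_deriv b g))"
        unfolding D1_def by (rule sum.mono_neutral_cong_right) (use J in auto)
      also have "\<dots> = - (\<Sum>b\<in>B. ev p (partial_deriv b g) * hess J \<xi> p (f b)) / ev p \<delta>"
        by (simp add: sum_divide_distrib sum_negf mult.commute)
      also have "\<dots> = - hess J \<xi> p g"
        unfolding hess[symmetric] using elim(1) by simp
      finally have "D2 J \<xi> ?\<zeta> p g = 0" by (simp add: D2_def)
      then show "D1 J \<xi> p g = 0 \<and> D2 J \<xi> ?\<zeta> p g = 0" using D1g by blast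
    qed
  qed
qed

end

section \<open>Linear equations over a field\<close>

lemma prime_ideal_zero: "prime_ideal {0 :: 'a::field}"
  by unfold_locales auto

lemma field_gauss_jordan:
  fixes h :: "'i \<Rightarrow> 'j \<Rightarrow> 'a::field"
  assumes "finite I"
  shows "\<exists>B f. B \<subseteq> J \<and> finite B \<and> card B \<le> card I \<and>
    (\<forall>i\<in>I. \<forall>j\<in>J. h i j = (\<Sum>b\<in>B. h i b * f b j)) \<and>
    (\<forall>b\<in>B. \<forall>c\<in>B. f b c = (if b = c then 1 else 0))"
proof -
  obtain B \<delta> f m where B: "B \<subseteq> J" "finite B" "card B \<le> card I" and \<delta>': "\<delta> \<notin> {0}"
    and f: "\<And>b j. b \<in> B \<Longrightarrow> f b j = (\<Sum>i\<in>I. m b i * h i j)"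
    and piv: "\<And>b c. b \<in> B \<Longrightarrow> c \<in> B \<Longrightarrow> f b c - (if b = c then \<delta> else 0) \<in> {0}"
    and span: "\<And>i j. i \<in> I \<Longrightarrow> j \<in> J \<Longrightarrow> \<delta> * h i j - (\<Sum>b\<in>B. h i b * f b j) \<in> {0}"
    by (rule prime_ideal.gauss_jordan[OF prime_ideal_zero assms, of J h]) (rule that; assumption)
  have \<delta>: "\<delta> \<noteq> 0" using \<delta>' by simp
  show ?thesis
  proof (intro exI conjI ballI allI impI)
    show "B \<subseteq> J" "finite B" "card B \<le> card I" by (fact B)+
    show "f b c / \<delta> = (if b = c then 1 else 0)" if "b \<in> B" "c \<in> B" for b c
    proof -
      have "f b c = (if b = c then \<delta> else 0)" using piv[OF that] by simp
      then show ?thesis using \<delta> by simp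
    qed
    show "h i j = (\<Sum>b\<in>B. h i b * (f b j / \<delta>))" if "i \<in> I" "j \<in> J" for i j
    proof -
      have "\<delta> * h i j = (\<Sum>b\<in>B. h i b * f b j)" using span[OF that] by simp
      then have "h i j = (\<Sum>b\<in>B. h i b * f b j) / \<delta>"
        using \<delta> by (simp add: nonzero_eq_divide_eq mult.commute)
      then show ?thesis by (simp add: sum_divide_distrib)
    qed
  qed
qed

text \<open>A parametrization of a solution space: the coordinates outside the pivots \<open>B\<close> are free.\<close>

lemma solve_pivots:
  fixes f :: "'j \<Rightarrow> 'j \<Rightarrow> 'a::field"
  assumes J: "finite J" "B \<subseteq> J" and f: "\<And>b c. b \<in> B \<Longrightarrow> c \<in> B \<Longrightarrow> f b c = (if b = c then 1 else 0)"
    and b: "b \<in> B"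
  shows "(\<Sum>j\<in>J. f b j * (if j \<in> B then - (\<Sum>l\<in>J - B. f j l * y l) else y j)) = 0"
proof -
  have fin: "finite B" using J finite_subset by blast
  let ?u = "\<lambda>j. if j \<in> B then - (\<Sum>l\<in>J - B. f j l * y l) else y j"
  have "(\<Sum>j\<in>J. f b j * ?u j) = (\<Sum>j\<in>J - B. f b j * ?u j) + (\<Sum>j\<in>B. f b j * ?u j)"
    by (rule sum.subset_diff[OF J(2,1)])
  moreover have "(\<Sum>j\<in>B. f b j * ?u j) = (\<Sum>j\<in>B. if j = b then ?u b else 0)"
    by (rule sum.cong) (use f b in auto)
  moreover have "(\<Sum>j\<in>J - B. f b j * ?u j) = (\<Sum>j\<in>J - B. f b j * y j)"
    by (rule sum.cong) auto
  ultimately show ?thesis using fin b by simp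
qed

lemma ex_pivots:
  fixes h :: "'i \<Rightarrow> 'j \<Rightarrow> 'a::field"
  assumes "finite I" "finite J"
  shows "\<exists>B\<subseteq>J. card B \<le> card I \<and>
    (\<forall>y. \<exists>u. (\<forall>j. j \<notin> B \<longrightarrow> u j = y j) \<and> (\<forall>i\<in>I. (\<Sum>j\<in>J. h i j * u j) = 0))"
proof -
  obtain B f where B: "B \<subseteq> J" "finite B" "card B \<le> card I"
    and span: "\<forall>i\<in>I. \<forall>j\<in>J. h i j = (\<Sum>b\<in>B. h i b * f b j)"
    and f: "\<forall>b\<in>B. \<forall>c\<in>B. f b c = (if b = c then 1 else 0)"
    using field_gauss_jordan[OF assms(1), of J h] by (elim exE conjE)
  have "\<exists>u. (\<forall>j. j \<notin> B \<longrightarrow> u j = y j) \<and> (\<forall>i\<in>I. (\<Sum>j\<in>J. h i j * u j) = 0)" for y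
  proof (intro exI conjI ballI)
    let ?u = "\<lambda>j. if j \<in> B then - (\<Sum>l\<in>J - B. f j l * y l) else y j"
    show "\<forall>j. j \<notin> B \<longrightarrow> ?u j = y j" by simp
    show "(\<Sum>j\<in>J. h i j * ?u j) = 0" if "i \<in> I" for i
    proof -
      have "(\<Sum>j\<in>J. h i j * ?u j) = (\<Sum>j\<in>J. \<Sum>b\<in>B. h i b * (f b j * ?u j))"
      proof (rule sum.cong[OF refl])
        fix j assume "j \<in> J"
        then have h: "h i j = (\<Sum>b\<in>B. h i b * f b j)" using span that by blast
        show "h i j * ?u j = (\<Sum>b\<in>B. h i b * (f b j * ?u j))"
          by (subst h) (simp only: sum_distrib_right mult.assoc)
      qed
      also have "\<dots> = (\<Sum>b\<in>B. h i b * (\<Sum>j\<in>J. f b j * ?u j))"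
        by (subst sum.swap) (simp only: sum_distrib_left)
      also have "\<dots> = 0"
      proof (rule sum.neutral, rule ballI)
        fix b assume "b \<in> B"
        then have "(\<Sum>j\<in>J. f b j * ?u j) = 0"
          by (intro solve_pivots[OF assms(2) B(1)]) (use f in auto)
        then show "h i b * (\<Sum>j\<in>J. f b j * ?u j) = 0" by simp
      qed
      finally show ?thesis .
    qed
  qed
  then show ?thesis using B by blast
qed

lemma ex_nonzero_solution:
  fixes h :: "'i \<Rightarrow> 'j \<Rightarrow> 'a::field"
  assumes "finite I" "finite J" "card I < card J"
  shows "\<exists>u. (\<exists>j\<in>J. u j \<noteq> 0) \<and> (\<forall>i\<in>I. (\<Sum>j\<in>J. h i j * u j) = 0)"
proof -
  obtain B where B: "B \<subseteq> J" "card B \<le> card I"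
    and ex: "\<And>y. \<exists>u. (\<forall>j. j \<notin> B \<longrightarrow> u j = y j) \<and> (\<forall>i\<in>I. (\<Sum>j\<in>J. h i j * u j) = 0)"
    using ex_pivots[OF assms(1,2), of h] by blast
  have "B \<noteq> J" using B assms(3) by auto
  then obtain j where "j \<in> J" "j \<notin> B" using B by blast
  moreover obtain u where "\<forall>j. j \<notin> B \<longrightarrow> u j = 1" "\<forall>i\<in>I. (\<Sum>j\<in>J. h i j * u j) = 0"
    using ex[of "\<lambda>_. 1"] by blast
  ultimately show ?thesis by (intro exI[of _ u] conjI bexI[of _ j]) auto
qed


section \<open>Polynomial functions\<close>

definition form_fun :: "nat \<Rightarrow> nat \<Rightarrow> ((nat \<Rightarrow> 'a::comm_ring_1) \<Rightarrow> 'a) \<Rightarrow> bool" where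
  "form_fun N d q \<longleftrightarrow> (\<exists>Q. homog N d Q \<and> (\<forall>w. q w = ev w Q))"

lemma form_fun_zero [simp]: "form_fun N d (\<lambda>_. 0)"
  unfolding form_fun_def by (rule exI[of _ 0]) simp

lemma form_fun_const: "form_fun N 0 (\<lambda>_. c)"
  unfolding form_fun_def by (rule exI[of _ "cst c"]) simp

lemma form_fun_coord: "i \<in> {1..N} \<Longrightarrow> form_fun N 1 (\<lambda>w. w i)"
  unfolding form_fun_def by (rule exI[of _ "var i"]) (simp add: homog_var del: One_nat_def)

lemma form_fun_add: "form_fun N d q \<Longrightarrow> form_fun N d r \<Longrightarrow> form_fun N d (\<lambda>w. q w + r w)"
  unfolding form_fun_def
  by (elim exE conjE, rename_tac Q R, rule_tac x = "Q + R" in exI) (simp add: homog_add)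

lemma form_fun_mult: "form_fun N d q \<Longrightarrow> form_fun N e r \<Longrightarrow> form_fun N (d + e) (\<lambda>w. q w * r w)"
  unfolding form_fun_def
  by (elim exE conjE, rename_tac Q R, rule_tac x = "Q * R" in exI) (simp add: homog_mult)

lemma form_fun_cmult: "form_fun N d q \<Longrightarrow> form_fun N d (\<lambda>w. c * q w)"
  using form_fun_mult[OF form_fun_const, of N d q c] by simp

lemma form_fun_multc: "form_fun N d q \<Longrightarrow> form_fun N d (\<lambda>w. q w * c)"
  using form_fun_mult[OF _ form_fun_const, of N d q c] by simp

lemma form_fun_divc: "form_fun N d q \<Longrightarrow> form_fun N d (\<lambda>w. q w / (c :: 'a::field))"
  using form_fun_multc[of N d q "inverse c"] by (simp add: divide_inverse)

lemma form_fun_uminus: "form_fun N d q \<Longrightarrow> form_fun N d (\<lambda>w. - q w)"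
  using form_fun_cmult[of N d q "- 1"] by simp

lemma form_fun_diff: "form_fun N d q \<Longrightarrow> form_fun N d r \<Longrightarrow> form_fun N d (\<lambda>w. q w - r w)"
  using form_fun_add[OF _ form_fun_uminus] by simp

lemma form_fun_sum: "(\<And>a. a \<in> A \<Longrightarrow> form_fun N d (q a)) \<Longrightarrow> form_fun N d (\<lambda>w. \<Sum>a\<in>A. q a w)"
  by (induction A rule: infinite_finite_induct) (auto intro: form_fun_add)

lemma form_fun_2: "form_fun N 1 q \<Longrightarrow> form_fun N 1 r \<Longrightarrow> form_fun N 2 (\<lambda>w. q w * r w)"
  using form_fun_mult[of N 1 q 1 r] by (simp add: numeral_2_eq_2)


section \<open>Quartic forms as symmetric tensors\<close>

text \<open>
  In \<open>2 N\<close> variables, the first \<open>N\<close> stand for a vector \<open>v\<close> and the others for a vector \<open>x\<close>; the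
  entries of the matrix are those of the bilinear form \<open>T v x\<close>.
\<close>

definition contraction :: "nat \<Rightarrow> (nat \<Rightarrow> nat \<Rightarrow> nat \<Rightarrow> nat \<Rightarrow> 'a::comm_ring_1) \<Rightarrow> nat \<Rightarrow> nat \<Rightarrow> 'a mpoly" where
  "contraction N T i l = (\<Sum>a=1..N. \<Sum>b=1..N. cst (T a b i l) * (var a * var (N + b)))"

definition doubled :: "nat \<Rightarrow> (nat \<Rightarrow> 'a) \<Rightarrow> nat \<Rightarrow> 'a" where
  "doubled N w j = (if j \<le> N then w j else w (j - N))"

lemma form_fun_doubled: "j \<in> {1..2 * N} \<Longrightarrow> form_fun N 1 (\<lambda>w. doubled N w j)"
proof -
  assume j: "j \<in> {1..2 * N}"
  show ?thesis
  proof (cases "j \<le> N")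
    case True
    then show ?thesis using form_fun_coord[of j N] j unfolding doubled_def by simp
  next
    case False
    then have "j - N \<in> {1..N}" using j by auto
    then show ?thesis using form_fun_coord[of "j - N" N] False unfolding doubled_def by simp
  qed
qed

lemma form_fun_D1: "form_fun N 1 (\<lambda>w. D1 {1..2 * N} (doubled N w) p g)"
  unfolding D1_def by (intro form_fun_sum form_fun_multc form_fun_doubled)

lemma form_fun_hess: "form_fun N 2 (\<lambda>w. hess {1..2 * N} (doubled N w) p g)"
  unfolding hess_def by (intro form_fun_sum form_fun_2 form_fun_doubled form_fun_D1)

lemma D2_contraction:
  "D2 {1..2 * N} (doubled N w) \<zeta> p (contraction N T i l) =
    (\<Sum>a=1..N. \<Sum>b=1..N. T a b i l * (\<zeta> a * p (N + b) + 2 * w a * w b + p a * \<zeta> (N + b)))"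
proof -
  have "D2 {1..2 * N} (doubled N w) \<zeta> p (cst (T a b i l) * (var a * var (N + b)))
      = T a b i l * (\<zeta> a * p (N + b) + 2 * w a * w b + p a * \<zeta> (N + b))"
    if "a \<in> {1..N}" "b \<in> {1..N}" for a b
    using that by (simp add: D2_mult D1_mult D2_var D1_var doubled_def)
  then show ?thesis unfolding contraction_def D2_sum by (intro sum.cong refl) simp
qed

text \<open>
  \<open>A, A', A''\<close> are the jets of a family of symmetric matrices and \<open>d w, y, z\<close> those of a family of
  kernel vectors. Pairing the second-order equation with \<open>w\<close> removes \<open>z\<close>, and pairing the first-order
  equation with \<open>y\<close> turns the mixed term into the quadratic form of \<open>A\<close> at \<open>y\<close>. Its rank is that of
  \<open>A\<close>, which is what makes this useful.
\<close>

lemma schur_complement: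
  fixes A A' A'' :: "nat \<Rightarrow> nat \<Rightarrow> 'a::comm_ring_1"
  assumes sym: "\<And>i l. A i l = A l i" "\<And>i l. A' i l = A' l i"
    and zero: "\<And>i. i \<in> I \<Longrightarrow> (\<Sum>l\<in>I. A i l * w l) = 0"
    and one: "\<And>i. i \<in> I \<Longrightarrow> (\<Sum>l\<in>I. A' i l * (d * w l) + A i l * y l) = 0"
    and two: "\<And>i. i \<in> I \<Longrightarrow> (\<Sum>l\<in>I. A'' i l * (d * w l) + 2 * A' i l * y l + A i l * z l) = 0"
  shows "d ^ 2 * (\<Sum>i\<in>I. \<Sum>l\<in>I. w i * w l * A'' i l) = 2 * (\<Sum>i\<in>I. \<Sum>l\<in>I. y i * A i l * y l)"
proof -
  let ?w2 = "\<Sum>i\<in>I. \<Sum>l\<in>I. w i * w l * A'' i l"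
  let ?wy = "\<Sum>i\<in>I. \<Sum>l\<in>I. w i * A' i l * y l"
  let ?yy = "\<Sum>i\<in>I. \<Sum>l\<in>I. y i * A i l * y l"
  have "0 = (\<Sum>i\<in>I. w i * (\<Sum>l\<in>I. A'' i l * (d * w l) + 2 * A' i l * y l + A i l * z l))"
    using two by simp
  also have "\<dots> = (\<Sum>i\<in>I. \<Sum>l\<in>I. d * (w i * w l * A'' i l) + 2 * (w i * A' i l * y l) + w i * A i l * z l)"
    by (simp only: sum_distrib_left distrib_left mult_ac)
  also have "\<dots> = d * ?w2 + 2 * ?wy + (\<Sum>i\<in>I. \<Sum>l\<in>I. w i * A i l * z l)"
    by (simp only: sum.distrib sum_distrib_left)
  also have "(\<Sum>i\<in>I. \<Sum>l\<in>I. w i * A i l * z l) = (\<Sum>l\<in>I. (\<Sum>i\<in>I. A l i * w i) * z l)"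
    unfolding sum_distrib_right by (subst sum.swap) (simp only: sym(1) mult_ac)
  also have "\<dots> = 0" using zero by simp
  finally have 1: "d * ?w2 = - (2 * ?wy)" by (simp add: eq_neg_iff_add_eq_0)
  have "0 = (\<Sum>i\<in>I. y i * (\<Sum>l\<in>I. A' i l * (d * w l) + A i l * y l))"
    using one by simp
  also have "\<dots> = (\<Sum>i\<in>I. \<Sum>l\<in>I. d * (w l * A' i l * y i) + y i * A i l * y l)"
    by (simp only: sum_distrib_left distrib_left mult_ac)
  also have "\<dots> = d * (\<Sum>i\<in>I. \<Sum>l\<in>I. w l * A' i l * y i) + ?yy"
    by (simp only: sum.distrib sum_distrib_left)
  also have "(\<Sum>i\<in>I. \<Sum>l\<in>I. w l * A' i l * y i) = ?wy"
    by (subst sum.swap) (simp only: sym(2))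
  finally have 2: "d * ?wy = - ?yy" by (simp add: eq_neg_iff_add_eq_0)
  have "d ^ 2 * ?w2 = d * (d * ?w2)" by (simp add: power2_eq_square)
  also have "\<dots> = - 2 * (d * ?wy)" by (simp add: 1)
  finally show ?thesis by (simp add: 2)
qed

lemma sum_pairs_swap:
  "(\<Sum>i\<in>I. \<Sum>l\<in>I. \<Sum>a\<in>I. \<Sum>b\<in>I. X i l a b) = (\<Sum>a\<in>I. \<Sum>b\<in>I. \<Sum>i\<in>I. \<Sum>l\<in>I. X i l a b :: 'b::comm_monoid_add)"
proof -
  have pair: "(\<Sum>i\<in>I. \<Sum>l\<in>I. g i l) = (\<Sum>z\<in>I \<times> I. g (fst z) (snd z))" for g :: "_ \<Rightarrow> _ \<Rightarrow> 'b"
    by (simp add: sum.cartesian_product case_prod_beta)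
  show ?thesis unfolding pair by (rule sum.swap)
qed

lemma sum_double_range:
  "(\<Sum>j=1..2 * N. g j) = (\<Sum>j=1..N. g j) + (\<Sum>j=1..N. g (N + j :: nat) :: 'a::comm_monoid_add)"
proof -
  have "{1..2 * N} = {1..N} \<union> (+) N ` {1..N}"
    by auto
  then have "(\<Sum>j=1..2 * N. g j) = (\<Sum>j\<in>{1..N} \<union> (+) N ` {1..N}. g j)" by simp
  also have "\<dots> = (\<Sum>j=1..N. g j) + (\<Sum>j\<in>(+) N ` {1..N}. g j)"
    by (rule sum.union_disjoint) auto
  also have "(\<Sum>j\<in>(+) N ` {1..N}. g j) = (\<Sum>j=1..N. g (N + j))"
    by (subst sum.reindex) simp_all
  finally show ?thesis .
qed

definition quartic :: "nat \<Rightarrow> (nat \<Rightarrow> nat \<Rightarrow> nat \<Rightarrow> nat \<Rightarrow> 'a::comm_ring_1) \<Rightarrow> (nat \<Rightarrow> 'a) \<Rightarrow> 'a" where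
  "quartic N T w = (\<Sum>a=1..N. \<Sum>b=1..N. \<Sum>i=1..N. \<Sum>l=1..N. T a b i l * w a * w b * w i * w l)"

text \<open>The quadratic form that multiplies the coordinate \<open>\<zeta> j\<close> of the second-order correction.\<close>

definition correction_coeff ::
    "nat \<Rightarrow> (nat \<Rightarrow> nat \<Rightarrow> nat \<Rightarrow> nat \<Rightarrow> 'a::comm_ring_1) \<Rightarrow> (nat \<Rightarrow> 'a) \<Rightarrow> nat \<Rightarrow> (nat \<Rightarrow> 'a) \<Rightarrow> 'a" where
  "correction_coeff N T p j w =
    (\<Sum>a=1..N. \<Sum>i=1..N. \<Sum>l=1..N.
      (if j \<le> N then T j a i l * p (N + a) else T a (j - N) i l * p a) * (w i * w l))"

lemma form_fun_correction_coeff: "form_fun N 2 (correction_coeff N T p j)"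
  unfolding correction_coeff_def[abs_def]
  by (intro form_fun_sum form_fun_cmult form_fun_2 form_fun_coord)

lemma quadratic_form_D2:
  "(\<Sum>i=1..N. \<Sum>l=1..N. w i * w l *
      (\<Sum>a=1..N. \<Sum>b=1..N. T a b i l * (\<zeta> a * p (N + b) + 2 * w a * w b + p a * \<zeta> (N + b))))
    = 2 * quartic N T w + (\<Sum>j=1..2 * N. \<zeta> j * correction_coeff N T p j w)"
proof -
  let ?I = "{1..N}"
  have "(\<Sum>i\<in>?I. \<Sum>l\<in>?I. w i * w l *
      (\<Sum>a\<in>?I. \<Sum>b\<in>?I. T a b i l * (\<zeta> a * p (N + b) + 2 * w a * w b + p a * \<zeta> (N + b))))
    = (\<Sum>i\<in>?I. \<Sum>l\<in>?I. \<Sum>a\<in>?I. \<Sum>b\<in>?I. \<zeta> a * (T a b i l * p (N + b) * (w i * w l))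
        + 2 * (T a b i l * w a * w b * w i * w l) + \<zeta> (N + b) * (T a b i l * p a * (w i * w l)))"
    unfolding sum_distrib_left by (intro sum.cong refl) (simp add: algebra_simps)
  also have "\<dots> = (\<Sum>a\<in>?I. \<Sum>b\<in>?I. \<Sum>i\<in>?I. \<Sum>l\<in>?I. \<zeta> a * (T a b i l * p (N + b) * (w i * w l))
        + 2 * (T a b i l * w a * w b * w i * w l) + \<zeta> (N + b) * (T a b i l * p a * (w i * w l)))"
    by (rule sum_pairs_swap)
  also have "\<dots> = (\<Sum>a\<in>?I. \<Sum>b\<in>?I. \<Sum>i\<in>?I. \<Sum>l\<in>?I. \<zeta> a * (T a b i l * p (N + b) * (w i * w l)))
      + 2 * quartic N T w
      + (\<Sum>a\<in>?I. \<Sum>b\<in>?I. \<Sum>i\<in>?I. \<Sum>l\<in>?I. \<zeta> (N + b) * (T a b i l * p a * (w i * w l)))"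
    unfolding quartic_def sum.distrib sum_distrib_left[of 2] by (rule refl)
  also have "(\<Sum>a\<in>?I. \<Sum>b\<in>?I. \<Sum>i\<in>?I. \<Sum>l\<in>?I. \<zeta> a * (T a b i l * p (N + b) * (w i * w l)))
      = (\<Sum>a\<in>?I. \<zeta> a * correction_coeff N T p a w)"
    unfolding correction_coeff_def by (intro sum.cong refl) (simp add: sum_distrib_left)
  also have "(\<Sum>a\<in>?I. \<Sum>b\<in>?I. \<Sum>i\<in>?I. \<Sum>l\<in>?I. \<zeta> (N + b) * (T a b i l * p a * (w i * w l)))
      = (\<Sum>b\<in>?I. \<zeta> (N + b) * correction_coeff N T p (N + b) w)"
    unfolding correction_coeff_def
    by (subst sum.swap, intro sum.cong refl) (simp add: sum_distrib_left)
  finally show ?thesis unfolding sum_double_range by simp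
qed

text \<open>
  Modulo vectors supported on \<open>Q\<close>, every vector satisfies the \<open>k\<close> equations \<open>\<l>\<close>. So a vector that
  satisfies these equations and is annihilated by the rows of \<open>A\<close> in \<open>Q\<close> is in the kernel of \<open>A\<close>. If
  there were more than \<open>2 * k\<close> pivots, then a nonzero such vector would be supported on \<open>B\<close>, where the
  reduced rows \<open>R\<close> are \<open>d\<close> times the identity.
\<close>

lemma card_pivots_le:
  fixes A :: "nat \<Rightarrow> nat \<Rightarrow> 'a::field"
  assumes B: "B \<subseteq> {1..N}" and d: "d \<noteq> 0"
    and R: "\<And>b j. b \<in> B \<Longrightarrow> R b j = (\<Sum>i=1..N. m b i * A i j)"
    and piv: "\<And>b c. b \<in> B \<Longrightarrow> c \<in> B \<Longrightarrow> R b c = (if b = c then d else 0)"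
    and Q: "Q \<subseteq> {1..N}" "card Q \<le> k"
    and lift: "\<And>y. \<exists>u. (\<forall>i. i \<notin> Q \<longrightarrow> u i = y i) \<and> (\<forall>m<k. (\<Sum>j=1..N. \<l> m j * u j) = 0)"
    and iso: "\<And>u v. (\<forall>m<k. (\<Sum>j=1..N. \<l> m j * u j) = 0) \<Longrightarrow> (\<forall>m<k. (\<Sum>j=1..N. \<l> m j * v j) = 0) \<Longrightarrow>
      (\<Sum>i=1..N. \<Sum>l=1..N. u i * v l * A i l) = 0"
  shows "card B \<le> 2 * k"
proof (rule ccontr)
  assume "\<not> card B \<le> 2 * k"
  have finQ: "finite Q" and finB: "finite B" using Q B finite_subset by auto
  let ?I = "{..<k} <+> Q"
  let ?h = "\<lambda>i j. case i of Inl m \<Rightarrow> \<l> m j | Inr q \<Rightarrow> A q j"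
  have "card ?I < card B"
    using \<open>\<not> card B \<le> 2 * k\<close> Q(2) finQ by (simp add: card_Plus)
  moreover have "finite ?I" using finQ by simp
  ultimately obtain u0 where u0: "\<exists>j\<in>B. u0 j \<noteq> 0" "\<forall>i\<in>?I. (\<Sum>j\<in>B. ?h i j * u0 j) = 0"
    using ex_nonzero_solution[of ?I B ?h] finB by blast
  define c where "c j = (if j \<in> B then u0 j else 0)" for j
  have sumc: "(\<Sum>j=1..N. g j * c j) = (\<Sum>j\<in>B. g j * u0 j)" for g
    by (rule sum.mono_neutral_cong_right) (use B in \<open>auto simp: c_def\<close>)
  have c\<l>: "\<forall>m<k. (\<Sum>j=1..N. \<l> m j * c j) = 0"
  proof (intro allI impI)
    fix m assume "m < k"
    then have "Inl m \<in> ?I" by auto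
    with u0(2) have "(\<Sum>j\<in>B. ?h (Inl m) j * u0 j) = 0" by blast
    then show "(\<Sum>j=1..N. \<l> m j * c j) = 0" unfolding sumc by simp
  qed
  have cQ: "(\<Sum>j=1..N. A q j * c j) = 0" if "q \<in> Q" for q
  proof -
    have "Inr q \<in> ?I" using that by auto
    with u0(2) have "(\<Sum>j\<in>B. ?h (Inr q) j * u0 j) = 0" by blast
    then show ?thesis unfolding sumc by simp
  qed
  have Ac: "(\<Sum>j=1..N. A i j * c j) = 0" if i: "i \<in> {1..N}" for i
  proof (cases "i \<in> Q")
    case False
    obtain u where u: "\<forall>j. j \<notin> Q \<longrightarrow> u j = (if j = i then 1 else 0)"
      "\<forall>m<k. (\<Sum>j=1..N. \<l> m j * u j) = 0"
      using lift[of "\<lambda>j. if j = i then 1 else 0"] by blast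
    have "0 = (\<Sum>j=1..N. \<Sum>l=1..N. u j * c l * A j l)" using iso[OF u(2) c\<l>] by simp
    also have "\<dots> = (\<Sum>j=1..N. u j * (\<Sum>l=1..N. A j l * c l))"
      by (simp add: sum_distrib_left algebra_simps)
    also have "\<dots> = (\<Sum>j=1..N. if j = i then (\<Sum>l=1..N. A i l * c l) else 0)"
      by (rule sum.cong[OF refl]) (use cQ u(1) False in \<open>force\<close>)
    also have "\<dots> = (\<Sum>l=1..N. A i l * c l)" using i by simp
    finally show ?thesis by simp
  qed (rule cQ)
  have "u0 b = 0" if b: "b \<in> B" for b
  proof -
    have "0 = (\<Sum>i=1..N. m b i * (\<Sum>j=1..N. A i j * c j))" using Ac by simp
    also have "\<dots> = (\<Sum>j=1..N. R b j * c j)"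
      unfolding R[OF b] sum_distrib_left sum_distrib_right by (subst sum.swap) (simp only: mult.assoc)
    also have "\<dots> = (\<Sum>j\<in>B. R b j * u0 j)" by (rule sumc)
    also have "\<dots> = (\<Sum>j\<in>B. if j = b then d * u0 b else 0)"
      by (rule sum.cong) (use piv b in auto)
    also have "\<dots> = d * u0 b" using b finB by simp
    finally show ?thesis using d by simp
  qed
  then show False using u0(1) by blast
qed

section \<open>The decomposition at a generic point\<close>

text \<open>
  The bilinear form \<open>T v x\<close>, for \<open>p = (v, x)\<close>, vanishes on a subspace of codimension at most \<open>k\<close>. The
  set \<open>Q\<close> is a witness for the codimension: the subspace projects onto the other coordinates.
\<close>

definition isotropic_point ::
    "nat \<Rightarrow> nat \<Rightarrow> (nat \<Rightarrow> nat \<Rightarrow> nat \<Rightarrow> nat \<Rightarrow> 'a::field) \<Rightarrow> (nat \<Rightarrow> 'a) \<Rightarrow> bool" where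
  "isotropic_point N k T p \<longleftrightarrow> (\<exists>\<l> Q. Q \<subseteq> {1..N} \<and> card Q \<le> k \<and>
    (\<forall>y. \<exists>u. (\<forall>i. i \<notin> Q \<longrightarrow> u i = y i) \<and> (\<forall>m<k. (\<Sum>j=1..N. \<l> m j * u j) = 0)) \<and>
    (\<forall>u v. (\<forall>m<k. (\<Sum>j=1..N. \<l> m j * u j) = 0) \<longrightarrow> (\<forall>m<k. (\<Sum>j=1..N. \<l> m j * v j) = 0) \<longrightarrow>
      (\<Sum>i=1..N. \<Sum>l=1..N. u i * v l * ev p (contraction N T i l)) = 0))"

context generic_point
begin

text \<open>
  The matrix \<open>contraction N T\<close> has rank at most \<open>2 * k\<close> at the generic point \<open>p = (v, x)\<close>, and reduced
  rows \<open>R b\<close> for pivots \<open>b \<in> C\<close> yield kernel vectors \<open>K w\<close> with polynomial entries. If \<open>(w, w)\<close> is a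
  tangent vector at \<open>p\<close>, then \<open>contraction N T\<close> times \<open>K w\<close> vanishes to second order along an arc in
  this direction. The second-order term of the matrix at \<open>(w, w)\<close> is \<open>2 T w w\<close> up to the correction
  \<open>\<zeta>\<close>, which lives in the pivot coordinates \<open>B\<close>. So if also \<open>w\<close> is in the kernel at \<open>p\<close>, then the
  Schur complement identity computes \<open>2 T w w w w\<close>: each element of \<open>B\<close> and of \<open>C\<close> contributes one
  linear condition on \<open>w\<close> and one product of quadratic forms in \<open>w\<close>.
\<close>

lemma quartic_decomposition:
  fixes T :: "nat \<Rightarrow> nat \<Rightarrow> nat \<Rightarrow> nat \<Rightarrow> 'a"
  assumes sym: "\<And>a b i l. T a b i l = T a b l i"
    and H: "finite H" "H \<subseteq> vanishing F" "\<forall>g\<in>vanishing F. locally_generated H g" "card H \<le> k"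
    and iso: "\<forall>\<^sub>F p in F. isotropic_point N k T p"
  shows "\<exists>(I :: (nat + nat) set) L q r. finite I \<and> card I \<le> 3 * k \<and>
    (\<forall>i\<in>I. form_fun N 1 (L i) \<and> form_fun N 2 (q i) \<and> form_fun N 2 (r i)) \<and>
    (\<forall>w. (\<forall>i\<in>I. L i w = 0) \<longrightarrow> 2 * quartic N T w = (\<Sum>i\<in>I. q i w * r i w))"
proof -
  let ?J = "{1..2 * N}" and ?P = "vanishing F" and ?M = "contraction N T"
  obtain B \<delta> f where B: "B \<subseteq> ?J" "finite B" "card B \<le> card H" and \<delta>: "\<delta> \<notin> ?P"
    and span: "\<forall>g\<in>?P. \<forall>j\<in>?J.
      \<delta> * partial_deriv j g - (\<Sum>b\<in>B. partial_deriv b g * partial_deriv j (f b)) \<in> ?P"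
    using ex_local_equations[OF H(1-3), of ?J] by (elim exE conjE)
  obtain C \<gamma> R m where C: "C \<subseteq> {1..N}" "finite C" "card C \<le> card {1..N}" "\<gamma> \<notin> ?P"
    and R: "\<And>b j. b \<in> C \<Longrightarrow> R b j = (\<Sum>i=1..N. m b i * ?M i j)"
    and piv: "\<And>b c. b \<in> C \<Longrightarrow> c \<in> C \<Longrightarrow> R b c - (if b = c then \<gamma> else 0) \<in> ?P"
    and row: "\<And>i j. i \<in> {1..N} \<Longrightarrow> j \<in> {1..N} \<Longrightarrow> \<gamma> * ?M i j - (\<Sum>b\<in>C. ?M i b * R b j) \<in> ?P"
    by (rule gauss_jordan[OF finite_atLeastAtMost, where J = "{1..N}" and h = ?M]) (rule that; assumption)
  (* the products of ?M with the kernel vectors below are combinations of the e i j *)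
  define e where "e i j = \<gamma> * ?M i j - (\<Sum>b\<in>C. ?M i b * R b j)" for i j
  have e: "e i j \<in> ?P" if "i \<in> {1..N}" "j \<in> {1..N}" for i j
    unfolding e_def using that by (rule row)
  define \<zeta> where "\<zeta> p \<xi> j = (if j \<in> B then - hess ?J \<xi> p (f j) / ev p \<delta> else 0)" for p \<xi> j
  have "\<forall>\<^sub>F p in F. \<forall>\<xi>. (\<forall>b\<in>B. D1 ?J \<xi> p (f b) = 0) \<longrightarrow>
      D1 ?J \<xi> p (e i j) = 0 \<and> D2 ?J \<xi> (\<zeta> p \<xi>) p (e i j) = 0"
    if "i \<in> {1..N}" "j \<in> {1..N}" for i j
    unfolding \<zeta>_def[abs_def]
    by (rule second_order_lift[OF _ B(1) \<delta> _ e[OF that]]) (use span in auto)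
  then have ev1: "\<forall>\<^sub>F p in F. \<forall>i\<in>{1..N}. \<forall>j\<in>{1..N}. \<forall>\<xi>. (\<forall>b\<in>B. D1 ?J \<xi> p (f b) = 0) \<longrightarrow>
      D1 ?J \<xi> p (e i j) = 0 \<and> D2 ?J \<xi> (\<zeta> p \<xi>) p (e i j) = 0"
    by (intro eventually_ball_finite ballI) auto
  have ev2: "\<forall>\<^sub>F p in F. \<forall>i\<in>{1..N}. \<forall>j\<in>{1..N}. ev p (e i j) = 0"
    using e by (intro eventually_ball_finite ballI in_vanishingD) auto
  have ev3: "\<forall>\<^sub>F p in F. \<forall>b\<in>C. \<forall>c\<in>C. ev p (R b c - (if b = c then \<gamma> else 0)) = 0"
    using piv C(2) by (intro eventually_ball_finite ballI in_vanishingD) auto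
  have "\<forall>\<^sub>F p in F. ev p \<gamma> \<noteq> 0 \<and> isotropic_point N k T p \<and>
      (\<forall>i\<in>{1..N}. \<forall>j\<in>{1..N}. ev p (e i j) = 0) \<and>
      (\<forall>b\<in>C. \<forall>c\<in>C. ev p (R b c - (if b = c then \<gamma> else 0)) = 0) \<and>
      (\<forall>i\<in>{1..N}. \<forall>j\<in>{1..N}. \<forall>\<xi>. (\<forall>b\<in>B. D1 ?J \<xi> p (f b) = 0) \<longrightarrow>
        D1 ?J \<xi> p (e i j) = 0 \<and> D2 ?J \<xi> (\<zeta> p \<xi>) p (e i j) = 0)"
    by (intro eventually_conj notin_vanishingD[OF C(4)] iso ev1 ev2 ev3)
  from eventually_happens'[OF nontrivial this] obtain p where
    p\<gamma>: "ev p \<gamma> \<noteq> 0" and piso: "isotropic_point N k T p"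
    and pe: "\<And>i j. i \<in> {1..N} \<Longrightarrow> j \<in> {1..N} \<Longrightarrow> ev p (e i j) = 0"
    and ppiv: "\<And>b c. b \<in> C \<Longrightarrow> c \<in> C \<Longrightarrow> ev p (R b c - (if b = c then \<gamma> else 0)) = 0"
    and plift: "\<And>i j \<xi>. i \<in> {1..N} \<Longrightarrow> j \<in> {1..N} \<Longrightarrow> \<forall>b\<in>B. D1 ?J \<xi> p (f b) = 0 \<Longrightarrow>
        D1 ?J \<xi> p (e i j) = 0 \<and> D2 ?J \<xi> (\<zeta> p \<xi>) p (e i j) = 0"
    by (elim exE conjE) (rule that; blast)
  define d where "d = ev p \<gamma>"
  define A where "A i j = ev p (?M i j)" for i j
  have cardC: "card C \<le> 2 * k"
  proof -
    obtain \<l> Q where Q: "Q \<subseteq> {1..N}" "card Q \<le> k"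
      and lift: "\<forall>y. \<exists>u. (\<forall>i. i \<notin> Q \<longrightarrow> u i = y i) \<and> (\<forall>m<k. (\<Sum>j=1..N. \<l> m j * u j) = 0)"
      and is0: "\<forall>u v. (\<forall>m<k. (\<Sum>j=1..N. \<l> m j * u j) = 0) \<longrightarrow> (\<forall>m<k. (\<Sum>j=1..N. \<l> m j * v j) = 0) \<longrightarrow>
        (\<Sum>i=1..N. \<Sum>l=1..N. u i * v l * A i l) = 0"
      using piso unfolding isotropic_point_def A_def by (elim exE conjE)
    show ?thesis
    proof (rule card_pivots_le[OF C(1) p\<gamma> _ _ Q spec[OF lift] is0[rule_format]])
      show "ev p (R b j) = (\<Sum>i=1..N. ev p (m b i) * A i j)" if "b \<in> C" for b j
        by (simp add: R[OF that] A_def)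
      show "ev p (R b c) = (if b = c then ev p \<gamma> else 0)" if "b \<in> C" "c \<in> C" for b c
        using ppiv[OF that] by (cases "b = c") auto
    qed auto
  qed
  define K where "K w l = \<gamma> * cst (w l) - (if l \<in> C then \<Sum>j=1..N. R l j * cst (w j) else 0)" for w l
  define y where "y w l = D1 ?J (doubled N w) p (K w l)" for w l
  define L where "L i w = (case i of Inl b \<Rightarrow> D1 ?J (doubled N w) p (f b)
    | Inr b \<Rightarrow> \<Sum>j=1..N. ev p (R b j) * w j)" for i w
  define q where "q i w = (case i of Inl b \<Rightarrow> hess ?J (doubled N w) p (f b) / ev p \<delta>
    | Inr b \<Rightarrow> 2 / d ^ 3 * (\<Sum>i=1..N. y w i * A i b))" for i w
  define r where "r i w = (case i of Inl b \<Rightarrow> correction_coeff N T p b w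
    | Inr b \<Rightarrow> \<Sum>j=1..N. ev p (R b j) * y w j)" for i w
  let ?I = "B <+> C"
  have fy: "form_fun N 2 (\<lambda>w. y w l)" if "l \<in> {1..N}" for l
  proof -
    have "y w l = D1 ?J (doubled N w) p \<gamma> * w l
        - (if l \<in> C then \<Sum>j=1..N. D1 ?J (doubled N w) p (R l j) * w j else 0)" for w
      by (simp add: y_def K_def D1_mult)
    moreover have "form_fun N 2 (\<lambda>w. D1 ?J (doubled N w) p \<gamma> * w l
        - (if l \<in> C then \<Sum>j=1..N. D1 ?J (doubled N w) p (R l j) * w j else 0))"
      using that
      by (cases "l \<in> C") (auto intro!: form_fun_diff form_fun_sum form_fun_2
          form_fun_D1 form_fun_coord simp del: One_nat_def)
    ultimately show ?thesis by simp
  qed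
  have forms: "form_fun N 1 (L i) \<and> form_fun N 2 (q i) \<and> form_fun N 2 (r i)" if "i \<in> ?I" for i
  proof (cases i)
    case (Inl b)
    then show ?thesis
      unfolding L_def[abs_def] q_def[abs_def] r_def[abs_def]
      by (auto intro!: form_fun_D1 form_fun_divc form_fun_hess form_fun_correction_coeff simp del: One_nat_def)
  next
    case (Inr b)
    have "form_fun N 1 (L i)"
      unfolding Inr L_def[abs_def] sum.case by (intro form_fun_sum form_fun_cmult form_fun_coord)
    moreover have "form_fun N 2 (q i)"
      unfolding Inr q_def[abs_def] sum.case by (intro form_fun_cmult form_fun_sum form_fun_multc fy)
    moreover have "form_fun N 2 (r i)"
      unfolding Inr r_def[abs_def] sum.case by (intro form_fun_sum form_fun_cmult fy)
    ultimately show ?thesis by blast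
  qed
  have main: "2 * quartic N T w = (\<Sum>i\<in>?I. q i w * r i w)" if w: "\<forall>i\<in>?I. L i w = 0" for w
  proof -
    let ?\<xi> = "doubled N w"
    define z where "z = \<zeta> p ?\<xi>"
    have tan: "\<forall>b\<in>B. D1 ?J ?\<xi> p (f b) = 0"
    proof
      fix b assume "b \<in> B"
      then have "L (Inl b) w = 0" using w by blast
      then show "D1 ?J ?\<xi> p (f b) = 0" by (simp add: L_def)
    qed
    have ker: "(\<Sum>j=1..N. ev p (R b j) * w j) = 0" if "b \<in> C" for b
    proof -
      have "L (Inr b) w = 0" using w that by blast
      then show ?thesis by (simp add: L_def)
    qed
    have MK: "(\<Sum>l=1..N. ?M i l * K w l) = (\<Sum>j=1..N. e i j * cst (w j))" for i
    proof -
      have "(\<Sum>l=1..N. ?M i l * (if l \<in> C then \<Sum>j=1..N. R l j * cst (w j) else 0))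
          = (\<Sum>l\<in>C. ?M i l * (\<Sum>j=1..N. R l j * cst (w j)))"
        by (rule sum.mono_neutral_cong_right) (use C in auto)
      also have "\<dots> = (\<Sum>j=1..N. (\<Sum>l\<in>C. ?M i l * R l j) * cst (w j))"
        unfolding sum_distrib_left sum_distrib_right by (subst sum.swap) (simp only: mult.assoc)
      finally show ?thesis
        by (simp add: K_def e_def right_diff_distrib left_diff_distrib sum_subtractf mult_ac)
    qed
    have Kp: "ev p (K w l) = d * w l" for l
      using ker[of l] by (simp add: K_def d_def)
    have Asym: "A i l = A l i" and A1sym: "D1 ?J ?\<xi> p (?M i l) = D1 ?J ?\<xi> p (?M l i)" for i l
    proof -
      have "?M i l = ?M l i" unfolding contraction_def by (simp only: sym[of _ _ i l])
      then show "A i l = A l i" "D1 ?J ?\<xi> p (?M i l) = D1 ?J ?\<xi> p (?M l i)"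
        unfolding A_def by simp_all
    qed
    have "d ^ 2 * (\<Sum>i=1..N. \<Sum>l=1..N. w i * w l * D2 ?J ?\<xi> z p (?M i l))
        = 2 * (\<Sum>i=1..N. \<Sum>l=1..N. y w i * A i l * y w l)"
    proof (rule schur_complement[where A' = "\<lambda>i l. D1 ?J ?\<xi> p (?M i l)"
          and z = "\<lambda>l. D2 ?J ?\<xi> z p (K w l)", OF Asym A1sym])
      fix i assume i: "i \<in> {1..N}"
      have "d * (\<Sum>l=1..N. A i l * w l) = ev p (\<Sum>l=1..N. ?M i l * K w l)"
        by (simp add: Kp A_def sum_distrib_left algebra_simps)
      also have "\<dots> = 0" unfolding MK using pe[OF i] by simp
      finally show "(\<Sum>l=1..N. A i l * w l) = 0" using p\<gamma> by (simp add: d_def)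
      have "(\<Sum>l=1..N. D1 ?J ?\<xi> p (?M i l) * (d * w l) + A i l * y w l)
          = D1 ?J ?\<xi> p (\<Sum>l=1..N. ?M i l * K w l)"
        by (simp add: D1_mult Kp A_def y_def)
      also have "\<dots> = 0" unfolding MK using plift[OF i _ tan] pe[OF i] by (simp add: D1_mult)
      finally show "(\<Sum>l=1..N. D1 ?J ?\<xi> p (?M i l) * (d * w l) + A i l * y w l) = 0" .
      have "(\<Sum>l=1..N. D2 ?J ?\<xi> z p (?M i l) * (d * w l) + 2 * D1 ?J ?\<xi> p (?M i l) * y w l
            + A i l * D2 ?J ?\<xi> z p (K w l)) = D2 ?J ?\<xi> z p (\<Sum>l=1..N. ?M i l * K w l)"
        by (simp add: D2_mult Kp A_def y_def)
      also have "\<dots> = 0"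
        unfolding MK using plift[OF i _ tan] pe[OF i] by (simp add: D2_mult z_def)
      finally show "(\<Sum>l=1..N. D2 ?J ?\<xi> z p (?M i l) * (d * w l) + 2 * D1 ?J ?\<xi> p (?M i l) * y w l
            + A i l * D2 ?J ?\<xi> z p (K w l)) = 0" .
    qed
    then have schur: "d ^ 2 * (2 * quartic N T w + (\<Sum>j\<in>?J. z j * correction_coeff N T p j w))
        = 2 * (\<Sum>i=1..N. \<Sum>l=1..N. y w i * A i l * y w l)"
      unfolding D2_contraction quadratic_form_D2 .
    have rank: "d * (\<Sum>i=1..N. \<Sum>l=1..N. y w i * A i l * y w l)
        = (\<Sum>b\<in>C. (\<Sum>i=1..N. y w i * A i b) * (\<Sum>j=1..N. ev p (R b j) * y w j))"
    proof -
      have step: "d * (y w i * A i l * y w l) = (\<Sum>b\<in>C. (y w i * A i b) * (ev p (R b l) * y w l))"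
        if "i \<in> {1..N}" "l \<in> {1..N}" for i l
      proof -
        have "d * A i l = (\<Sum>b\<in>C. A i b * ev p (R b l))"
          using pe[OF that] by (simp add: e_def d_def A_def)
        then have "y w i * (d * A i l) * y w l = (\<Sum>b\<in>C. (y w i * A i b) * (ev p (R b l) * y w l))"
          by (simp only: sum_distrib_left sum_distrib_right mult.assoc)
        then show ?thesis by (simp only: mult_ac)
      qed
      have "d * (\<Sum>i=1..N. \<Sum>l=1..N. y w i * A i l * y w l)
          = (\<Sum>i=1..N. \<Sum>l=1..N. \<Sum>b\<in>C. (y w i * A i b) * (ev p (R b l) * y w l))"
        unfolding sum_distrib_left by (intro sum.cong refl step)
      also have "\<dots> = (\<Sum>i=1..N. \<Sum>b\<in>C. \<Sum>l=1..N. (y w i * A i b) * (ev p (R b l) * y w l))"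
        by (rule sum.cong[OF refl]) (rule sum.swap)
      also have "\<dots> = (\<Sum>b\<in>C. \<Sum>i=1..N. \<Sum>l=1..N. (y w i * A i b) * (ev p (R b l) * y w l))"
        by (rule sum.swap)
      also have "\<dots> = (\<Sum>b\<in>C. (\<Sum>i=1..N. y w i * A i b) * (\<Sum>j=1..N. ev p (R b j) * y w j))"
        by (simp only: sum_product)
      finally show ?thesis .
    qed
    have corr: "(\<Sum>j\<in>?J. z j * correction_coeff N T p j w)
        = - (\<Sum>b\<in>B. q (Inl b) w * r (Inl b) w)"
    proof -
      have "(\<Sum>j\<in>?J. z j * correction_coeff N T p j w)
          = (\<Sum>b\<in>B. - (q (Inl b) w * r (Inl b) w))"
        by (rule sum.mono_neutral_cong_right) (use B in \<open>auto simp: z_def \<zeta>_def q_def r_def\<close>)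
      then show ?thesis by (simp add: sum_negf)
    qed
    have "d ^ 3 * (2 * quartic N T w - (\<Sum>b\<in>B. q (Inl b) w * r (Inl b) w))
        = d * (d ^ 2 * (2 * quartic N T w + (\<Sum>j\<in>?J. z j * correction_coeff N T p j w)))"
      unfolding corr by (simp add: power3_eq_cube power2_eq_square algebra_simps)
    also have "\<dots> = 2 * (\<Sum>b\<in>C. (\<Sum>i=1..N. y w i * A i b) * (\<Sum>j=1..N. ev p (R b j) * y w j))"
      unfolding schur rank[symmetric] by (simp only: mult_ac)
    also have "\<dots> = d ^ 3 * (\<Sum>b\<in>C. 2 / d ^ 3 *
        ((\<Sum>i=1..N. y w i * A i b) * (\<Sum>j=1..N. ev p (R b j) * y w j)))"
      unfolding sum_distrib_left[symmetric, of "2 / d ^ 3"] using p\<gamma> by (simp add: d_def)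
    also have "(\<Sum>b\<in>C. 2 / d ^ 3 *
        ((\<Sum>i=1..N. y w i * A i b) * (\<Sum>j=1..N. ev p (R b j) * y w j)))
        = (\<Sum>b\<in>C. q (Inr b) w * r (Inr b) w)"
      by (simp only: q_def r_def sum.case mult.assoc)
    finally have "2 * quartic N T w - (\<Sum>b\<in>B. q (Inl b) w * r (Inl b) w)
        = (\<Sum>b\<in>C. q (Inr b) w * r (Inr b) w)"
      using p\<gamma> by (simp add: d_def)
    then show ?thesis using B(2) C(2) by (simp add: sum.Plus algebra_simps)
  qed
  show ?thesis
  proof (intro exI conjI)
    show "finite ?I" using B(2) C(2) by simp
    show "card ?I \<le> 3 * k" using B C cardC H(4) by (simp add: card_Plus)
    show "\<forall>i\<in>?I. form_fun N 1 (L i) \<and> form_fun N 2 (q i) \<and> form_fun N 2 (r i)" using forms by blast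
    show "\<forall>w. (\<forall>i\<in>?I. L i w = 0) \<longrightarrow> 2 * quartic N T w = (\<Sum>i\<in>?I. q i w * r i w)" using main by blast
  qed
qed

end

section \<open>From values to collapses\<close>

lemma mpoly_eqI:
  assumes "infinite (UNIV :: 'a::field set)" "\<And>x. ev x p = ev x (q :: 'a mpoly)"
  shows "p = q"
  using ex_ev_nonzero[OF assms(1), of "p - q"] assms(2) by auto

lemma euler_ev:
  assumes "homog N d (p :: 'a::comm_ring_1 mpoly)"
  shows "of_nat d * ev x p = (\<Sum>i=1..N. x i * ev x (partial_deriv i p))"
proof -
  have "ev x (of_nat d :: 'a mpoly) = of_nat d" using ev_cst[of x "of_nat d"] by simp
  then show ?thesis using arg_cong[OF euler[OF assms], of "ev x"] by simp
qed

lemma form_fun_1_coeffs: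
  assumes "form_fun N 1 f"
  shows "\<exists>c. \<forall>w. f w = (\<Sum>j=1..N. c j * w j)"
proof -
  obtain p where p: "homog N 1 p" "\<And>w. f w = ev w p"
    using assms unfolding form_fun_def by blast
  define c where "c j = Poly_Mapping.lookup (partial_deriv j p) 0" for j
  have "homog N 0 (partial_deriv j p)" for j
    using p(1) by (intro homog_partial_deriv) simp
  then have "partial_deriv j p = cst (c j)" for j
    unfolding c_def by (rule homog_0_eq_cst)
  then have "f w = (\<Sum>j=1..N. c j * w j)" for w
    using euler_ev[OF p(1), of w] by (simp add: p(2) mult.commute)
  then show ?thesis by blast
qed

text \<open>
  Euler's identity writes a form as a combination of its partial derivatives. This reduces the
  difference of its values at \<open>x\<close> and \<open>\<pi> x\<close> to the differences of the coordinates and of the partial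
  derivatives, and so to forms of lower degree.
\<close>

lemma form_minus_substituted_form:
  fixes \<pi> :: "(nat \<Rightarrow> 'a::field) \<Rightarrow> nat \<Rightarrow> 'a"
  assumes \<pi>: "\<And>i. i \<in> {1..N} \<Longrightarrow> form_fun N 1 (\<lambda>x. \<pi> x i)"
    and diff: "\<And>i x. i \<in> {1..N} \<Longrightarrow> x i - \<pi> x i = (\<Sum>b\<in>B. c i b * lam b x)"
    and nz: "\<And>m. 0 < m \<Longrightarrow> m \<le> Suc d \<Longrightarrow> of_nat m \<noteq> (0 :: 'a)"
    and p: "homog N (Suc d) p"
  shows "\<exists>C. (\<forall>b\<in>B. form_fun N d (C b)) \<and> (\<forall>x. ev x p - ev (\<pi> x) p = (\<Sum>b\<in>B. lam b x * C b x))"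
proof -
  let ?P = "\<lambda>d p. \<exists>C. (\<forall>b\<in>B. form_fun N d (C b)) \<and>
    (\<forall>x. ev x p - ev (\<pi> x) p = (\<Sum>b\<in>B. lam b x * C b x))"
  have step: "?P d p"
    if p: "homog N (Suc d) p" and d: "of_nat (Suc d) \<noteq> (0 :: 'a)"
      and IH: "\<And>i. i \<in> {1..N} \<Longrightarrow> \<exists>C. (\<forall>b\<in>B. form_fun N d (\<lambda>x. \<pi> x i * C b x)) \<and>
        (\<forall>x. ev x (partial_deriv i p) - ev (\<pi> x) (partial_deriv i p) = (\<Sum>b\<in>B. lam b x * C b x))"
    for d and p :: "'a mpoly"
  proof -
    obtain C where C: "\<And>i b. i \<in> {1..N} \<Longrightarrow> b \<in> B \<Longrightarrow> form_fun N d (\<lambda>x. \<pi> x i * C i b x)"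
      and Cdiff: "\<And>i x. i \<in> {1..N} \<Longrightarrow>
        ev x (partial_deriv i p) - ev (\<pi> x) (partial_deriv i p) = (\<Sum>b\<in>B. lam b x * C i b x)"
    proof -
      have "\<forall>i\<in>{1..N}. \<exists>C. (\<forall>b\<in>B. form_fun N d (\<lambda>x. \<pi> x i * C b x)) \<and>
        (\<forall>x. ev x (partial_deriv i p) - ev (\<pi> x) (partial_deriv i p) = (\<Sum>b\<in>B. lam b x * C b x))"
        using IH by blast
      from bchoice[OF this] show thesis using that by blast
    qed
    define D where "D b x = (\<Sum>i=1..N. c i b * ev x (partial_deriv i p) + \<pi> x i * C i b x) / of_nat (Suc d)" for b x
    have "form_fun N d (D b)" if "b \<in> B" for b
      unfolding D_def[abs_def]
    proof (intro form_fun_divc form_fun_sum form_fun_add form_fun_cmult)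
      show "form_fun N d (\<lambda>x. ev x (partial_deriv i p))" for i
        unfolding form_fun_def using homog_partial_deriv[OF p] by blast
      show "form_fun N d (\<lambda>x. \<pi> x i * C i b x)" if "i \<in> {1..N}" for i
        using C that \<open>b \<in> B\<close> by blast
    qed
    moreover have "ev x p - ev (\<pi> x) p = (\<Sum>b\<in>B. lam b x * D b x)" for x
    proof -
      have "of_nat (Suc d) * (ev x p - ev (\<pi> x) p)
          = (\<Sum>i=1..N. x i * ev x (partial_deriv i p)) - (\<Sum>i=1..N. \<pi> x i * ev (\<pi> x) (partial_deriv i p))"
        unfolding right_diff_distrib euler_ev[OF p] ..
      also have "\<dots> = (\<Sum>i=1..N. (x i - \<pi> x i) * ev x (partial_deriv i p)
          + \<pi> x i * (ev x (partial_deriv i p) - ev (\<pi> x) (partial_deriv i p)))"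
        unfolding sum_subtractf[symmetric] by (intro sum.cong refl) (simp add: algebra_simps)
      also have "\<dots> = (\<Sum>i=1..N. \<Sum>b\<in>B. lam b x * (c i b * ev x (partial_deriv i p) + \<pi> x i * C i b x))"
      proof (rule sum.cong[OF refl])
        fix i assume i: "i \<in> {1..N}"
        show "(x i - \<pi> x i) * ev x (partial_deriv i p)
            + \<pi> x i * (ev x (partial_deriv i p) - ev (\<pi> x) (partial_deriv i p))
            = (\<Sum>b\<in>B. lam b x * (c i b * ev x (partial_deriv i p) + \<pi> x i * C i b x))"
          unfolding diff[OF i] Cdiff[OF i] sum_distrib_right sum_distrib_left sum.distrib[symmetric]
          by (intro sum.cong refl) (simp add: algebra_simps)
      qed
      also have "\<dots> = of_nat (Suc d) * (\<Sum>b\<in>B. lam b x * D b x)"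
      proof -
        have "of_nat (Suc d) * (lam b x * D b x)
            = (\<Sum>i=1..N. lam b x * (c i b * ev x (partial_deriv i p) + \<pi> x i * C i b x))" for b
          unfolding sum_distrib_left[symmetric] using d by (simp add: D_def del: of_nat_Suc)
        then show ?thesis unfolding sum_distrib_left[of "of_nat (Suc d)"] by (subst sum.swap) simp
      qed
      finally show ?thesis using d by (simp del: of_nat_Suc)
    qed
    ultimately show ?thesis by blast
  qed
  show ?thesis
    using nz p
  proof (induction d arbitrary: p)
    case 0
    show ?case
    proof (rule step[OF 0(2)])
      show "of_nat (Suc 0) \<noteq> (0 :: 'a)" by simp
      fix i
      have "partial_deriv i p = cst (Poly_Mapping.lookup (partial_deriv i p) 0)"
        by (rule homog_0_eq_cst[OF homog_partial_deriv[OF 0(2)]])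
      then obtain a where "partial_deriv i p = cst a" by blast
      then have "ev x (partial_deriv i p) - ev (\<pi> x) (partial_deriv i p) = 0" for x
        by simp
      then show "\<exists>C. (\<forall>b\<in>B. form_fun N 0 (\<lambda>x. \<pi> x i * C b x)) \<and>
        (\<forall>x. ev x (partial_deriv i p) - ev (\<pi> x) (partial_deriv i p) = (\<Sum>b\<in>B. lam b x * C b x))"
        by (intro exI[of _ "\<lambda>_ _. 0"]) simp
    qed
  next
    case (Suc d)
    show ?case
    proof (rule step[OF Suc.prems(2)])
      show "of_nat (Suc (Suc d)) \<noteq> (0 :: 'a)" by (rule Suc.prems(1)) simp_all
      fix i assume i: "i \<in> {1..N}"
      have "?P d (partial_deriv i p)"
      proof (rule Suc.IH)
        show "of_nat m \<noteq> (0 :: 'a)" if "0 < m" "m \<le> Suc d" for m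
          using Suc.prems(1)[of m] that by simp
      qed (rule homog_partial_deriv[OF Suc.prems(2)])
      then obtain C where C: "\<forall>b\<in>B. form_fun N d (C b)"
        "\<forall>x. ev x (partial_deriv i p) - ev (\<pi> x) (partial_deriv i p) = (\<Sum>b\<in>B. lam b x * C b x)"
        by (elim exE conjE)
      have "form_fun N (Suc d) (\<lambda>x. \<pi> x i * C b x)" if "b \<in> B" for b
        using form_fun_mult[OF \<pi>[OF i] bspec[OF C(1) that]] by simp
      then show "\<exists>C. (\<forall>b\<in>B. form_fun N (Suc d) (\<lambda>x. \<pi> x i * C b x)) \<and>
        (\<forall>x. ev x (partial_deriv i p) - ev (\<pi> x) (partial_deriv i p) = (\<Sum>b\<in>B. lam b x * C b x))"
        using C(2) by blast
    qed
  qed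
qed

text \<open>
  Solving the linear equations \<open>L\<close> for pivot coordinates gives a projection \<open>\<pi>\<close> onto the subspace. It
  changes each coordinate by a multiple of a linear form from their span, so the form differs from its
  composition with \<open>\<pi>\<close>, which is zero, by an element of the ideal of these linear forms.
\<close>

lemma form_vanishing_on_subspace:
  fixes p :: "'a::field mpoly"
  assumes I: "finite I" and L: "\<And>i. i \<in> I \<Longrightarrow> form_fun N 1 (L i)"
    and nz: "\<And>m. 0 < m \<Longrightarrow> m \<le> Suc d \<Longrightarrow> of_nat m \<noteq> (0 :: 'a)"
    and p: "homog N (Suc d) p" and van: "\<And>w. \<forall>i\<in>I. L i w = 0 \<Longrightarrow> ev w p = 0"
  shows "\<exists>(B :: nat set) lam C. finite B \<and> card B \<le> card I \<and>
    (\<forall>b\<in>B. form_fun N 1 (lam b) \<and> form_fun N d (C b)) \<and> (\<forall>x. ev x p = (\<Sum>b\<in>B. lam b x * C b x))"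
proof -
  have "\<forall>i\<in>I. \<exists>c. \<forall>w. L i w = (\<Sum>j=1..N. c j * w j)"
    using L form_fun_1_coeffs by blast
  then obtain h where h: "\<And>i w. i \<in> I \<Longrightarrow> L i w = (\<Sum>j=1..N. h i j * w j)"
    by metis
  let ?J = "{1..N}"
  obtain B f where B: "B \<subseteq> ?J" "finite B" "card B \<le> card I"
    and span: "\<forall>i\<in>I. \<forall>j\<in>?J. h i j = (\<Sum>b\<in>B. h i b * f b j)"
    and f: "\<forall>b\<in>B. \<forall>c\<in>B. f b c = (if b = c then 1 else 0)"
    using field_gauss_jordan[OF I, of ?J h] by (elim exE conjE)
  define \<pi> where "\<pi> x j = (if j \<in> B then - (\<Sum>l\<in>?J - B. f j l * x l) else x j)" for x :: "nat \<Rightarrow> 'a" and j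
  define lam where "lam b x = (\<Sum>j=1..N. f b j * x j)" for b and x :: "nat \<Rightarrow> 'a"
  have lam_form: "form_fun N 1 (lam b)" for b
    unfolding lam_def[abs_def] by (intro form_fun_sum form_fun_cmult form_fun_coord)
  have "ev (\<pi> x) p = 0" for x
  proof (rule van, rule ballI)
    fix i assume i: "i \<in> I"
    have "L i (\<pi> x) = (\<Sum>j=1..N. \<Sum>b\<in>B. h i b * (f b j * \<pi> x j))"
      unfolding h[OF i]
    proof (rule sum.cong[OF refl])
      fix j assume "j \<in> ?J"
      then have hj: "h i j = (\<Sum>b\<in>B. h i b * f b j)" using span i by blast
      show "h i j * \<pi> x j = (\<Sum>b\<in>B. h i b * (f b j * \<pi> x j))"
        by (subst hj) (simp only: sum_distrib_right mult.assoc)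
    qed
    also have "\<dots> = (\<Sum>b\<in>B. h i b * (\<Sum>j=1..N. f b j * \<pi> x j))"
      by (subst sum.swap) (simp only: sum_distrib_left)
    also have "\<dots> = 0"
    proof (rule sum.neutral, rule ballI)
      fix b assume "b \<in> B"
      then have "(\<Sum>j=1..N. f b j * \<pi> x j) = 0"
        unfolding \<pi>_def by (intro solve_pivots[OF _ B(1)]) (use f in auto)
      then show "h i b * (\<Sum>j=1..N. f b j * \<pi> x j) = 0" by simp
    qed
    finally show "L i (\<pi> x) = 0" .
  qed
  moreover have "\<exists>C. (\<forall>b\<in>B. form_fun N d (C b)) \<and>
      (\<forall>x. ev x p - ev (\<pi> x) p = (\<Sum>b\<in>B. lam b x * C b x))"
  proof (rule form_minus_substituted_form[OF _ _ nz p])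
    show "form_fun N 1 (\<lambda>x. \<pi> x i)" if "i \<in> ?J" for i
    proof (cases "i \<in> B")
      case True
      have "form_fun N 1 (\<lambda>x. - (\<Sum>l\<in>?J - B. f i l * x l))"
        by (intro form_fun_uminus form_fun_sum form_fun_cmult form_fun_coord) simp
      then show ?thesis using True by (simp add: \<pi>_def)
    next
      case False
      then show ?thesis using form_fun_coord[OF that] by (simp add: \<pi>_def)
    qed
    show "x i - \<pi> x i = (\<Sum>b\<in>B. (if b = i then 1 else 0) * lam b x)" if "i \<in> ?J" for i x
    proof -
      have "(\<Sum>b\<in>B. (if b = i then 1 else 0) * lam b x) = (\<Sum>b\<in>B. if b = i then lam b x else 0)"
        by (rule sum.cong) auto
      also have "\<dots> = (if i \<in> B then lam i x else 0)" using B(2) by simp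
      finally have eq: "(\<Sum>b\<in>B. (if b = i then 1 else 0) * lam b x) = \<dots>" .
      show ?thesis
      proof (cases "i \<in> B")
        case True
        have "lam i x = (\<Sum>j\<in>?J - B. f i j * x j) + (\<Sum>j\<in>B. f i j * x j)"
          unfolding lam_def by (rule sum.subset_diff) (use B in auto)
        also have "(\<Sum>j\<in>B. f i j * x j) = (\<Sum>j\<in>B. if j = i then x i else 0)"
          by (rule sum.cong) (use f True in auto)
        also have "\<dots> = x i" using B(2) True by simp
        finally show ?thesis unfolding eq using True by (simp add: \<pi>_def)
      next
        case False
        then show ?thesis unfolding eq by (simp add: \<pi>_def)
      qed
    qed
  qed
  ultimately obtain C where "\<forall>b\<in>B. form_fun N d (C b)" "\<forall>x. ev x p = (\<Sum>b\<in>B. lam b x * C b x)"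
    by auto
  then show ?thesis using B lam_form by (intro exI[of _ B] exI[of _ lam] exI[of _ C]) auto
qed

lemma has_collapse_of_sum:
  fixes G H :: "'i \<Rightarrow> 'a::comm_ring_1 mpoly"
  assumes F: "is_form N 4 F" and I: "finite I" "card I \<le> K" and eq: "F = (\<Sum>i\<in>I. G i * H i)"
    and forms: "\<And>i. i \<in> I \<Longrightarrow>
      homog N 1 (G i) \<and> homog N 3 (H i) \<or> homog N 2 (G i) \<and> homog N 2 (H i)"
  shows "has_collapse N K F"
proof -
  obtain g where g: "bij_betw g {1..card I} I"
    using ex_bij_betw_nat_finite_1[OF I(1)] by blast
  (* The zero polynomial has total degree 0, so a factor G = 0 would call for a factor H of degree 4;
     a product with a zero factor is therefore replaced by 0 * 0. *)
  define ok where "ok j \<longleftrightarrow> j \<in> {1..card I} \<and> G (g j) \<noteq> 0 \<and> H (g j) \<noteq> 0" for j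
  let ?G = "\<lambda>j. if ok j then G (g j) else 0" and ?H = "\<lambda>j. if ok j then H (g j) else 0"
  have "F = (\<Sum>j=1..card I. G (g j) * H (g j))"
    unfolding eq by (rule sum.reindex_bij_betw[OF g, symmetric])
  also have "\<dots> = (\<Sum>j=1..K. ?G j * ?H j)"
    by (rule sum.mono_neutral_cong_left) (use I(2) in \<open>auto simp: ok_def\<close>)
  finally have sum: "F = (\<Sum>j=1..K. ?G j * ?H j)" .
  have deg: "(?G j = 0 \<or> (\<exists>d. 0 < d \<and> d < total_degree F \<and> is_form N d (?G j))) \<and>
      (?H j = 0 \<or> is_form N (total_degree F - total_degree (?G j)) (?H j))" for j
  proof (cases "ok j")
    case True
    then have nz: "G (g j) \<noteq> 0" "H (g j) \<noteq> 0" and "g j \<in> I"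
      using g by (auto simp: ok_def bij_betw_def)
    from forms[OF this(3)] show ?thesis
    proof
      assume "homog N 1 (G (g j)) \<and> homog N 3 (H (g j))"
      then have "is_form N 1 (G (g j))" "is_form N 3 (H (g j))" using nz by (auto simp: is_form_iff)
      then show ?thesis
        using True total_degree_form[OF F] total_degree_form[of N 1 "G (g j)"] by (auto intro: exI[of _ 1])
    next
      assume "homog N 2 (G (g j)) \<and> homog N 2 (H (g j))"
      then have "is_form N 2 (G (g j))" "is_form N 2 (H (g j))" using nz by (auto simp: is_form_iff)
      then show ?thesis
        using True total_degree_form[OF F] total_degree_form[of N 2 "G (g j)"] by (auto intro: exI[of _ 2])
    qed
  qed simp
  show ?thesis unfolding has_collapse_def
    using sum deg by (intro exI[of _ ?G] exI[of _ ?H]) blast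
qed

lemma has_collapse_mono:
  assumes "has_collapse N k F" "k \<le> K"
  shows "has_collapse N K F"
proof -
  obtain G H where eq: "F = (\<Sum>i=1..k. G i * H i)"
    and deg: "\<forall>i\<in>{1..k}. (G i = 0 \<or> (\<exists>d. 0 < d \<and> d < total_degree F \<and> is_form N d (G i))) \<and>
      (H i = 0 \<or> is_form N (total_degree F - total_degree (G i)) (H i))"
    using assms(1) unfolding has_collapse_def by (elim exE conjE)
  let ?G = "\<lambda>i. if i \<le> k then G i else 0" and ?H = "\<lambda>i. if i \<le> k then H i else 0"
  have "F = (\<Sum>i=1..K. ?G i * ?H i)"
    unfolding eq by (rule sum.mono_neutral_cong_left) (use assms(2) in auto)
  then show ?thesis
    unfolding has_collapse_def using deg by (intro exI[of _ ?G] exI[of _ ?H]) auto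
qed

lemma form_fun_family:
  assumes "\<And>i. i \<in> I \<Longrightarrow> form_fun N d (q i)"
  obtains Q where "\<And>i. i \<in> I \<Longrightarrow> homog N d (Q i)" "\<And>i w. i \<in> I \<Longrightarrow> q i w = ev w (Q i)"
proof -
  have "\<forall>i\<in>I. \<exists>Q. homog N d Q \<and> (\<forall>w. q i w = ev w Q)"
    using assms unfolding form_fun_def by blast
  from bchoice[OF this] show thesis using that by blast
qed

lemma has_collapse_of_decomposition:
  fixes F :: "'a::field mpoly" and I :: "'i set"
  assumes inf: "infinite (UNIV :: 'a set)" and char: "(2 :: 'a) \<noteq> 0" "(3 :: 'a) \<noteq> 0"
    and F: "is_form N 4 F" and c: "c \<noteq> 0"
    and I: "finite I" "card I \<le> n"
    and forms: "\<forall>i\<in>I. form_fun N 1 (L i) \<and> form_fun N 2 (q i) \<and> form_fun N 2 (r i)"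
    and dec: "\<forall>w. (\<forall>i\<in>I. L i w = 0) \<longrightarrow> c * ev w F = (\<Sum>i\<in>I. q i w * r i w)"
  shows "has_collapse N (2 * n) F"
proof -
  obtain Q where Q: "\<And>i. i \<in> I \<Longrightarrow> homog N 2 (Q i)" "\<And>i w. i \<in> I \<Longrightarrow> q i w = ev w (Q i)"
    using form_fun_family[of I N 2 q] forms by blast
  obtain R where R: "\<And>i. i \<in> I \<Longrightarrow> homog N 2 (R i)" "\<And>i w. i \<in> I \<Longrightarrow> r i w = ev w (R i)"
    using form_fun_family[of I N 2 r] forms by blast
  define E where "E = F + cst (- 1 / c) * (\<Sum>i\<in>I. Q i * R i)"
  have "homog N 4 (Q i * R i)" if "i \<in> I" for i
    using homog_mult[OF Q(1)[OF that] R(1)[OF that]] by simp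
  then have E: "homog N (Suc 3) E"
    using F unfolding E_def by (auto simp: is_form_iff intro!: homog_add homog_cst_mult homog_sum)
  have evE: "ev w E = ev w F - (\<Sum>i\<in>I. q i w * r i w) / c" for w
    using Q(2) R(2) by (simp add: E_def sum_distrib_left sum_divide_distrib sum_negf)
  have nz: "of_nat m \<noteq> (0 :: 'a)" if "0 < m" "m \<le> Suc 3" for m
  proof -
    have "m = 1 \<or> m = 2 \<or> m = 3 \<or> m = 2 * 2" using that by linarith
    moreover have "of_nat (2 * 2) \<noteq> (0 :: 'a)"
      unfolding of_nat_mult of_nat_numeral using char(1) by (simp only: mult_eq_0_iff) simp
    moreover have "of_nat 1 \<noteq> (0 :: 'a)" "of_nat 2 \<noteq> (0 :: 'a)" "of_nat 3 \<noteq> (0 :: 'a)"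
      unfolding of_nat_numeral using char by simp_all
    ultimately show ?thesis by blast
  qed
  have "ev w E = 0" if "\<forall>i\<in>I. L i w = 0" for w
  proof -
    have "(\<Sum>i\<in>I. q i w * r i w) = c * ev w F" using dec that by simp
    then show ?thesis unfolding evE using c by simp
  qed
  note van = this
  obtain B :: "nat set" and lam C where B: "finite B" "card B \<le> card I"
    and lamC: "\<forall>b\<in>B. form_fun N 1 (lam b) \<and> form_fun N 3 (C b)"
    and evB: "\<forall>x. ev x E = (\<Sum>b\<in>B. lam b x * C b x)"
  proof -
    have "\<exists>(B :: nat set) lam C. finite B \<and> card B \<le> card I \<and>
        (\<forall>b\<in>B. form_fun N 1 (lam b) \<and> form_fun N 3 (C b)) \<and> (\<forall>x. ev x E = (\<Sum>b\<in>B. lam b x * C b x))"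
    proof (rule form_vanishing_on_subspace[OF I(1) _ nz E])
      show "form_fun N 1 (L i)" if "i \<in> I" for i using forms that by blast
      show "ev w E = 0" if "\<forall>i\<in>I. L i w = 0" for w by (rule van[OF that])
    qed
    then show thesis using that by blast
  qed
  obtain M where M: "\<And>b. b \<in> B \<Longrightarrow> homog N 1 (M b)" "\<And>b w. b \<in> B \<Longrightarrow> lam b w = ev w (M b)"
    using form_fun_family[of B N 1 lam] lamC by blast
  obtain D where D: "\<And>b. b \<in> B \<Longrightarrow> homog N 3 (D b)" "\<And>b w. b \<in> B \<Longrightarrow> C b w = ev w (D b)"
    using form_fun_family[of B N 3 C] lamC by blast
  define G where "G i = (case i of Inl b \<Rightarrow> M b | Inr i \<Rightarrow> cst (1 / c) * Q i)" for i
  define H where "H i = (case i of Inl b \<Rightarrow> D b | Inr i \<Rightarrow> R i)" for i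
  show ?thesis
  proof (rule has_collapse_of_sum[OF F])
    show "finite (B <+> I)" using B I by simp
    show "card (B <+> I) \<le> 2 * n" using B I by (simp add: card_Plus)
    show "F = (\<Sum>i\<in>B <+> I. G i * H i)"
    proof (rule mpoly_eqI[OF inf])
      fix x
      have "ev x F = ev x E + (\<Sum>i\<in>I. q i x * r i x) / c" by (simp add: evE)
      also have "ev x E = (\<Sum>b\<in>B. ev x (M b) * ev x (D b))"
        using evB M(2) D(2) by simp
      also have "(\<Sum>i\<in>I. q i x * r i x) / c = (\<Sum>i\<in>I. 1 / c * ev x (Q i) * ev x (R i))"
        unfolding sum_divide_distrib by (rule sum.cong) (simp_all add: Q(2) R(2))
      finally show "ev x F = ev x (\<Sum>i\<in>B <+> I. G i * H i)"
        using B(1) I(1) by (simp add: sum.Plus G_def H_def)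
    qed
    show "homog N 1 (G i) \<and> homog N 3 (H i) \<or> homog N 2 (G i) \<and> homog N 2 (H i)"
      if "i \<in> B <+> I" for i
      using that by (auto simp: G_def H_def M(1) D(1) Q(1) R(1) homog_cst_mult simp del: One_nat_def)
  qed
qed

section \<open>The tensor of a quartic form and its derivatives\<close>

definition deriv_tensor :: "'a::comm_ring_1 mpoly \<Rightarrow> nat \<Rightarrow> nat \<Rightarrow> nat \<Rightarrow> nat \<Rightarrow> 'a" where
  "deriv_tensor F a b i l =
    Poly_Mapping.lookup (partial_deriv l (partial_deriv i (partial_deriv b (partial_deriv a F)))) 0"

lemma deriv_tensor_sym:
  "deriv_tensor F a b i l = deriv_tensor F a b l i"
  "deriv_tensor F a b i l = deriv_tensor F a i b l"
  unfolding deriv_tensor_def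
  by (simp only: partial_deriv_commute[of l i]) (simp only: partial_deriv_commute[of i b])

lemma cubic_eq_tensor:
  assumes g: "homog N 3 (g :: 'a::comm_ring_1 mpoly)"
  shows "6 * ev x g = (\<Sum>b=1..N. \<Sum>i=1..N. \<Sum>l=1..N.
    Poly_Mapping.lookup (partial_deriv l (partial_deriv i (partial_deriv b g))) 0 * x b * x i * x l)"
proof -
  have g1: "homog N 2 (partial_deriv b g)" for b
    using homog_partial_deriv[of N 2 g b] g by (simp add: numeral_eq_Suc)
  have g2: "homog N 1 (partial_deriv i (partial_deriv b g))" for b i
    using homog_partial_deriv[of N 1 "partial_deriv b g" i] g1[of b] by (simp add: numeral_eq_Suc)
  have g3: "ev x (partial_deriv l (partial_deriv i (partial_deriv b g)))
      = Poly_Mapping.lookup (partial_deriv l (partial_deriv i (partial_deriv b g))) 0" for b i l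
  proof -
    have "homog N 0 (partial_deriv l (partial_deriv i (partial_deriv b g)))"
      using homog_partial_deriv[of N 0 "partial_deriv i (partial_deriv b g)" l] g2[of i b] by simp
    from homog_0_eq_cst[OF this] show ?thesis by (metis ev_cst)
  qed
  have "6 * ev x g = 2 * (of_nat 3 * ev x g)" by simp
  also have "\<dots> = (\<Sum>b=1..N. x b * (of_nat 2 * ev x (partial_deriv b g)))"
    unfolding euler_ev[OF g] sum_distrib_left by (rule sum.cong) (simp_all add: algebra_simps)
  also have "\<dots> = (\<Sum>b=1..N. x b * (\<Sum>i=1..N. x i * (of_nat 1 * ev x (partial_deriv i (partial_deriv b g)))))"
    unfolding euler_ev[OF g1] by simp
  also have "\<dots> = (\<Sum>b=1..N. x b * (\<Sum>i=1..N. x i * (\<Sum>l=1..N. x l *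
      Poly_Mapping.lookup (partial_deriv l (partial_deriv i (partial_deriv b g))) 0)))"
    unfolding euler_ev[OF g2] g3 by (rule refl)
  also have "\<dots> = (\<Sum>b=1..N. \<Sum>i=1..N. \<Sum>l=1..N.
    Poly_Mapping.lookup (partial_deriv l (partial_deriv i (partial_deriv b g))) 0 * x b * x i * x l)"
    by (simp only: sum_distrib_left mult_ac)
  finally show ?thesis .
qed

lemma quartic_eq_tensor:
  assumes F: "homog N 4 (F :: 'a::comm_ring_1 mpoly)"
  shows "24 * ev x F = quartic N (deriv_tensor F) x"
proof -
  have F1: "homog N 3 (partial_deriv a F)" for a
    using homog_partial_deriv[of N 3 F a] F by (simp add: numeral_eq_Suc)
  have "24 * ev x F = 6 * (of_nat 4 * ev x F)" by simp
  also have "\<dots> = (\<Sum>a=1..N. x a * (6 * ev x (partial_deriv a F)))"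
    unfolding euler_ev[OF F] sum_distrib_left by (rule sum.cong) (simp_all add: algebra_simps)
  also have "\<dots> = quartic N (deriv_tensor F) x"
    unfolding cubic_eq_tensor[OF F1] quartic_def deriv_tensor_def
    by (simp only: sum_distrib_left mult_ac)
  finally show ?thesis .
qed

definition directional :: "nat \<Rightarrow> 'a::field mpoly \<Rightarrow> (nat \<Rightarrow> 'a) \<Rightarrow> 'a mpoly" where
  "directional N F p = (\<Sum>a=1..N. scale_mpoly (p a) (partial_deriv a F))"

lemma homog_directional:
  assumes "homog N 4 F"
  shows "homog N 3 (directional N F p)"
  unfolding directional_def scale_mpoly_def
  using assms by (intro homog_sum homog_cst_mult homog_partial_deriv) (simp add: numeral_eq_Suc)

definition trilinear :: "nat \<Rightarrow> (nat \<Rightarrow> nat \<Rightarrow> nat \<Rightarrow> 'a::comm_ring_1) \<Rightarrow>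
    (nat \<Rightarrow> 'a) \<Rightarrow> (nat \<Rightarrow> 'a) \<Rightarrow> (nat \<Rightarrow> 'a) \<Rightarrow> 'a" where
  "trilinear N t x y z = (\<Sum>b=1..N. \<Sum>i=1..N. \<Sum>l=1..N. t b i l * x b * y i * z l)"

lemma trilinear_add:
  "trilinear N t (\<lambda>i. x i + x' i) y z = trilinear N t x y z + trilinear N t x' y z"
  "trilinear N t x (\<lambda>i. y i + y' i) z = trilinear N t x y z + trilinear N t x y' z"
  "trilinear N t x y (\<lambda>i. z i + z' i) = trilinear N t x y z + trilinear N t x y z'"
  unfolding trilinear_def by (simp_all only: sum.distrib[symmetric] distrib_left distrib_right)

lemma trilinear_polarization:
  assumes sym: "\<And>b i l. t b i l = t i b l" "\<And>b i l. t b i l = t b l i"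
  shows "6 * trilinear N t x y z =
    trilinear N t (\<lambda>i. x i + y i + z i) (\<lambda>i. x i + y i + z i) (\<lambda>i. x i + y i + z i)
    - trilinear N t (\<lambda>i. x i + y i) (\<lambda>i. x i + y i) (\<lambda>i. x i + y i)
    - trilinear N t (\<lambda>i. x i + z i) (\<lambda>i. x i + z i) (\<lambda>i. x i + z i)
    - trilinear N t (\<lambda>i. y i + z i) (\<lambda>i. y i + z i) (\<lambda>i. y i + z i)
    + trilinear N t x x x + trilinear N t y y y + trilinear N t z z z"
proof -
  have s1: "trilinear N t x y z = trilinear N t y x z" for x y z
    unfolding trilinear_def by (subst sum.swap) (simp only: sym(1) mult_ac)
  have s2: "trilinear N t x y z = trilinear N t x z y" for x y z
    unfolding trilinear_def
    by (rule sum.cong[OF refl], subst sum.swap) (simp only: sym(2) mult_ac)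
  have c: "trilinear N t y x x = trilinear N t x x y" "trilinear N t x y x = trilinear N t x x y" for x y
    using s1 s2 by metis+
  have d: "trilinear N t x z y = trilinear N t x y z" "trilinear N t y x z = trilinear N t x y z"
    "trilinear N t y z x = trilinear N t x y z" "trilinear N t z x y = trilinear N t x y z"
    "trilinear N t z y x = trilinear N t x y z"
    using s1 s2 by metis+
  show ?thesis
    unfolding trilinear_add c d by (simp add: c)
qed

text \<open>
  Two factors of positive degree whose product is cubic are a linear and a quadratic form. The
  equations \<open>\<l>\<close> are the linear ones among the factors of the collapse.
\<close>

lemma collapse_cubic_vanishes:
  assumes g: "homog N 3 (g :: 'a::comm_ring_1 mpoly)" and col: "has_collapse N k g"
  shows "\<exists>\<l>. \<forall>u. (\<forall>m<k. (\<Sum>j=1..N. \<l> m j * u j) = 0) \<longrightarrow> ev u g = 0"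
proof -
  obtain G H where eq: "g = (\<Sum>i=1..k. G i * H i)"
    and deg: "\<forall>i\<in>{1..k}. (G i = 0 \<or> (\<exists>d. 0 < d \<and> d < total_degree g \<and> is_form N d (G i))) \<and>
      (H i = 0 \<or> is_form N (total_degree g - total_degree (G i)) (H i))"
    using col unfolding has_collapse_def by (elim exE conjE)
  have tot: "total_degree g \<le> 3"
  proof (cases "g = 0")
    case True
    then show ?thesis by (simp add: total_degree_def)
  next
    case False
    then show ?thesis using total_degree_form[of N 3 g] g by (simp add: is_form_iff)
  qed
  have lin: "\<exists>c. \<forall>u. (\<Sum>j=1..N. c j * u j) = 0 \<longrightarrow> ev u p = 0" if "homog N 1 p" for p :: "'a mpoly"
  proof -
    have "form_fun N 1 (\<lambda>u. ev u p)" using that unfolding form_fun_def by blast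
    from form_fun_1_coeffs[OF this] show ?thesis by metis
  qed
  have "\<exists>c. \<forall>u. (\<Sum>j=1..N. c j * u j) = 0 \<longrightarrow> ev u (G i * H i) = 0" if i: "i \<in> {1..k}" for i
  proof (cases "G i = 0 \<or> H i = 0")
    case True
    then show ?thesis by (intro exI[of _ "\<lambda>_. 0"]) auto
  next
    case False
    then obtain d where d: "0 < d" "d < total_degree g" "is_form N d (G i)"
      and H: "is_form N (total_degree g - d) (H i)"
      using deg i total_degree_form by metis
    then have "homog N d (G i)" "homog N (total_degree g - d) (H i)" "d = 1 \<or> total_degree g - d = 1"
      using tot by (auto simp: is_form_iff)
    then obtain p where p: "p = G i \<or> p = H i" "homog N 1 p" by metis
    then obtain c where "\<forall>u. (\<Sum>j=1..N. c j * u j) = 0 \<longrightarrow> ev u p = 0" using lin by blast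
    then show ?thesis using p(1) by (intro exI[of _ c]) auto
  qed
  then have "\<forall>m\<in>{..<k}. \<exists>c. \<forall>u. (\<Sum>j=1..N. c j * u j) = 0 \<longrightarrow> ev u (G (Suc m) * H (Suc m)) = 0"
    by auto
  from bchoice[OF this] obtain \<l> where
    \<l>: "\<forall>m\<in>{..<k}. \<forall>u. (\<Sum>j=1..N. \<l> m j * u j) = 0 \<longrightarrow> ev u (G (Suc m) * H (Suc m)) = 0" by blast
  have "ev u g = 0" if u: "\<forall>m<k. (\<Sum>j=1..N. \<l> m j * u j) = 0" for u
  proof -
    have "ev u (G i * H i) = 0" if "i \<in> {1..k}" for i
    proof -
      have "i - 1 \<in> {..<k}" "Suc (i - 1) = i" using that by auto
      then show ?thesis using \<l> u by (metis lessThan_iff)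
    qed
    then show ?thesis unfolding eq ev_sum by (intro sum.neutral ballI)
  qed
  then show ?thesis by blast
qed


section \<open>Quartics all of whose derivatives collapse\<close>

text \<open>
  For \<open>p = (v, x)\<close>, the vector \<open>x\<close> lies in a subspace on which the derivative of \<open>F\<close> along \<open>v\<close>
  vanishes. The set \<open>Q\<close> is part of the data because the coordinates of \<open>x\<close> outside \<open>Q\<close> may then be
  prescribed, which bounds the codimension of the closure of these points by \<open>card Q\<close>.
\<close>

definition collapse_point :: "nat \<Rightarrow> nat \<Rightarrow> 'a::field mpoly \<Rightarrow> nat set \<Rightarrow> (nat \<Rightarrow> 'a) \<Rightarrow> bool" where
  "collapse_point N k F Q p \<longleftrightarrow> (\<exists>\<l>.
    (\<forall>y. \<exists>u. (\<forall>i. i \<notin> Q \<longrightarrow> u i = y i) \<and> (\<forall>m<k. (\<Sum>j=1..N. \<l> m j * u j) = 0)) \<and>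
    (\<forall>u. (\<forall>m<k. (\<Sum>j=1..N. \<l> m j * u j) = 0) \<longrightarrow> ev u (directional N F p) = 0) \<and>
    (\<forall>m<k. (\<Sum>j=1..N. \<l> m j * p (N + j)) = 0))"

text \<open>
  Polarization: a cubic form that vanishes on a subspace has a trilinear form that vanishes on it, and
  one of the three arguments may be the vector \<open>x\<close>, which is in the subspace.
\<close>

lemma isotropic_point_if_collapse_point:
  fixes F :: "'a::field mpoly"
  assumes char: "(2 :: 'a) \<noteq> 0" "(3 :: 'a) \<noteq> 0" and F: "homog N 4 F"
    and Q: "Q \<subseteq> {1..N}" "card Q \<le> k" and col: "collapse_point N k F Q p"
  shows "isotropic_point N k (deriv_tensor F) p"
proof -
  let ?T = "deriv_tensor F" and ?sol = "\<lambda>\<l> u. \<forall>m<k. (\<Sum>j=1..N. \<l> m j * u j) = 0"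
  obtain \<l> where lift: "\<forall>y. \<exists>u. (\<forall>i. i \<notin> Q \<longrightarrow> u i = y i) \<and> ?sol \<l> u"
    and van: "\<forall>u. ?sol \<l> u \<longrightarrow> ev u (directional N F p) = 0"
    and x: "?sol \<l> (\<lambda>b. p (N + b))"
    using col unfolding collapse_point_def by (elim exE conjE)
  define t where "t b i l = (\<Sum>a=1..N. p a * ?T a b i l)" for b i l
  have tsym: "t b i l = t i b l" "t b i l = t b l i" for b i l
    unfolding t_def
    by (simp only: deriv_tensor_sym(2)[of F _ b i]) (simp only: deriv_tensor_sym(1)[of F _ b i l])
  have six: "(6 :: 'a) \<noteq> 0"
  proof -
    have "(6 :: 'a) = 2 * 3" by simp
    then show ?thesis using char by (simp only: mult_eq_0_iff) simp
  qed
  have F1: "homog N 3 (partial_deriv a F)" for a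
    using homog_partial_deriv[of N 3 F a] F by (simp add: numeral_eq_Suc)
  have tri: "6 * ev u (directional N F p) = trilinear N t u u u" for u
  proof -
    have "6 * ev u (directional N F p) = (\<Sum>a=1..N. p a * (6 * ev u (partial_deriv a F)))"
      by (simp add: directional_def scale_mpoly_def sum_distrib_left algebra_simps)
    also have "\<dots> = (\<Sum>a=1..N. \<Sum>b=1..N. \<Sum>i=1..N. \<Sum>l=1..N. p a * ?T a b i l * u b * u i * u l)"
      unfolding cubic_eq_tensor[OF F1] deriv_tensor_def by (simp only: sum_distrib_left mult.assoc)
    also have "\<dots> = (\<Sum>b=1..N. \<Sum>i=1..N. \<Sum>l=1..N. \<Sum>a=1..N. p a * ?T a b i l * u b * u i * u l)"
      by (subst sum.swap, rule sum.cong[OF refl], subst sum.swap, rule sum.cong[OF refl], rule sum.swap)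
    also have "\<dots> = trilinear N t u u u"
      unfolding trilinear_def t_def by (simp only: sum_distrib_right)
    finally show ?thesis .
  qed
  have cube: "trilinear N t u u u = 0" if "?sol \<l> u" for u
    using van that unfolding tri[symmetric] by simp
  have add: "?sol \<l> (\<lambda>i. u i + v i)" if "?sol \<l> u" "?sol \<l> v" for u v
    using that by (simp add: distrib_left sum.distrib)
  have zero: "trilinear N t u v w = 0" if "?sol \<l> u" "?sol \<l> v" "?sol \<l> w" for u v w
  proof -
    have "6 * trilinear N t u v w = 0"
      unfolding trilinear_polarization[OF tsym]
      using cube[OF add[OF add[OF that(1,2)] that(3)]] cube[OF add[OF that(1,2)]]
        cube[OF add[OF that(1,3)]] cube[OF add[OF that(2,3)]] cube[OF that(1)] cube[OF that(2)] cube[OF that(3)]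
      by simp
    then show ?thesis using six by simp
  qed
  have "(\<Sum>i=1..N. \<Sum>l=1..N. u i * v l * ev p (contraction N ?T i l)) = 0"
    if "?sol \<l> u" "?sol \<l> v" for u v
  proof -
    have "(\<Sum>i=1..N. \<Sum>l=1..N. u i * v l * ev p (contraction N ?T i l))
        = (\<Sum>i=1..N. \<Sum>l=1..N. \<Sum>a=1..N. \<Sum>b=1..N. p a * ?T a b i l * p (N + b) * u i * v l)"
      unfolding contraction_def ev_sum ev_mult ev_cst ev_var sum_distrib_left by (simp only: mult_ac)
    also have "\<dots> = (\<Sum>a=1..N. \<Sum>b=1..N. \<Sum>i=1..N. \<Sum>l=1..N. p a * ?T a b i l * p (N + b) * u i * v l)"
      by (rule sum_pairs_swap)
    also have "\<dots> = (\<Sum>b=1..N. \<Sum>i=1..N. \<Sum>l=1..N. \<Sum>a=1..N. p a * ?T a b i l * p (N + b) * u i * v l)"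
      by (subst sum.swap, rule sum.cong[OF refl], subst sum.swap, rule sum.cong[OF refl], rule sum.swap)
    also have "\<dots> = trilinear N t (\<lambda>b. p (N + b)) u v"
      unfolding trilinear_def t_def by (simp only: sum_distrib_right)
    also have "\<dots> = 0" by (rule zero[OF x that])
    finally show ?thesis .
  qed
  then show ?thesis
    unfolding isotropic_point_def using Q lift by (intro exI[of _ \<l>] exI[of _ Q]) blast
qed

text \<open>
  If every \<open>Q\<close> had a polynomial \<open>d Q\<close> that vanishes at its collapse points, then the product of these
  finitely many polynomials would be nonzero at some point \<open>p\<close> whose derivative has a collapse. The
  collapse comes with a set \<open>Q\<close>, and changing only those coordinates of \<open>p\<close> on which \<open>d Q\<close> does not
  depend produces a collapse point for \<open>Q\<close>.
\<close>

lemma ex_dense_collapse_points: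
  fixes F :: "'a::field mpoly"
  assumes F: "homog N 4 F"
    and dense: "\<And>d :: 'a mpoly. d \<noteq> 0 \<Longrightarrow> \<exists>p. ev p d \<noteq> 0 \<and> has_collapse N k (directional N F p)"
  shows "\<exists>Q\<subseteq>{1..N}. card Q \<le> k \<and>
    (\<forall>d\<in>mpvars (- (+) N ` Q). d \<noteq> 0 \<longrightarrow> (\<exists>p. collapse_point N k F Q p \<and> ev p d \<noteq> 0))"
proof (rule ccontr)
  let ?\<Q> = "{Q. Q \<subseteq> {1..N} \<and> card Q \<le> k}"
  assume contra: "\<not> ?thesis"
  have "\<forall>Q\<in>?\<Q>. \<exists>d. d \<in> mpvars (- (+) N ` Q) \<and> d \<noteq> 0 \<and> (\<forall>p. collapse_point N k F Q p \<longrightarrow> ev p d = 0)"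
  proof
    fix Q assume "Q \<in> ?\<Q>"
    then have "\<not> (\<forall>d\<in>mpvars (- (+) N ` Q). d \<noteq> 0 \<longrightarrow> (\<exists>p. collapse_point N k F Q p \<and> ev p d \<noteq> 0))"
      using contra by simp
    then show "\<exists>d. d \<in> mpvars (- (+) N ` Q) \<and> d \<noteq> 0 \<and> (\<forall>p. collapse_point N k F Q p \<longrightarrow> ev p d = 0)"
      by blast
  qed
  then obtain d where
    d: "\<forall>Q\<in>?\<Q>. d Q \<in> mpvars (- (+) N ` Q) \<and> d Q \<noteq> 0 \<and> (\<forall>p. collapse_point N k F Q p \<longrightarrow> ev p (d Q) = 0)"
    by (rule bchoice[THEN exE])
  have fin: "finite ?\<Q>" by simp
  have "(\<Prod>Q\<in>?\<Q>. d Q) \<noteq> 0" unfolding prod_zero_iff[OF fin] using d by simp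
  from dense[OF this] obtain p where p: "ev p (\<Prod>Q\<in>?\<Q>. d Q) \<noteq> 0"
    and col: "has_collapse N k (directional N F p)" by (elim exE conjE)
  obtain \<l> where \<l>: "\<forall>u. (\<forall>m<k. (\<Sum>j=1..N. \<l> m j * u j) = 0) \<longrightarrow> ev u (directional N F p) = 0"
    using collapse_cubic_vanishes[OF homog_directional[OF F] col] by (elim exE)
  obtain Q where Q: "Q \<subseteq> {1..N}" "card Q \<le> card {..<k}"
    and lift: "\<forall>y. \<exists>u. (\<forall>j. j \<notin> Q \<longrightarrow> u j = y j) \<and> (\<forall>m\<in>{..<k}. (\<Sum>j=1..N. \<l> m j * u j) = 0)"
    using ex_pivots[where I = "{..<k}" and J = "{1..N}" and h = \<l>, OF finite_lessThan finite_atLeastAtMost]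
    by (elim exE conjE)
  then have QQ: "Q \<in> ?\<Q>" by simp
  obtain u where u: "\<forall>j. j \<notin> Q \<longrightarrow> u j = p (N + j)" "\<forall>m\<in>{..<k}. (\<Sum>j=1..N. \<l> m j * u j) = 0"
    using spec[OF lift, of "\<lambda>j. p (N + j)"] by (elim exE conjE)
  define p' where "p' j = (if j \<in> (+) N ` Q then u (j - N) else p j)" for j
  have p'x: "p' (N + j) = u j" for j using u(1) by (auto simp: p'_def)
  have "directional N F p' = directional N F p"
    unfolding directional_def by (rule sum.cong) (use Q(1) in \<open>auto simp: p'_def\<close>)
  then have "collapse_point N k F Q p'"
    unfolding collapse_point_def p'x using lift \<l> u(2) unfolding Ball_def lessThan_iff
    by (intro exI[of _ \<l>] conjI) simp_all
  then have "ev p' (d Q) = 0" using bspec[OF d QQ] by blast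
  moreover have "ev p' (d Q) = ev p (d Q)"
  proof (rule ev_cong)
    show "d Q \<in> mpvars (- (+) N ` Q)" using bspec[OF d QQ] by blast
    show "p' i = p i" if "i \<in> - (+) N ` Q" for i using that by (simp add: p'_def)
  qed
  moreover have "ev p (d Q) \<noteq> 0"
    using p QQ unfolding ev_prod prod_zero_iff[OF fin] by simp
  ultimately show False by simp
qed

text \<open>
  The collapse points for a suitable \<open>Q\<close> meet every principal open set in the coordinates outside \<open>Q\<close>,
  and these sets are closed under intersection. An ultrafilter that contains all of them is the generic
  point to which the decomposition of the quartic applies.
\<close>

lemma quartic_collapse_if_derivatives_collapse:
  fixes F :: "'a::field mpoly"
  assumes inf: "infinite (UNIV :: 'a set)" and char: "(2 :: 'a) \<noteq> 0" "(3 :: 'a) \<noteq> 0"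
    and F: "is_form N 4 F"
    and dense: "\<And>d :: 'a mpoly. d \<noteq> 0 \<Longrightarrow> \<exists>p. ev p d \<noteq> 0 \<and> has_collapse N k (directional N F p)"
  shows "has_collapse N (6 * k) F"
proof -
  have hF: "homog N 4 F" using F by (simp add: is_form_iff)
  let ?T = "deriv_tensor F"
  obtain Q where Q: "Q \<subseteq> {1..N}" "card Q \<le> k"
    and good: "\<And>d. d \<in> mpvars (- (+) N ` Q) \<Longrightarrow> d \<noteq> 0 \<Longrightarrow> \<exists>p. collapse_point N k F Q p \<and> ev p d \<noteq> 0"
  proof -
    have "\<exists>Q\<subseteq>{1..N}. card Q \<le> k \<and>
      (\<forall>d\<in>mpvars (- (+) N ` Q). d \<noteq> 0 \<longrightarrow> (\<exists>p. collapse_point N k F Q p \<and> ev p d \<noteq> 0))"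
      by (rule ex_dense_collapse_points[OF hF dense])
    then show thesis using that by blast
  qed
  let ?R = "mpvars (- (+) N ` Q) :: 'a mpoly set"
  define S where "S d = {p. collapse_point N k F Q p \<and> ev p d \<noteq> 0}" for d
  define \<D> where "\<D> = S ` (?R - {0})"
  have "\<exists>\<F>. \<F> \<noteq> bot \<and> (\<forall>A\<in>\<D>. \<forall>\<^sub>F p in \<F>. p \<in> A) \<and>
      (\<forall>P. (\<forall>\<^sub>F p in \<F>. P p) \<or> (\<forall>\<^sub>F p in \<F>. \<not> P p))"
  proof (rule ex_ultrafilter)
    have "1 \<in> ?R - {0}" by simp
    then show "\<D> \<noteq> {}" unfolding \<D>_def by blast
    show "{} \<notin> \<D>" unfolding \<D>_def S_def using good by blast
    fix A B assume "A \<in> \<D>" "B \<in> \<D>"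
    then obtain d e where AB: "A = S d" "B = S e" and de: "d \<in> ?R - {0}" "e \<in> ?R - {0}"
      unfolding \<D>_def by blast
    from de have "S (d * e) \<in> \<D>"
      unfolding \<D>_def by (intro imageI) (simp add: mpvars_mult)
    moreover have "S (d * e) \<subseteq> A \<inter> B" unfolding AB S_def by auto
    ultimately show "\<exists>C\<in>\<D>. C \<subseteq> A \<inter> B" by (rule bexI[rotated])
  qed
  then obtain \<F> where \<F>: "\<F> \<noteq> bot" and in\<D>: "\<forall>A\<in>\<D>. \<forall>\<^sub>F p in \<F>. p \<in> A"
    and ultra: "\<forall>P. (\<forall>\<^sub>F p in \<F>. P p) \<or> (\<forall>\<^sub>F p in \<F>. \<not> P p)"
    by (elim exE conjE)
  interpret generic_point \<F>
    by (rule generic_point.intro) (rule spec[OF ultra], rule \<F>)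
  have mem: "\<forall>\<^sub>F p in \<F>. collapse_point N k F Q p \<and> ev p d \<noteq> 0" if "d \<in> ?R" "d \<noteq> 0" for d
  proof -
    have "S d \<in> \<D>" unfolding \<D>_def using that by blast
    then have "\<forall>\<^sub>F p in \<F>. p \<in> S d" using in\<D> by blast
    then show ?thesis by (simp add: S_def)
  qed
  have "vanishing \<F> \<inter> ?R = {0}"
  proof -
    have "d = 0" if "d \<in> vanishing \<F>" "d \<in> ?R" for d
    proof (rule ccontr)
      assume "d \<noteq> 0"
      have "\<forall>\<^sub>F p in \<F>. False"
        using mem[OF that(2) \<open>d \<noteq> 0\<close>] in_vanishingD[OF that(1)] by eventually_elim simp
      then show False using \<F> by simp
    qed
    then show ?thesis by auto
  qed
  from locally_generated_mpoly[OF prime_ideal_axioms _ this]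
  obtain H where H: "finite H" "H \<subseteq> vanishing \<F>" "card H \<le> card ((+) N ` Q)"
    "\<forall>g\<in>vanishing \<F>. locally_generated H g"
    using finite_subset[OF Q(1)] by auto
  have "card ((+) N ` Q) \<le> k" using Q(2) by (simp add: card_image)
  then have Hk: "card H \<le> k" using H(3) by simp
  have "\<forall>\<^sub>F p in \<F>. isotropic_point N k ?T p"
    using mem[of 1]
    by (rule eventually_mono) (simp, simp, rule isotropic_point_if_collapse_point[OF char hF Q], simp)
  from quartic_decomposition[OF deriv_tensor_sym(1) H(1,2,4) Hk this]
  obtain I :: "(nat + nat) set" and L q r where I: "finite I" "card I \<le> 3 * k"
    and forms: "\<forall>i\<in>I. form_fun N 1 (L i) \<and> form_fun N 2 (q i) \<and> form_fun N 2 (r i)"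
    and dec: "\<forall>w. (\<forall>i\<in>I. L i w = 0) \<longrightarrow> 2 * quartic N ?T w = (\<Sum>i\<in>I. q i w * r i w)"
    by (elim exE conjE)
  have "(48 :: 'a) = 2 * (2 * (2 * (2 * 3)))" by simp
  then have c: "(48 :: 'a) \<noteq> 0" using char by (simp only: mult_eq_0_iff) simp
  have "has_collapse N (2 * (3 * k)) F"
  proof (rule has_collapse_of_decomposition[OF inf char F c I forms])
    have "2 * quartic N ?T w = 48 * ev w F" for w
      unfolding quartic_eq_tensor[OF hF, symmetric] by simp
    then show "\<forall>w. (\<forall>i\<in>I. L i w = 0) \<longrightarrow> 48 * ev w F = (\<Sum>i\<in>I. q i w * r i w)"
      using dec by simp
  qed
  then show ?thesis by simp
qed

section \<open>Zariski dense sets of derivatives\<close>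

lemma infinite_alg_closed: "infinite (UNIV :: 'a::alg_closed_field set)"
proof
  assume fin: "finite (UNIV :: 'a set)"
  let ?q = "\<Prod>a\<in>(UNIV :: 'a set). [:- a, 1:]"
  have "degree ?q = card (UNIV :: 'a set)"
    by (subst degree_prod_eq_sum_degree) auto
  then have "degree (?q + 1) = card (UNIV :: 'a set)"
    using fin by (subst degree_add_eq_left) (auto simp: card_gt_0_iff)
  then have "degree (?q + 1) > 0" using fin by (simp add: card_gt_0_iff)
  then obtain x where "poly (?q + 1) x = 0" using alg_closed_imp_poly_has_root by blast
  moreover have "poly ?q x = 0" using fin by (simp add: poly_prod prod_zero_iff)
  ultimately show False by simp
qed

lemma regular_function_on_line:
  fixes f :: "'a::field mpoly \<Rightarrow> 'a"
  assumes "f \<in> regular_functions scale_mpoly"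
  shows "\<exists>q. \<forall>t. f (x + scale_mpoly t y) = poly q t"
  using assms
proof induction
  case (const c)
  show ?case by (rule exI[of _ "[:c:]"]) simp
next
  case (linear l)
  interpret Vector_Spaces.linear scale_mpoly "(*)" l by (rule linear)
  show ?case by (rule exI[of _ "[:l x, l y:]"]) (simp add: add scale)
next
  case (add f g)
  then obtain p q where "\<forall>t. f (x + scale_mpoly t y) = poly p t" "\<forall>t. g (x + scale_mpoly t y) = poly q t"
    by blast
  then show ?case by (intro exI[of _ "p + q"]) simp
next
  case (mult f g)
  then obtain p q where "\<forall>t. f (x + scale_mpoly t y) = poly p t" "\<forall>t. g (x + scale_mpoly t y) = poly q t"
    by blast
  then show ?case by (intro exI[of _ "p * q"]) simp
qed

text \<open>A subspace is irreducible: two nonempty principal open sets meet on the line joining them.\<close>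

lemma zariski_dense_open_principal:
  fixes V :: "'a::field mpoly set"
  assumes inf: "infinite (UNIV :: 'a set)" and V: "mpoly.subspace V"
    and f: "f \<in> regular_functions scale_mpoly" and x: "x \<in> V" "f x \<noteq> 0"
  shows "zariski_dense_open scale_mpoly V {v \<in> V. f v \<noteq> 0}"
  unfolding zariski_dense_open_def
proof
  have "{v \<in> V. f v \<noteq> 0} = V - {v \<in> V. \<forall>g\<in>{f}. g v = 0}" by auto
  then show "openin (zariski_topology scale_mpoly V) {v \<in> V. f v \<noteq> 0}"
    unfolding openin_zariski_topology zariski_open_def using f by (intro exI[of _ "{f}"]) simp
  show "zariski_topology scale_mpoly V closure_of {v \<in> V. f v \<noteq> 0} = V"
  proof
    show "zariski_topology scale_mpoly V closure_of {v \<in> V. f v \<noteq> 0} \<subseteq> V"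
      using closure_of_subset_topspace[of "zariski_topology scale_mpoly V"]
      unfolding topspace_zariski_topology .
    show "V \<subseteq> zariski_topology scale_mpoly V closure_of {v \<in> V. f v \<noteq> 0}"
    proof
      fix y assume y: "y \<in> V"
      have "\<exists>z. z \<in> {v \<in> V. f v \<noteq> 0} \<and> z \<in> W"
        if yW: "y \<in> W" and W: "openin (zariski_topology scale_mpoly V) W" for W
      proof -
        obtain S where S: "S \<subseteq> regular_functions scale_mpoly" "W = V - {v \<in> V. \<forall>g\<in>S. g v = 0}"
          using W unfolding openin_zariski_topology zariski_open_def by blast
        then obtain g where g: "g \<in> S" "g y \<noteq> 0" using yW by blast
        obtain p where p: "\<forall>t. f (y + scale_mpoly t (x - y)) = poly p t"
          using regular_function_on_line[OF f] by blast
        obtain q where q: "\<forall>t. g (y + scale_mpoly t (x - y)) = poly q t"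
          using regular_function_on_line[of g] g(1) S(1) by blast
        have "poly p 1 = f x" unfolding p[rule_format, symmetric] by simp
        then have "poly p 1 \<noteq> 0" using x(2) by simp
        moreover have "poly q 0 = g y" unfolding q[rule_format, symmetric] by simp
        then have "poly q 0 \<noteq> 0" using g(2) by simp
        ultimately have "p * q \<noteq> 0" by auto
        then have fin: "finite {t. poly (p * q) t = 0}" by (rule poly_roots_finite)
        obtain t where t: "poly (p * q) t \<noteq> 0"
        proof -
          have "{t. poly (p * q) t = 0} \<noteq> UNIV" using fin inf by metis
          then show thesis using that by blast
        qed
        let ?z = "y + scale_mpoly t (x - y)"
        have "?z \<in> V"
          using V x(1) y by (intro mpoly.subspace_add mpoly.subspace_scale mpoly.subspace_diff)
        moreover have "f ?z \<noteq> 0" "g ?z \<noteq> 0" using t unfolding p[rule_format] q[rule_format] by simp_all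
        ultimately show ?thesis using g(1) unfolding S(2) by (intro exI[of _ ?z]) blast
      qed
      then show "y \<in> zariski_topology scale_mpoly V closure_of {v \<in> V. f v \<noteq> 0}"
        unfolding in_closure_of topspace_zariski_topology using y by blast
    qed
  qed
qed

lemma directional_add: "directional N F (\<lambda>a. p a + q a) = directional N F p + directional N F q"
  by (simp add: directional_def mpoly.scale_left_distrib sum.distrib)

lemma directional_diff: "directional N F (\<lambda>a. p a - q a) = directional N F p - directional N F q"
  by (simp add: directional_def mpoly.scale_left_diff_distrib sum_subtractf)

lemma directional_in_deriv_span: "directional N F p \<in> deriv_span N F"
  unfolding directional_def deriv_span_def
  by (intro mpoly.span_sum mpoly.span_scale mpoly.span_base) auto

text \<open>
  The map \<open>directional N F\<close> onto the span of the derivatives has a kernel if \<open>F\<close> depends on fewer than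
  \<open>N\<close> variables after a linear change. A section transports polynomial conditions on directions to
  regular functions of the derivative.
\<close>

lemma ex_linear_section:
  fixes F :: "'a::field mpoly"
  shows "\<exists>\<sigma>. (\<forall>a. Vector_Spaces.linear scale_mpoly (*) (\<sigma> a)) \<and>
    (\<forall>G\<in>deriv_span N F. directional N F (\<lambda>a. \<sigma> a G) = G)"
proof -
  let ?D = "(\<lambda>a. partial_deriv a F) ` {1..N}"
  obtain Bs where Bs: "Bs \<subseteq> ?D" "mpoly.independent Bs" "?D \<subseteq> mpoly.span Bs"
    using mpoly.maximal_independent_subset by blast
  have "\<forall>b\<in>Bs. \<exists>a. a \<in> {1..N} \<and> partial_deriv a F = b" using Bs(1) by blast
  from bchoice[OF this] obtain idx where
    idx: "\<forall>b\<in>Bs. idx b \<in> {1..N} \<and> partial_deriv (idx b) F = b" by blast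
  interpret vector_space "(*) :: 'a \<Rightarrow> 'a \<Rightarrow> 'a"
    by unfold_locales (auto simp: algebra_simps)
  interpret vp: vector_space_pair "scale_mpoly :: 'a \<Rightarrow> 'a mpoly \<Rightarrow> 'a mpoly" "(*) :: 'a \<Rightarrow> 'a \<Rightarrow> 'a" ..
  have "\<forall>a. \<exists>l. Vector_Spaces.linear scale_mpoly (*) l \<and> (\<forall>b\<in>Bs. l b = (if idx b = a then 1 else 0))"
    by (intro allI vp.linear_independent_extend Bs(2))
  from choice[OF this] obtain \<sigma> where lin: "\<And>a. Vector_Spaces.linear scale_mpoly (*) (\<sigma> a)"
    and \<sigma>: "\<And>a b. b \<in> Bs \<Longrightarrow> \<sigma> a b = (if idx b = a then 1 else 0)" by blast
  have add: "\<sigma> a (G + H) = \<sigma> a G + \<sigma> a H" and scale: "\<sigma> a (scale_mpoly c G) = c * \<sigma> a G" for a c G H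
  proof -
    interpret l: Vector_Spaces.linear scale_mpoly "(*)" "\<sigma> a" by (rule lin)
    show "\<sigma> a (G + H) = \<sigma> a G + \<sigma> a H" "\<sigma> a (scale_mpoly c G) = c * \<sigma> a G"
      by (simp_all add: l.add l.scale)
  qed
  have "directional N F (\<lambda>a. \<sigma> a G) = G" if "G \<in> deriv_span N F" for G
  proof -
    have "deriv_span N F \<subseteq> mpoly.span Bs"
      unfolding deriv_span_def using Bs(3) by (rule mpoly.span_minimal) (rule mpoly.subspace_span)
    with that have "G \<in> mpoly.span Bs" by blast
    then show ?thesis
    proof (induction rule: mpoly.span_induct_alt)
      case base
      have "\<sigma> a 0 = 0" for a using scale[of a 0 0] by simp
      then show ?case by (simp add: directional_def)
    next
      case (step c b G)
      have "directional N F (\<lambda>a. \<sigma> a b) = (\<Sum>a=1..N. if a = idx b then partial_deriv a F else 0)"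
        unfolding directional_def by (rule sum.cong) (use step(1) \<sigma> in auto)
      also have "\<dots> = b" using idx step(1) by (simp add: bspec[OF idx])
      finally have b: "directional N F (\<lambda>a. \<sigma> a b) = b" .
      have "directional N F (\<lambda>a. \<sigma> a (scale_mpoly c b + G))
          = directional N F (\<lambda>a. c * \<sigma> a b) + directional N F (\<lambda>a. \<sigma> a G)"
        by (simp only: add scale directional_add)
      also have "directional N F (\<lambda>a. c * \<sigma> a b) = scale_mpoly c (directional N F (\<lambda>a. \<sigma> a b))"
        by (simp add: directional_def mpoly.scale_sum_right)
      finally show ?case using b step(2) by simp
    qed
  qed
  then show ?thesis using lin by blast
qed

lemma regular_ev_section:
  fixes \<sigma> :: "nat \<Rightarrow> 'a::field mpoly \<Rightarrow> 'a"
  assumes "\<And>a. Vector_Spaces.linear scale_mpoly (*) (\<sigma> a)"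
  shows "(\<lambda>G. ev (\<lambda>a. \<sigma> a G + n a) d) \<in> regular_functions scale_mpoly"
proof (induction d rule: mpoly_induct)
  case (cst c)
  show ?case by (simp add: regular_functions.const)
next
  case (var a)
  show ?case by (simp add: regular_functions.add[OF regular_functions.linear[OF assms] regular_functions.const])
next
  case (add p q)
  then show ?case by (simp add: regular_functions.add)
next
  case (mult p q)
  then show ?case by (simp add: regular_functions.mult)
qed

text \<open>
  As \<open>F\<close> has no collapse with \<open>6 * k\<close> terms, some polynomial \<open>d\<close> vanishes at every direction whose
  derivative has a collapse with \<open>k\<close> terms. Where \<open>d\<close> is nonzero, the derivatives are strong. The shift
  \<open>n\<close> along the kernel of \<open>directional N F\<close> makes the section pass through a point \<open>p0\<close> with
  \<open>d\<close> nonzero, so the open set is not empty.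
\<close>

theorem strong_derivatives_dense:
  fixes F :: "'a::field mpoly"
  assumes inf: "infinite (UNIV :: 'a set)" and char: "(2 :: 'a) \<noteq> 0" "(3 :: 'a) \<noteq> 0"
    and F: "is_form N 4 F" and strong: "strong N (6 * k) F"
  shows "\<exists>U. zariski_dense_open scale_mpoly (deriv_span N F) U \<and> (\<forall>G\<in>U. strong N k G)"
proof -
  have "\<not> (\<forall>d :: 'a mpoly. d \<noteq> 0 \<longrightarrow> (\<exists>p. ev p d \<noteq> 0 \<and> has_collapse N k (directional N F p)))"
    using quartic_collapse_if_derivatives_collapse[OF inf char F] strong unfolding strong_def by blast
  then obtain d :: "'a mpoly" where "d \<noteq> 0"
    and d: "\<And>p. has_collapse N k (directional N F p) \<Longrightarrow> ev p d = 0" by blast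
  obtain p0 where p0: "ev p0 d \<noteq> 0" using ex_ev_nonzero[OF inf \<open>d \<noteq> 0\<close>] by blast
  let ?V = "deriv_span N F"
  obtain \<sigma> where lin: "\<And>a. Vector_Spaces.linear scale_mpoly (*) (\<sigma> a)"
    and \<sigma>: "\<And>G. G \<in> ?V \<Longrightarrow> directional N F (\<lambda>a. \<sigma> a G) = G"
    using ex_linear_section[of N F] by blast
  define G0 where "G0 = directional N F p0"
  have G0: "G0 \<in> ?V" unfolding G0_def by (rule directional_in_deriv_span)
  define n where "n a = p0 a - \<sigma> a G0" for a
  define f where "f G = ev (\<lambda>a. \<sigma> a G + n a) d" for G
  have "f \<in> regular_functions scale_mpoly"
    unfolding f_def[abs_def] by (rule regular_ev_section[OF lin])
  moreover have "f G0 \<noteq> 0" using p0 by (simp add: f_def n_def)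
  moreover have "mpoly.subspace ?V" unfolding deriv_span_def by (rule mpoly.subspace_span)
  ultimately have "zariski_dense_open scale_mpoly ?V {G \<in> ?V. f G \<noteq> 0}"
    using zariski_dense_open_principal[OF inf] G0 by blast
  moreover have "strong N k G" if "G \<in> {G \<in> ?V. f G \<noteq> 0}" for G
  proof -
    have "directional N F n = 0"
      unfolding n_def directional_diff \<sigma>[OF G0] by (simp add: G0_def)
    then have "directional N F (\<lambda>a. \<sigma> a G + n a) = G"
      using that \<sigma>[of G] by (simp add: directional_add)
    then show ?thesis using that d[of "\<lambda>a. \<sigma> a G + n a"] unfolding strong_def f_def by auto
  qed
  ultimately show ?thesis by blast
qed

theorem theorem1p19:
  assumes "CHAR('a::alg_closed_field) \<noteq> 2" and "CHAR('a) \<noteq> 3"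
  shows "(\<forall>N>0. \<forall>k>0. \<forall>F :: 'a mpoly.
            is_form N 4 F \<longrightarrow>
            strong N (6 * k * (k + 1) * 4 ^ (k * (k + 1)) + (k + 1)^2) F \<longrightarrow>
            (\<exists>U. zariski_dense_open scale_mpoly (deriv_span N F) U \<and> (\<forall>G\<in>U. strong N k G)))
         \<and> key_function TYPE('a) 4 {c. c \<noteq> 2 \<and> c \<noteq> 3}
             (\<lambda>k. 6 * k * (k + 1) * 4 ^ (k * (k + 1)) + (k + 1)^2)"
proof -
  have nz: "of_nat p \<noteq> (0 :: 'a)" if "p \<in> {2, 3}" for p
  proof
    assume "of_nat p = (0 :: 'a)"
    then have "CHAR('a) dvd p" by (simp only: of_nat_eq_0_iff_char_dvd)
    moreover from this have "CHAR('a) \<le> p" using that by (intro dvd_imp_le) auto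
    moreover have "CHAR('a) \<noteq> 1" using CHAR_not_1 by simp
    ultimately have "CHAR('a) = 0" using that assms by (cases "CHAR('a)") (auto simp: le_Suc_eq numeral_eq_Suc)
    then show False using \<open>CHAR('a) dvd p\<close> that by auto
  qed
  have char: "(2 :: 'a) \<noteq> 0" "(3 :: 'a) \<noteq> 0" using nz[of 2] nz[of 3] by simp_all
  have main: "\<exists>U. zariski_dense_open scale_mpoly (deriv_span N F) U \<and> (\<forall>G\<in>U. strong N k G)"
    if F: "is_form N 4 F" and strong: "strong N (6 * k * (k + 1) * 4 ^ (k * (k + 1)) + (k + 1)^2) F"
    for N k and F :: "'a mpoly"
  proof (rule strong_derivatives_dense[OF infinite_alg_closed char F])
    have "0 < (k + 1) * 4 ^ (k * (k + 1))" by simp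
    then have "6 * k * 1 \<le> 6 * k * ((k + 1) * 4 ^ (k * (k + 1)))"
      by (intro mult_le_mono2) linarith
    then have "6 * k \<le> 6 * k * (k + 1) * 4 ^ (k * (k + 1)) + (k + 1)^2"
      unfolding mult.assoc mult_1_right by (rule trans_le_add1)
    then show "strong N (6 * k) F" using strong has_collapse_mono unfolding strong_def by blast
  qed
  show ?thesis unfolding key_function_def using main by blast
qed

end
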